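(* Let $n\ge3$, $1\le j\le n-1$, and let $K_1,K_2,L_1,L_2$ be origin-symmetric convex bodies with non-empty interior in $\mathbb{R}^n$. If $K_1$ is the $j$-projection body of $L_1$ and $K_2$ is the $(n-j)$-projection body of $L_2$, then $$V(K_1[j],K_2[n-j])=V(L_1[n-j],L_2[j]).$$
   Context: For $1\le i\le n-1$, $K$ is called the $i$-projection body of $L$ if $\mathrm{vol}_i(K|E^\perp)=\mathrm{vol}_{n-i}(L|E)$ for every $(n-i)$-dimensional linear subspace $E$ ($K|E$ orthogonal projection). $V(K[j],L[n-j])$ denotes the mixed volume with $j$ copies of $K$ and $n-j$ copies of $L$, i.e. the coefficients in Minkowski's polynomial expansion $\mathrm{vol}_n(\lambda_1K_1+\dots+\lambda_mK_m)=\sum V(K_{i_1},\dots,K_{i_n})\lambda_{i_1}\cdots\lambda_{i_n}$ with symmetric coefficients. *)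

theory Defs
  imports "HOL-Analysis.Analysis"
begin

definition sym_convex_body :: "'a::euclidean_space set \<Rightarrow> bool" where
  "sym_convex_body K \<longleftrightarrow> compact K \<and> convex K \<and> interior K \<noteq> {} \<and> (\<forall>x\<in>K. - x \<in> K)"

definition orth_proj :: "'a::euclidean_space set \<Rightarrow> 'a \<Rightarrow> 'a" where
  "orth_proj E x = (THE y. y \<in> E \<and> (\<forall>z\<in>E. inner (x - y) z = 0))"

definition is_onb :: "'a::euclidean_space set \<Rightarrow> nat \<Rightarrow> (nat \<Rightarrow> 'a) \<Rightarrow> bool" where
  "is_onb E k b \<longleftrightarrow> (\<forall>i<k. b i \<in> E \<and> norm (b i) = 1) \<and>
     (\<forall>i<k. \<forall>j<k. i \<noteq> j \<longrightarrow> inner (b i) (b j) = 0) \<and> span (b ` {..<k}) = E"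

text \<open>k-dimensional Lebesgue measure of a subset A of a k-dimensional subspace E,
  computed in orthonormal coordinates of E (independent of the chosen basis).\<close>
definition vol_sub :: "nat \<Rightarrow> 'a::euclidean_space set \<Rightarrow> 'a set \<Rightarrow> real" where
  "vol_sub k E A = measure (PiM {..<k} (\<lambda>_. lborel))
     ((\<lambda>x. restrict (\<lambda>i. inner x ((SOME b. is_onb E k b) i)) {..<k}) ` A)"

definition is_proj_body :: "nat \<Rightarrow> 'a::euclidean_space set \<Rightarrow> 'a set \<Rightarrow> bool" where
  "is_proj_body i K L \<longleftrightarrow>
     (\<forall>E. subspace E \<and> dim E = DIM('a) - i \<longrightarrow>
        vol_sub i (orthogonal_comp E) (orth_proj (orthogonal_comp E) ` K) =
        vol_sub (DIM('a) - i) E (orth_proj E ` L))"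

text \<open>Mixed volume V(K[j], L[n-j]): by Minkowski's theorem,
  vol(s K + t L) = sum_j (n choose j) V(K[j],L[n-j]) s^j t^(n-j) for s,t \<ge> 0.\<close>
definition mixed_vol :: "'a::euclidean_space set \<Rightarrow> 'a set \<Rightarrow> nat \<Rightarrow> real" where
  "mixed_vol K L j = (THE c. \<exists>a::nat \<Rightarrow> real.
     (\<forall>s t. s \<ge> 0 \<longrightarrow> t \<ge> 0 \<longrightarrow>
        measure lebesgue {s *\<^sub>R x + t *\<^sub>R y | x y. x \<in> K \<and> y \<in> L} =
        (\<Sum>i\<le>DIM('a). real (DIM('a) choose i) * a i * s ^ i * t ^ (DIM('a) - i)))
     \<and> c = a j)"

end

theory Submission
  imports Defs
begin

text \<open>
Replacing a segment \<open>seg u\<close> by \<open>seg (t u)\<close> changes the volume of \<open>C + seg (t u)\<close> affinely, so the iterated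
difference \<open>mdiff us C\<close> of the volume along segments \<open>us\<close> is a nonnegative, monotone functional of the
convex body \<open>C\<close>; for orthonormal \<open>us\<close> it is the volume of the projection of \<open>C\<close> onto the orthogonal
complement of \<open>us\<close>. Support functions of symmetric bodies are uniform limits of differences of
support functions of zonotopes. Hence, for symmetric \<open>L\<close>, the volume of \<open>C + t L\<close> is a polynomial in
\<open>t\<close> and its coefficients are iterated limits of signed sums of \<open>mdiff us C\<close>.

With \<open>m = n - j\<close>, the hypotheses say that \<open>mdiff w K1\<close> and \<open>mdiff u L2\<close> are, up to \<open>m!\<close>, the iterated limits of the
kernel \<open>\<bar>det (u\<^sub>i \<bullet> w\<^sub>k)\<bar>\<close> over \<open>u\<close> from approximations of \<open>L1\<close> and over \<open>w\<close> from approximations of \<open>K2\<close>, respectively. The two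
mixed volumes are therefore the two orders of one double iterated limit. To interchange them, replace the kernel by
\<open>\<bar>det (A u\<^sub>i \<bullet> w\<^sub>k)\<bar>\<close> and average over matrices \<open>A\<close> near the identity against a polynomial: by orthogonal
invariance the averaged kernel has finite rank, where the interchange is pure linear algebra. Since both iterated
limits are continuous in \<open>A\<close>, equality of all polynomial moments gives equality at \<open>A = 1\<close>.
\<close>

section \<open>Iterated differences of volume along segments\<close>

text \<open>The obstacle is that the support function of a symmetric body need not come from a
  signed measure on directions. The total length of the approximating segments may grow without
  bound, so no domination or Fubini argument interchanges the two limits for the kernel itself. Only
  one argument at a time is under control, since each limit is the derivative of a volume. Averaging
  helps for two reasons. The entries of \<open>R ** A\<close> are bilinear, so a polynomial weight
  in \<open>R ** A\<close> is a finite sum of products of a function of \<open>R\<close> and a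
  function of \<open>A\<close>. And the determinant depends on \<open>w\<close> only through a
  scalar factor and one orthogonal matrix, which an invariant integral can absorb into the weight.
  The price is a parameter \<open>A\<close> in every limit. All limits are therefore taken uniformly
  over a compact set of matrices, so that they stay continuous in \<open>A\<close> and pass through
  the integral. The adjoint moves \<open>A\<close> from \<open>u\<close> to \<open>w\<close>; both
  orders then keep their form, with one body replaced by a linear image.\<close>

definition cconvex :: "'a::euclidean_space set \<Rightarrow> bool" where
  "cconvex C \<longleftrightarrow> compact C \<and> convex C"

text \<open>The segment is centred at the origin, so that zonotopes are origin-symmetric; its
  endpoints lie at half the length of \<open>u\<close>.\<close>

definition seg :: "'a::real_vector \<Rightarrow> 'a set" where
  "seg u = (\<lambda>t. t *\<^sub>R u) ` {- (1/2)..1/2 :: real}"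

definition zono :: "'a::real_vector list \<Rightarrow> 'a set" where
  "zono us = sum_list (map seg us)"

text \<open>For convex \<open>C\<close> in dimension n and k \<le> n vectors this is
  \<open>n! / (n - k)!\<close> times the mixed volume of n - k copies of \<open>C\<close> and the k
  segments: the volume is affine in the length of each segment, so the iterated difference is its
  multilinear coefficient.\<close>

primrec mdiff :: "'a::euclidean_space list \<Rightarrow> 'a set \<Rightarrow> real" where
  "mdiff [] C = measure lebesgue C"
| "mdiff (u # us) C = mdiff us (C + seg u) - mdiff us C"

lemma set_plus_iff: "x \<in> A + B \<longleftrightarrow> (\<exists>a\<in>A. \<exists>b\<in>B. x = a + b)"
  unfolding set_plus_def by blast

lemma zono_simps [simp]: "zono [] = {0}" "zono (u # us) = seg u + zono us"
  by (simp_all add: zono_def)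

lemma zero_mem_seg [simp]: "0 \<in> seg u"
  unfolding seg_def by (rule image_eqI[of _ _ 0]) auto

lemma zero_mem_zono [simp]: "0 \<in> zono us"
  by (induction us) (auto simp: set_plus_iff intro!: bexI[of _ 0])

lemma cconvex_plus: "cconvex C \<Longrightarrow> cconvex D \<Longrightarrow> cconvex (C + D)"
proof -
  assume "cconvex C" "cconvex D"
  moreover have "C + D = {x + y |x y. x \<in> C \<and> y \<in> D}" unfolding set_plus_def by blast
  ultimately show ?thesis using compact_sums[of C D] convex_set_plus[of C D] by (simp add: cconvex_def)
qed

lemma cconvex_linear_image: "linear f \<Longrightarrow> cconvex C \<Longrightarrow> cconvex (f ` C)"
  by (simp add: cconvex_def compact_continuous_image linear_continuous_on linear_conv_bounded_linear[THEN iffD1] convex_linear_image)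

lemma cconvex_seg [simp]: "cconvex (seg u)"
proof -
  have "linear (\<lambda>t::real. t *\<^sub>R u)"
    by (rule linear_scale_left)
  then show ?thesis
    unfolding seg_def by (intro cconvex_linear_image) (auto simp: cconvex_def)
qed

lemma cconvex_zono [simp]: "cconvex (zono us)"
  by (induction us) (auto simp: cconvex_plus, simp add: cconvex_def)

lemma cconvex_measurable: "cconvex C \<Longrightarrow> C \<in> lmeasurable"
  by (simp add: cconvex_def lmeasurable_compact)

lemma cconvex_scaleR: "cconvex C \<Longrightarrow> cconvex ((*\<^sub>R) t ` C)"
  by (simp add: cconvex_def compact_scaling convex_scaling)

lemma seg_linear_image: "linear f \<Longrightarrow> f ` seg u = seg (f u)"
  by (auto simp: seg_def linear_cmul image_image)

lemma set_plus_linear_image: "linear f \<Longrightarrow> f ` (A + B) = f ` A + f ` B"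
  by (force simp: set_plus_iff linear_add image_iff)

lemma zono_linear_image: "linear f \<Longrightarrow> f ` zono us = zono (map f us)"
  by (induction us) (auto simp: set_plus_linear_image seg_linear_image linear_0)

lemma subset_plus_right: "0 \<in> B \<Longrightarrow> A \<subseteq> A + (B :: 'a::monoid_add set)"
proof
  fix x assume "0 \<in> B" "x \<in> A"
  then have "x + 0 \<in> A + B" by blast
  then show "x \<in> A + B" by simp
qed

text \<open>The one-sided segment grows only at one end as \<open>s\<close> increases, which the
  increment argument for volumes needs; the translation does not affect volume.\<close>

lemma seg_scaleR_eq:
  assumes "s \<ge> 0"
  shows "seg (s *\<^sub>R u) = (+) (- ((s / 2) *\<^sub>R u)) ` ((\<lambda>t. t *\<^sub>R u) ` {0..s})"
proof (intro equalityI subsetI)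
  fix x assume "x \<in> seg (s *\<^sub>R u)"
  then obtain t where t: "- (1/2) \<le> t" "t \<le> 1/2" "x = t *\<^sub>R s *\<^sub>R u" by (auto simp: seg_def)
  have "x = - ((s / 2) *\<^sub>R u) + (s * t + s / 2) *\<^sub>R u"
    using t by (simp add: algebra_simps)
  moreover have "s * t \<ge> s * (- (1/2))" "s * t \<le> s * (1/2)"
    using t assms by (intro mult_left_mono; simp)+
  then have "s * t + s / 2 \<in> {0..s}" by auto
  ultimately show "x \<in> (+) (- ((s / 2) *\<^sub>R u)) ` ((\<lambda>t. t *\<^sub>R u) ` {0..s})" by blast
next
  fix x assume "x \<in> (+) (- ((s / 2) *\<^sub>R u)) ` ((\<lambda>t. t *\<^sub>R u) ` {0..s})"
  then obtain t where t: "0 \<le> t" "t \<le> s" "x = - ((s / 2) *\<^sub>R u) + t *\<^sub>R u" by auto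
  show "x \<in> seg (s *\<^sub>R u)"
  proof (cases "s = 0")
    case True
    then show ?thesis using t by simp
  next
    case False
    then have "x = (t / s - 1/2) *\<^sub>R s *\<^sub>R u" using t by (simp add: algebra_simps)
    moreover have "t / s - 1/2 \<in> {-(1/2)..1/2}" using t False assms by (auto simp: field_simps)
    ultimately show ?thesis unfolding seg_def by blast
  qed
qed

lemma seg_plus_seg:
  assumes "s \<ge> 0" "t \<ge> 0"
  shows "seg (s *\<^sub>R u) + seg (t *\<^sub>R u) = seg ((s + t) *\<^sub>R u)"
proof (intro equalityI subsetI)
  fix x assume "x \<in> seg (s *\<^sub>R u) + seg (t *\<^sub>R u)"
  then obtain a b where ab: "a \<in> {0..s}" "b \<in> {0..t}"
    "x = - ((s / 2) *\<^sub>R u) + a *\<^sub>R u + (- ((t / 2) *\<^sub>R u) + b *\<^sub>R u)"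
    using assms by (auto simp: set_plus_iff seg_scaleR_eq)
  then have "x = - (((s + t) / 2) *\<^sub>R u) + (a + b) *\<^sub>R u"
    by (simp add: algebra_simps add_divide_distrib)
  moreover have "a + b \<in> {0..s + t}" using ab by auto
  ultimately show "x \<in> seg ((s + t) *\<^sub>R u)" using assms by (force simp: seg_scaleR_eq)
next
  fix x assume "x \<in> seg ((s + t) *\<^sub>R u)"
  then obtain r where r: "- (1/2) \<le> r" "r \<le> 1/2" "x = r *\<^sub>R (s + t) *\<^sub>R u" by (auto simp: seg_def)
  then have "x = r *\<^sub>R s *\<^sub>R u + r *\<^sub>R t *\<^sub>R u" by (simp add: algebra_simps)
  then show "x \<in> seg (s *\<^sub>R u) + seg (t *\<^sub>R u)" using r by (force simp: seg_def set_plus_iff)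
qed

text \<open>Nonnegativity makes \<open>g\<close> monotone, so \<open>k * t\<close> can be trapped
  between consecutive integers. Thus \<open>k\<close> times the deviation from linearity stays below
  \<open>g 1\<close> for every \<open>k\<close>, and the deviation is zero.\<close>

lemma additive_nonneg_imp_linear:
  fixes g :: "real \<Rightarrow> real"
  assumes add: "\<And>s t. s \<ge> 0 \<Longrightarrow> t \<ge> 0 \<Longrightarrow> g (s + t) = g s + g t"
    and nn: "\<And>t. t \<ge> 0 \<Longrightarrow> g t \<ge> 0" and t: "t \<ge> 0"
  shows "g t = t * g 1"
proof -
  have mult: "g (real k * s) = real k * g s" if "s \<ge> 0" for k s
  proof (induction k)
    case 0
    then show ?case using add[of 0 0] by simp
  next
    case (Suc k)
    then show ?case using add[of "real k * s" s] that by (simp add: algebra_simps)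
  qed
  have mono: "g a \<le> g b" if "0 \<le> a" "a \<le> b" for a b
    using add[of a "b - a"] nn[of "b - a"] that by simp
  have bound: "real k * \<bar>g t - t * g 1\<bar> \<le> g 1" for k
  proof -
    define N where "N = nat \<lfloor>real k * t\<rfloor>"
    have N: "real N \<le> real k * t" "real k * t \<le> real N + 1"
      unfolding N_def using t by auto
    have "g (real N) \<le> g (real k * t)" "g (real k * t) \<le> g (real (Suc N))"
      using N t by (auto intro!: mono)
    then have "real N * g 1 \<le> real k * g t" "real k * g t \<le> (real N + 1) * g 1"
      using mult[of 1 N] mult[of 1 "Suc N"] mult[OF t, of k] by (auto simp: algebra_simps)
    moreover have "real N * g 1 \<le> real k * t * g 1" "real k * t * g 1 \<le> (real N + 1) * g 1"
      using N nn[of 1] by (auto intro: mult_right_mono)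
    ultimately have "\<bar>real k * g t - real k * t * g 1\<bar> \<le> g 1"
      by (auto simp: abs_le_iff algebra_simps)
    also have "real k * g t - real k * t * g 1 = real k * (g t - t * g 1)" by (simp add: algebra_simps)
    finally show ?thesis by (simp add: abs_mult)
  qed
  show ?thesis
  proof (rule ccontr)
    assume "g t \<noteq> t * g 1"
    then have "\<bar>g t - t * g 1\<bar> > 0" by simp
    then obtain k where "real k * \<bar>g t - t * g 1\<bar> > g 1" using reals_Archimedean3 by blast
    then show False using bound[of k] by simp
  qed
qed

text \<open>On every line parallel to \<open>u\<close> the set \<open>C + {0..s} u\<close> adds an interval of length \<open>s\<close> at the end
  of the chord of \<open>C\<close>, so consecutive increments are translates of each other.\<close>

lemma measure_plus_seg:
  assumes C: "cconvex C" and t: "t \<ge> 0"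
  shows "measure lebesgue (C + seg (t *\<^sub>R u)) =
    measure lebesgue C + t * (measure lebesgue (C + seg u) - measure lebesgue C)"
proof -
  define J where "J s = (\<lambda>t. t *\<^sub>R u) ` {0..s}" for s :: real
  have J0: "0 \<in> J s" if "s \<ge> 0" for s
    unfolding J_def using that by (intro image_eqI[of _ _ 0]) auto
  have JC: "cconvex (C + J s)" for s
    using C unfolding J_def
    by (intro cconvex_plus cconvex_linear_image linear_scale_left) (auto simp: cconvex_def)
  have tr: "measure lebesgue (C + seg (s *\<^sub>R u)) = measure lebesgue (C + J s)" if "s \<ge> 0" for s
  proof -
    have "C + seg (s *\<^sub>R u) = (+) (- ((s / 2) *\<^sub>R u)) ` (C + J s)"
      unfolding seg_scaleR_eq[OF that] J_def[symmetric]
    proof (intro equalityI subsetI)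
      fix x assume "x \<in> C + (+) (- ((s / 2) *\<^sub>R u)) ` J s"
      then obtain c y where "c \<in> C" "y \<in> J s" "x = c + (- ((s / 2) *\<^sub>R u) + y)"
        by (auto simp: set_plus_iff)
      then show "x \<in> (+) (- ((s / 2) *\<^sub>R u)) ` (C + J s)"
        by (intro image_eqI[of _ _ "c + y"]) auto
    next
      fix x assume "x \<in> (+) (- ((s / 2) *\<^sub>R u)) ` (C + J s)"
      then obtain c y where "c \<in> C" "y \<in> J s" "x = - ((s / 2) *\<^sub>R u) + (c + y)"
        by (auto simp: set_plus_iff)
      then have "x = c + (- ((s / 2) *\<^sub>R u) + y)" "c \<in> C" "y \<in> J s" by simp_all
      then show "x \<in> C + (+) (- ((s / 2) *\<^sub>R u)) ` J s" by blast
    qed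
    then show ?thesis by (simp only: measure_translation)
  qed
  have J_def': "x \<in> C + J s \<longleftrightarrow> (\<exists>c\<in>C. \<exists>r. 0 \<le> r \<and> r \<le> s \<and> x = c + r *\<^sub>R u)" for x s
    unfolding set_plus_iff J_def Bex_def image_iff atLeastAtMost_iff by blast
  have incr: "(C + J (s + t)) - (C + J s) = (+) (s *\<^sub>R u) ` ((C + J t) - C)"
    if st: "s \<ge> 0" "t \<ge> 0" for s t
  proof (intro equalityI subsetI)
    fix x assume "x \<in> (C + J (s + t)) - (C + J s)"
    then obtain c r where c: "c \<in> C" "0 \<le> r" "r \<le> s + t" "x = c + r *\<^sub>R u" and nx: "x \<notin> C + J s"
      by (auto simp: J_def')
    then have "r > s" unfolding J_def' using not_le by blast
    have "x - s *\<^sub>R u = c + (r - s) *\<^sub>R u" using c by (simp add: algebra_simps)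
    then have "x - s *\<^sub>R u \<in> C + J t"
      unfolding J_def' using c \<open>r > s\<close> by (intro bexI[of _ c] exI[of _ "r - s"]) auto
    moreover have "x - s *\<^sub>R u \<notin> C"
      using nx st by (auto simp: J_def') (metis add.commute diff_add_cancel order_refl)
    ultimately show "x \<in> (+) (s *\<^sub>R u) ` ((C + J t) - C)"
      by (intro image_eqI[of _ _ "x - s *\<^sub>R u"]) auto
  next
    fix x assume "x \<in> (+) (s *\<^sub>R u) ` ((C + J t) - C)"
    then obtain y c r where y: "x = s *\<^sub>R u + y" "y \<notin> C" "c \<in> C" "0 \<le> r" "r \<le> t" "y = c + r *\<^sub>R u"
      by (auto simp: J_def')
    have "x = c + (s + r) *\<^sub>R u" using y by (simp add: algebra_simps)
    then have "x \<in> C + J (s + t)"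
      using y st by (auto simp: J_def' simp del: scaleR_add_left intro!: bexI[of _ c] exI[of _ "s + r"])
    moreover have "x \<notin> C + J s"
    proof
      assume "x \<in> C + J s"
      then obtain c' r' where c': "c' \<in> C" "0 \<le> r'" "r' \<le> s" "x = c' + r' *\<^sub>R u" by (auto simp: J_def')
      define q where "q = s - r'"
      have q: "q \<ge> 0" "c' = y + q *\<^sub>R u"
        using c' y by (auto simp: q_def algebra_simps)
      have "r \<noteq> 0" using y(2,3,6) by auto
      then have "r + q \<noteq> 0" using y(4) q(1) by simp
      then have rq: "r + q > 0" using y q by simp
      \<comment> \<open>If \<open>x\<close> were already in \<open>C + J s\<close>, then
        \<open>y\<close> would lie on the chord from \<open>c\<close> to \<open>c'\<close>, hence in
        \<open>C\<close>.\<close>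
      have "y = (q / (r + q)) *\<^sub>R c + (r / (r + q)) *\<^sub>R c'"
      proof -
        have "(r + q) *\<^sub>R y = q *\<^sub>R c + r *\<^sub>R c'"
          unfolding q(2) using y(6) by (simp add: algebra_simps)
        then have "(1 / (r + q)) *\<^sub>R ((r + q) *\<^sub>R y) = (1 / (r + q)) *\<^sub>R (q *\<^sub>R c + r *\<^sub>R c')" by simp
        then show ?thesis using rq by (simp add: scaleR_add_right)
      qed
      moreover have "(q / (r + q)) *\<^sub>R c + (r / (r + q)) *\<^sub>R c' \<in> C"
        using C y(3,4) c'(1) q(1) rq unfolding cconvex_def
        by (intro convexD) (simp_all flip: add_divide_distrib add: add.commute)
      ultimately show False using y(2) by simp
    qed
    ultimately show "x \<in> (C + J (s + t)) - (C + J s)" by simp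
  qed
  have Jmono: "C + J s \<subseteq> C + J (s + t)" if "t \<ge> 0" for s t
    using that by (fastforce simp: J_def')
  define g where "g s = measure lebesgue (C + J s) - measure lebesgue C" for s
  have "g (s + t) = g s + g t" if "s \<ge> 0" "t \<ge> 0" for s t
  proof -
    have "measure lebesgue (C + J (s + t)) - measure lebesgue (C + J s) =
        measure lebesgue ((C + J (s + t)) - (C + J s))"
      unfolding infinity_ennreal_def
      by (intro measure_Diff[symmetric] fmeasurableD fmeasurableD2[folded infinity_ennreal_def] cconvex_measurable JC Jmono that)
    also have "\<dots> = measure lebesgue ((C + J t) - C)"
      using incr[OF that] by (simp only: measure_translation)
    also have "\<dots> = measure lebesgue (C + J t) - measure lebesgue C"
      by (intro measure_Diff fmeasurableD fmeasurableD2[folded infinity_ennreal_def] cconvex_measurable JC C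
          subset_plus_right J0 that)
    finally show ?thesis by (simp add: g_def)
  qed
  moreover have "g s \<ge> 0" if "s \<ge> 0" for s
    using JC C J0[OF that] unfolding g_def
    by (simp add: cconvex_measurable fmeasurableD measure_mono_fmeasurable subset_plus_right)
  ultimately have "g t = t * g 1" using t by (rule additive_nonneg_imp_linear)
  then show ?thesis using tr[OF t] tr[of 1] by (simp add: g_def)
qed

text \<open>Adding \<open>seg v\<close> commutes with adding the scaled segment, so every difference
  inherits the affine dependence on \<open>t\<close> from the volume.\<close>

lemma mdiff_plus_seg:
  assumes "cconvex C" "t \<ge> 0"
  shows "mdiff us (C + seg (t *\<^sub>R u)) = mdiff us C + t * mdiff (u # us) C"
  using assms
proof (induction us arbitrary: C)
  case Nil
  then show ?case by (simp add: measure_plus_seg)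
next
  case (Cons v us)
  have "C + seg (t *\<^sub>R u) + seg v = C + seg v + seg (t *\<^sub>R u)" by (simp add: ac_simps)
  then show ?case
    using Cons.IH[of C] Cons.IH[of "C + seg v"] Cons.prems
    by (simp add: cconvex_plus algebra_simps)
qed

text \<open>Nonnegativity of a difference is monotonicity one level lower, hence the joint
  induction. For monotonicity, add the segment of \<open>t *\<^sub>R u\<close> to both
  \<open>C\<close> and \<open>D\<close>: the values are affine in \<open>t\<close>, and the first
  stays below the second for all \<open>t \<ge> 0\<close>, so its slope is at most the other
  slope.\<close>

lemma mdiff_mono_nonneg:
  assumes "cconvex C" "cconvex D" "C \<subseteq> D"
  shows "0 \<le> mdiff us C \<and> mdiff us C \<le> mdiff us D"
  using assms
proof (induction us arbitrary: C D)
  case Nil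
  then show ?case
    by (auto intro!: measure_mono_fmeasurable simp: cconvex_measurable fmeasurableD)
next
  case (Cons u us)
  have nn: "0 \<le> mdiff (u # us) C"
    using Cons.IH[of C "C + seg u"] Cons.prems by (simp add: cconvex_plus subset_plus_right)
  have "t * (mdiff (u # us) C - mdiff (u # us) D) \<le> mdiff us D" if "t \<ge> 0" for t
  proof -
    have "mdiff us (C + seg (t *\<^sub>R u)) \<le> mdiff us (D + seg (t *\<^sub>R u))"
      using Cons.IH[of "C + seg (t *\<^sub>R u)" "D + seg (t *\<^sub>R u)"] Cons.prems
      by (simp add: cconvex_plus set_plus_mono2)
    then have "mdiff us C + t * mdiff (u # us) C \<le> mdiff us D + t * mdiff (u # us) D"
      using that Cons.prems by (simp only: mdiff_plus_seg)
    then show ?thesis using Cons.IH[of C C] Cons.prems by (simp add: algebra_simps)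
  qed
  then have *: "real k * (mdiff (u # us) C - mdiff (u # us) D) \<le> mdiff us D" for k by simp
  have "mdiff (u # us) C \<le> mdiff (u # us) D"
  proof (rule ccontr)
    assume "\<not> mdiff (u # us) C \<le> mdiff (u # us) D"
    then obtain k where "real k * (mdiff (u # us) C - mdiff (u # us) D) > mdiff us D"
      using reals_Archimedean3 by (metis diff_gt_0_iff_gt not_le)
    then show False using * not_le by blast
  qed
  with nn show ?case by blast
qed

lemma mdiff_nonneg: "cconvex C \<Longrightarrow> 0 \<le> mdiff us C"
  using mdiff_mono_nonneg[of C C us] by simp

lemma mdiff_mono: "cconvex C \<Longrightarrow> cconvex D \<Longrightarrow> C \<subseteq> D \<Longrightarrow> mdiff us C \<le> mdiff us D"
  using mdiff_mono_nonneg by blast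

lemma mdiff_append_Cons: "mdiff (us @ v # vs) C = mdiff (v # us @ vs) C"
  by (induction us arbitrary: C) (simp_all add: ac_simps)

lemma mdiff_le_measure: "cconvex C \<Longrightarrow> mdiff us C \<le> measure lebesgue (C + zono us)"
proof (induction us arbitrary: C)
  case (Cons u us)
  then show ?case
    using Cons.IH[of "C + seg u"] mdiff_nonneg[of C us] by (simp add: cconvex_plus add.assoc)
qed simp

lemma zono_subset_cball:
  assumes "\<And>u. u \<in> set us \<Longrightarrow> norm u \<le> R"
  shows "zono us \<subseteq> cball 0 (real (length us) * R)"
  using assms
proof (induction us)
  case (Cons u us)
  have "norm (x + y) \<le> R + real (length us) * R" if x: "x \<in> seg u" and y: "y \<in> zono us" for x y
  proof -
    obtain t where t': "t \<in> {- (1/2)..1/2}" "x = t *\<^sub>R u" using x unfolding seg_def by blast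
    then have t: "\<bar>t\<bar> \<le> 1/2" "x = t *\<^sub>R u" by (auto simp: abs_le_iff)
    have "norm x \<le> 1 * norm u" unfolding t(2) norm_scaleR using t(1) by (intro mult_right_mono) auto
    then have "norm x \<le> R" using Cons.prems[of u] by simp
    moreover have "norm y \<le> real (length us) * R" using Cons y by fastforce
    ultimately show ?thesis using norm_triangle_ineq[of x y] by linarith
  qed
  then show ?case by (fastforce simp: set_plus_iff algebra_simps)
qed simp

lemma mdiff_bound:
  fixes C :: "'a::euclidean_space set"
  assumes "cconvex C" "C \<subseteq> cball 0 R" "\<And>u. u \<in> set us \<Longrightarrow> norm u \<le> R"
  shows "mdiff us C \<le> measure lebesgue (cball (0::'a) (R + real (length us) * R))"
proof -
  have "C + zono us \<subseteq> cball 0 (R + real (length us) * R)"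
  proof
    fix z assume "z \<in> C + zono us"
    then obtain x y where xy: "x \<in> C" "y \<in> zono us" "z = x + y" by (auto simp: set_plus_iff)
    then have "norm x \<le> R" "norm y \<le> real (length us) * R"
      using assms zono_subset_cball[of us R] by fastforce+
    then show "z \<in> cball 0 (R + real (length us) * R)"
      using norm_triangle_ineq[of x y] xy by simp
  qed
  then have "measure lebesgue (C + zono us) \<le> measure lebesgue (cball (0::'a) (R + real (length us) * R))"
    using assms by (intro measure_mono_fmeasurable)
      (auto simp: cconvex_plus cconvex_measurable fmeasurableD lmeasurable_cball)
  then show ?thesis using mdiff_le_measure[OF assms(1), of us] by linarith
qed

section \<open>Homogeneity, vanishing and first-order estimates\<close>

lemma mdiff_scaleR_list:
  assumes "cconvex C" "t \<ge> 0"
  shows "mdiff (map ((*\<^sub>R) t) us) C = t ^ length us * mdiff us C"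
  using assms
proof (induction us arbitrary: C)
  case (Cons u us)
  have "mdiff (map ((*\<^sub>R) t) (u # us)) C = t ^ length us * (mdiff us (C + seg (t *\<^sub>R u)) - mdiff us C)"
    using Cons.IH[of C] Cons.IH[of "C + seg (t *\<^sub>R u)"] Cons.prems by (simp add: cconvex_plus algebra_simps)
  then show ?case using mdiff_plus_seg[OF Cons.prems, of us u] by simp
qed simp

lemma linear_scaleR_right: "linear ((*\<^sub>R) t :: 'a::real_vector \<Rightarrow> 'a)"
  by (simp add: linear_scale_self)

lemma mdiff_homothety:
  fixes C :: "'a::euclidean_space set"
  assumes "t \<ge> 0"
  shows "mdiff (map ((*\<^sub>R) t) us) ((*\<^sub>R) t ` C) = t ^ DIM('a) * mdiff us C"
proof (induction us arbitrary: C)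
  case Nil
  have "(\<lambda>x. t *\<^sub>R x + 0) ` C = (*\<^sub>R) t ` C" by auto
  then show ?case
    using measure_lebesgue_affine[where m=t and S=C and \<delta>=0] assms by simp
next
  case (Cons u us)
  have "(*\<^sub>R) t ` (C + seg u) = (*\<^sub>R) t ` C + seg (t *\<^sub>R u)"
    by (simp add: set_plus_linear_image linear_scaleR_right seg_linear_image)
  then show ?case using Cons[of C] Cons[of "C + seg u"] by (simp add: algebra_simps)
qed

text \<open>Scaling body and segments together multiplies by \<open>t ^ n\<close>, scaling the
  segments alone by \<open>t ^ length us\<close>; the quotient is left for the body.\<close>

lemma mdiff_scaleR_set:
  fixes C :: "'a::euclidean_space set"
  assumes "cconvex C" "t > 0" "length us \<le> DIM('a)"
  shows "mdiff us ((*\<^sub>R) t ` C) = t ^ (DIM('a) - length us) * mdiff us C"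
proof -
  have "t ^ length us * mdiff us ((*\<^sub>R) t ` C) = t ^ DIM('a) * mdiff us C"
    using mdiff_homothety[of t us C] mdiff_scaleR_list[of "(*\<^sub>R) t ` C" t us] assms
    by (simp add: cconvex_scaleR)
  also have "\<dots> = t ^ length us * (t ^ (DIM('a) - length us) * mdiff us C)"
    using assms by (simp flip: power_add)
  finally show ?thesis using assms by simp
qed

text \<open>Dilation by 2 fixes \<open>{0}\<close> but multiplies the value by a power of 2 greater
  than 1.\<close>

lemma mdiff_singleton_eq_0:
  assumes "length us < DIM('a::euclidean_space)"
  shows "mdiff us {0::'a} = 0"
proof -
  have "cconvex {0::'a}" by (simp add: cconvex_def)
  then have "mdiff us {0::'a} = 2 ^ (DIM('a) - length us) * mdiff us {0::'a}"
    using mdiff_scaleR_set[of "{0::'a}" 2 us] assms by simp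
  moreover have "(2::real) ^ (DIM('a) - length us) > 1" using assms by (intro one_less_power) auto
  ultimately show ?thesis by simp
qed

text \<open>Scaling the vectors by \<open>t\<close> multiplies the difference by
  \<open>t ^ length us\<close>, but the volume bounding it grows only like
  \<open>t ^ n\<close>.\<close>

lemma mdiff_eq_0_of_long:
  fixes C :: "'a::euclidean_space set"
  assumes C: "cconvex C" and len: "length us > DIM('a)"
  shows "mdiff us C = 0"
proof -
  obtain R1 where R1: "C \<subseteq> cball 0 R1"
    using C compact_imp_bounded[of C] by (auto simp: cconvex_def bounded_iff subset_iff)
  define R where "R = Max (insert \<bar>R1\<bar> (norm ` set us))"
  have R: "norm u \<le> R" if "u \<in> set us" for u unfolding R_def using that by (intro Max_ge) auto
  have "\<bar>R1\<bar> \<le> R" unfolding R_def by (intro Max_ge) auto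
  then have CR: "C \<subseteq> cball 0 R" and R0: "R \<ge> 0" using R1 by auto
  define V where "V = unit_ball_vol (DIM('a)) * (R + real (length us) * R) ^ DIM('a)"
  have bd: "t * mdiff us C \<le> V" if t: "t \<ge> 1" for t :: real
  proof -
    have "t ^ length us * mdiff us C = mdiff (map ((*\<^sub>R) t) us) C"
      using mdiff_scaleR_list[OF C, of t us] t by simp
    also have "\<dots> \<le> measure lebesgue (cball (0::'a) (t * R + real (length (map ((*\<^sub>R) t) us)) * (t * R)))"
    proof (intro mdiff_bound C)
      have "1 * R \<le> t * R" using t R0 by (intro mult_right_mono) auto
      then show "C \<subseteq> cball 0 (t * R)" using CR by auto
      show "norm u \<le> t * R" if "u \<in> set (map ((*\<^sub>R) t) us)" for u
        using that R t by (auto intro!: mult_left_mono)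
    qed
    also have "t * R + real (length (map ((*\<^sub>R) t) us)) * (t * R) = t * (R + real (length us) * R)"
      by (simp add: algebra_simps)
    also have "measure lebesgue (cball (0::'a) (t * (R + real (length us) * R))) = t ^ DIM('a) * V"
      using R0 t by (simp add: content_cball V_def power_mult_distrib)
    finally have "t ^ DIM('a) * (t ^ (length us - DIM('a)) * mdiff us C) \<le> t ^ DIM('a) * V"
      using len by (simp flip: power_add mult.assoc)
    then have "t ^ (length us - DIM('a)) * mdiff us C \<le> V" using t by simp
    moreover have "t * mdiff us C \<le> t ^ (length us - DIM('a)) * mdiff us C"
      using t len mdiff_nonneg[OF C] by (intro mult_right_mono self_le_power) auto
    ultimately show ?thesis by linarith
  qed
  have nn: "mdiff us C \<ge> 0" using mdiff_nonneg[OF C] .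
  show ?thesis
  proof (rule ccontr)
    assume "mdiff us C \<noteq> 0"
    then have pos: "mdiff us C > 0" using nn by simp
    define t where "t = \<bar>V\<bar> / mdiff us C + 1"
    have "t \<ge> 1" unfolding t_def using pos by simp
    moreover have "t * mdiff us C = \<bar>V\<bar> + mdiff us C" using pos by (simp add: t_def field_simps)
    ultimately show False using bd[of t] pos by linarith
  qed
qed

text \<open>An affine function of the length of a segment has vanishing second difference in the
  same direction.\<close>

lemma mdiff_repeat: "cconvex C \<Longrightarrow> u \<in> set us \<Longrightarrow> mdiff (u # us) C = 0"
proof -
  assume C: "cconvex C" and "u \<in> set us"
  then obtain xs ys where us: "us = xs @ u # ys" by (meson split_list)
  define vs where "vs = xs @ ys"
  have eq: "mdiff us D = mdiff (u # vs) D" for D unfolding us vs_def by (rule mdiff_append_Cons)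
  have "mdiff vs (C + seg u + seg u) = mdiff vs (C + seg (2 *\<^sub>R u))"
    using seg_plus_seg[of 1 1 u] by (simp add: add.assoc)
  also have "\<dots> = mdiff vs C + 2 * mdiff (u # vs) C" by (rule mdiff_plus_seg[OF C]) simp
  finally show ?thesis unfolding mdiff.simps(2)[of u us] eq by simp
qed

text \<open>When the segments are added one at a time, each contributes \<open>s\<close> times a
  difference at the sum reached so far; monotonicity bounds it below by the difference at
  \<open>C\<close>.\<close>

lemma mdiff_plus_zono_ge:
  assumes "cconvex C" "s \<ge> 0"
  shows "mdiff us C + s * (\<Sum>v\<leftarrow>vs. mdiff (v # us) C) \<le> mdiff us (C + zono (map ((*\<^sub>R) s) vs))"
  using assms
proof (induction vs)
  case (Cons v vs)
  let ?D = "C + zono (map ((*\<^sub>R) s) vs)"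
  have D: "cconvex ?D" using Cons.prems by (simp add: cconvex_plus)
  have "mdiff us (C + zono (map ((*\<^sub>R) s) (v # vs))) = mdiff us (?D + seg (s *\<^sub>R v))"
    by (simp add: ac_simps)
  also have "\<dots> = mdiff us ?D + s * mdiff (v # us) ?D" by (rule mdiff_plus_seg[OF D Cons.prems(2)])
  finally have "mdiff us (C + zono (map ((*\<^sub>R) s) (v # vs))) = mdiff us ?D + s * mdiff (v # us) ?D" .
  moreover have "s * mdiff (v # us) C \<le> s * mdiff (v # us) ?D"
    using Cons.prems D by (intro mult_left_mono mdiff_mono) (auto intro: subset_plus_right[THEN subsetD])
  ultimately show ?case using Cons by (simp add: algebra_simps del: mdiff.simps)
qed simp

text \<open>The same telescoping, with the differences at the intermediate sums bounded above by
  those at \<open>D\<close>.\<close>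

lemma mdiff_plus_zono_le:
  assumes "cconvex C" "s \<ge> 0" "cconvex D" "C + zono (map ((*\<^sub>R) s) vs) \<subseteq> D"
  shows "mdiff us (C + zono (map ((*\<^sub>R) s) vs)) \<le> mdiff us C + s * (\<Sum>v\<leftarrow>vs. mdiff (v # us) D)"
  using assms
proof (induction vs)
  case (Cons v vs)
  let ?E = "C + zono (map ((*\<^sub>R) s) vs)"
  have E: "cconvex ?E" using Cons.prems by (simp add: cconvex_plus)
  have EE: "C + zono (map ((*\<^sub>R) s) (v # vs)) = ?E + seg (s *\<^sub>R v)" by (simp add: ac_simps)
  have ED: "?E \<subseteq> D" using Cons.prems(4) unfolding EE using subset_plus_right[OF zero_mem_seg] by blast
  have "mdiff us (C + zono (map ((*\<^sub>R) s) (v # vs))) = mdiff us ?E + s * mdiff (v # us) ?E"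
    unfolding EE by (rule mdiff_plus_seg[OF E Cons.prems(2)])
  moreover have "s * mdiff (v # us) ?E \<le> s * mdiff (v # us) D"
    using Cons.prems E ED by (intro mult_left_mono mdiff_mono)
  ultimately show ?case using Cons.IH[OF Cons.prems(1-3) ED] by (simp add: algebra_simps del: mdiff.simps)
qed simp

lemma seg_mono:
  assumes "0 \<le> s" "s \<le> t"
  shows "seg (s *\<^sub>R u) \<subseteq> seg (t *\<^sub>R u)"
  using seg_plus_seg[of s "t - s" u] assms subset_plus_right[OF zero_mem_seg] by auto

lemma zono_scaleR_mono:
  assumes "0 \<le> s" "s \<le> t"
  shows "zono (map ((*\<^sub>R) s) us) \<subseteq> zono (map ((*\<^sub>R) t) us)"
proof (induction us)
  case (Cons u us)
  then show ?case unfolding list.map zono_simps by (intro set_plus_mono2 seg_mono assms)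
qed simp

lemma mdiff_scaleR_Cons:
  "cconvex C \<Longrightarrow> t \<ge> 0 \<Longrightarrow> mdiff ((t *\<^sub>R u) # us) C = t * mdiff (u # us) C"
  using mdiff_plus_seg[of C t us u] by simp

text \<open>The upper estimate is used twice: once for the value, and once to replace the slopes at
  the final sum by those at \<open>C\<close>, which costs a further factor \<open>s\<close>.\<close>

lemma mdiff_plus_zono_le_quadratic:
  assumes C: "cconvex C" and s: "0 \<le> s" "s \<le> 1"
    and B: "\<And>v w. v \<in> set vs \<Longrightarrow> w \<in> set vs \<Longrightarrow> mdiff (w # v # us) (C + zono vs) \<le> B"
  shows "mdiff us (C + zono (map ((*\<^sub>R) s) vs)) \<le>
    mdiff us C + s * (\<Sum>v\<leftarrow>vs. mdiff (v # us) C) + s\<^sup>2 * ((real (length vs))\<^sup>2 * B)"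
proof -
  let ?D = "C + zono (map ((*\<^sub>R) s) vs)"
  have sub: "?D \<subseteq> C + zono vs"
    using zono_scaleR_mono[of s 1 vs] s by (intro set_plus_mono2) (simp_all add: map_idI)
  have D: "cconvex ?D" using C by (simp add: cconvex_plus)
  have 1: "mdiff (v # us) ?D \<le> mdiff (v # us) C + s * (real (length vs) * B)" if v: "v \<in> set vs" for v
  proof -
    have "mdiff (v # us) ?D \<le> mdiff (v # us) C + s * (\<Sum>w\<leftarrow>vs. mdiff (w # v # us) (C + zono vs))"
      using C s sub by (intro mdiff_plus_zono_le) (auto simp: cconvex_plus)
    also have "(\<Sum>w\<leftarrow>vs. mdiff (w # v # us) (C + zono vs)) \<le> (\<Sum>w\<leftarrow>vs. B)"
      using B[OF v] by (intro sum_list_mono)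
    also have "(\<Sum>w\<leftarrow>vs. B) = real (length vs) * B" by (simp add: sum_list_triv)
    finally show ?thesis using s by (simp add: mult_left_mono)
  qed
  have "mdiff us ?D \<le> mdiff us C + s * (\<Sum>v\<leftarrow>vs. mdiff (v # us) ?D)"
    using C D s by (intro mdiff_plus_zono_le) auto
  also have "(\<Sum>v\<leftarrow>vs. mdiff (v # us) ?D) \<le> (\<Sum>v\<leftarrow>vs. mdiff (v # us) C + s * (real (length vs) * B))"
    using 1 by (intro sum_list_mono)
  also have "\<dots> = (\<Sum>v\<leftarrow>vs. mdiff (v # us) C) + real (length vs) * (s * (real (length vs) * B))"
    by (simp add: sum_list_addf sum_list_triv)
  finally have "mdiff us ?D \<le> mdiff us C +
      s * ((\<Sum>v\<leftarrow>vs. mdiff (v # us) C) + real (length vs) * (s * (real (length vs) * B)))"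
    using s by (simp add: mult_left_mono)
  then show ?thesis by (simp add: algebra_simps power2_eq_square del: mdiff.simps)
qed

text \<open>The centred segment of a vector of norm 2 ends at distance 1 from the origin, so this
  zonotope is the cube with coordinates in \<open>[-1, 1]\<close> and contains the unit
  ball.\<close>

definition cube_vecs :: "'a::euclidean_space list" where
  "cube_vecs = map ((*\<^sub>R) 2) (SOME xs. set xs = Basis \<and> distinct xs)"

lemma cube_vecs_basis:
  obtains xs :: "'a::euclidean_space list"
  where "set xs = Basis" "distinct xs" "length xs = DIM('a)" "cube_vecs = map ((*\<^sub>R) 2) xs"
proof -
  have "\<exists>xs :: 'a list. set xs = Basis \<and> distinct xs"
    using finite_distinct_list[of "Basis :: 'a set"] by simp
  from someI_ex[OF this] have 1: "set (SOME xs :: 'a list. set xs = Basis \<and> distinct xs) = Basis"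
    "distinct (SOME xs :: 'a list. set xs = Basis \<and> distinct xs)" by auto
  show ?thesis
    using that[OF 1 _ cube_vecs_def] distinct_card[OF 1(2)] unfolding 1(1) by simp
qed

lemma sum_list_mem_zono:
  assumes "\<And>u. u \<in> set us \<Longrightarrow> \<bar>c u\<bar> \<le> 1/2"
  shows "(\<Sum>u\<leftarrow>us. c u *\<^sub>R u) \<in> zono us"
  using assms
proof (induction us)
  case (Cons u us)
  have "\<bar>c u\<bar> \<le> 1/2" using Cons.prems by simp
  then have "c u *\<^sub>R u \<in> seg u" unfolding seg_def by (intro imageI) (simp add: abs_le_iff, linarith)
  then show ?case using Cons by (auto intro: set_plus_intro)
qed simp

lemma cball_subset_cube: "cball 0 1 \<subseteq> zono (cube_vecs :: 'a::euclidean_space list)"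
proof
  fix x :: 'a assume x: "x \<in> cball 0 1"
  obtain xs :: "'a list" where xs: "set xs = Basis" "distinct xs" "cube_vecs = map ((*\<^sub>R) 2) xs"
    using cube_vecs_basis by metis
  have ii: "\<bar>inner x (u /\<^sub>R 2)\<bar> / 2 \<le> 1/2" if "u \<in> set cube_vecs" for u
    using that x Basis_le_norm[of _ x] by (fastforce simp: xs)
  have "(\<Sum>u\<leftarrow>cube_vecs. (inner x (u /\<^sub>R 2) / 2) *\<^sub>R u) = (\<Sum>u\<leftarrow>xs. inner x u *\<^sub>R u)"
    by (simp add: xs(3) comp_def)
  also have "\<dots> = x" using xs by (simp add: sum_list_distinct_conv_sum_set euclidean_representation)
  finally show "x \<in> zono cube_vecs"
    using sum_list_mem_zono[of cube_vecs "\<lambda>u. inner x (u /\<^sub>R 2) / 2"] ii by simp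
qed

lemma norm_cube_vecs: "u \<in> set (cube_vecs :: 'a::euclidean_space list) \<Longrightarrow> norm u = 2"
  using cube_vecs_basis by (metis (no_types, lifting) abs_numeral ex_map_conv list.set_map image_iff mult.right_neutral norm_Basis norm_scaleR)

lemma length_cube_vecs: "length (cube_vecs :: 'a::euclidean_space list) = DIM('a)"
  using cube_vecs_basis by (metis length_map)

lemma scaleR_cball_subset_cube:
  assumes "r \<ge> 0"
  shows "cball 0 r \<subseteq> zono (map ((*\<^sub>R) r) (cube_vecs :: 'a::euclidean_space list))"
proof
  fix x :: 'a assume x: "x \<in> cball 0 r"
  show "x \<in> zono (map ((*\<^sub>R) r) cube_vecs)"
  proof (cases "r = 0")
    case True
    then show ?thesis using x by simp
  next
    case False
    then have "x /\<^sub>R r \<in> cball 0 1" using x assms by (simp add: field_simps)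
    then have "x /\<^sub>R r \<in> zono cube_vecs" using cball_subset_cube by blast
    then have "r *\<^sub>R (x /\<^sub>R r) \<in> (*\<^sub>R) r ` zono cube_vecs" by blast
    then show ?thesis using False by (simp add: zono_linear_image linear_scaleR_right)
  qed
qed

section \<open>First-order expansion along a symmetric body\<close>

lemma plus_subset_cball:
  "A \<subseteq> cball 0 r \<Longrightarrow> B \<subseteq> cball 0 s \<Longrightarrow> A + B \<subseteq> cball (0::'a::real_normed_vector) (r + s)"
  by (force simp: set_plus_iff dist_norm intro: norm_triangle_le add_mono)

definition ball_bound :: "'a::euclidean_space itself \<Rightarrow> real \<Rightarrow> nat \<Rightarrow> real" where
  "ball_bound T R l = measure lebesgue (cball (0::'a) (R + real l * R))"

lemma ball_bound_nonneg: "0 \<le> ball_bound T R l"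
  by (simp add: ball_bound_def)

lemma mdiff_le_ball_bound:
  "cconvex C \<Longrightarrow> C \<subseteq> cball 0 R \<Longrightarrow> (\<And>u. u \<in> set us \<Longrightarrow> norm u \<le> R) \<Longrightarrow> length us = l \<Longrightarrow>
    mdiff us (C::'a::euclidean_space set) \<le> ball_bound TYPE('a) R l"
  using mdiff_bound[of C R us] by (simp add: ball_bound_def)

text \<open>The support function of \<open>L\<close> is, up to \<open>\<epsilon>\<close>, the difference of those of \<open>zono zp\<close> and \<open>zono zn\<close>; a cube serves
as unit ball because it is itself a zonotope.\<close>

definition zono_approx :: "'a::euclidean_space set \<Rightarrow> real \<Rightarrow> 'a list \<Rightarrow> 'a list \<Rightarrow> bool" where
  "zono_approx L \<epsilon> zp zn \<longleftrightarrow> 0 \<le> \<epsilon> \<and> \<epsilon> \<le> 1 \<and>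
     L + zono zn \<subseteq> zono (zp @ map ((*\<^sub>R) \<epsilon>) cube_vecs) \<and>
     zono zp \<subseteq> L + zono (zn @ map ((*\<^sub>R) \<epsilon>) cube_vecs)"

text \<open>The inclusions of \<open>zono_approx\<close>, scaled by \<open>s\<close>, compare
  \<open>C + s L\<close> with sums of segments, where the estimates above apply. The order of the
  constants matters: the factor of \<open>s * \<epsilon>\<close> depends on neither
  \<open>zp\<close> nor \<open>zn\<close>, whereas \<open>K\<close> may depend on both. Hence
  \<open>s\<close> can tend to 0 for a fixed approximation, and only the error in \<epsilon>
  remains.\<close>

lemma mdiff_first_order:
  fixes L :: "'a::euclidean_space set"
  assumes L: "cconvex L" "0 \<in> L" "L \<subseteq> cball 0 \<rho>"
    and ap: "zono_approx L \<epsilon> zp zn"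
    and R: "0 \<le> R"
  shows "\<exists>K\<ge>0. \<forall>C us s. cconvex C \<longrightarrow> C \<subseteq> cball 0 R \<longrightarrow> (\<forall>u\<in>set us. norm u \<le> R) \<longrightarrow> length us = l \<longrightarrow>
     0 \<le> s \<longrightarrow> s \<le> 1 \<longrightarrow>
     \<bar>mdiff us (C + (*\<^sub>R) s ` L) - mdiff us C
       - s * ((\<Sum>v\<leftarrow>zp. mdiff (v # us) C) - (\<Sum>v\<leftarrow>zn. mdiff (v # us) C))\<bar>
     \<le> s * \<epsilon> * (real DIM('a) * ball_bound TYPE('a) (R + \<rho> + 2) (Suc l)) + s\<^sup>2 * K"
proof -
  let ?Q = "cube_vecs :: 'a list"
  have \<epsilon>: "0 \<le> \<epsilon>" "\<epsilon> \<le> 1" using ap by (auto simp: zono_approx_def)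
  have \<rho>: "\<rho> \<ge> 0" using L by auto
  define M where "M = real DIM('a) * ball_bound TYPE('a) (R + \<rho> + 2) (Suc l)"
  define vp where "vp = zp @ map ((*\<^sub>R) \<epsilon>) ?Q"
  define vn where "vn = zn @ map ((*\<^sub>R) \<epsilon>) ?Q"
  \<comment> \<open>\<open>zono vq\<close> contains \<open>L\<close>; it bounds the change of a
    difference between \<open>C\<close> and \<open>C + s L\<close> in the lower estimate.\<close>
  define vq where "vq = map ((*\<^sub>R) \<rho>) ?Q"
  define N where "N = length vp + length vn + length vq"
  define r where "r = Max (insert 2 (norm ` set (vp @ vn @ vq)))"
  have rv: "norm v \<le> r" if "v \<in> set (vp @ vn @ vq)" for v unfolding r_def using that by (intro Max_ge) auto
  have r2: "r \<ge> 2" unfolding r_def by (intro Max_ge) auto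
  define R1 where "R1 = R + \<rho> + r + real N * r"
  define B where "B = ball_bound TYPE('a) R1 (Suc (Suc l))"
  have B0: "B \<ge> 0" by (simp add: B_def ball_bound_nonneg)
  have zb: "zono v \<subseteq> cball 0 (real N * r)" if "set v \<subseteq> set (vp @ vn @ vq)" "length v \<le> N" for v
  proof -
    have "zono v \<subseteq> cball 0 (real (length v) * r)" using rv that by (intro zono_subset_cball) auto
    moreover have "real (length v) * r \<le> real N * r" using that r2 by (intro mult_right_mono) auto
    ultimately show ?thesis by auto
  qed
  define K where "K = (real N)\<^sup>2 * B + real N * (real N * B)"
  have K0: "K \<ge> 0" using B0 by (simp add: K_def)
  show ?thesis
  proof (intro exI[of _ K] conjI allI impI K0)
    fix C :: "'a set" and us :: "'a list" and s :: real
    assume C: "cconvex C" "C \<subseteq> cball 0 R" and us: "\<forall>u\<in>set us. norm u \<le> R" "length us = l"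
      and s: "0 \<le> s" "s \<le> 1"
    let ?sL = "(*\<^sub>R) s ` L"
    let ?D = "C + ?sL"
    have sL: "cconvex ?sL" using L by (simp add: cconvex_scaleR)
    have sL\<rho>: "?sL \<subseteq> cball 0 \<rho>"
    proof -
      have "s * norm x \<le> 1 * \<rho>" if "x \<in> L" for x using that L s by (intro mult_mono) auto
      then show ?thesis using s by auto
    qed
    have D: "cconvex ?D" using C sL by (simp add: cconvex_plus)
    have D\<rho>: "?D \<subseteq> cball 0 (R + \<rho>)" using plus_subset_cball[OF C(2) sL\<rho>] .
    have CD: "C \<subseteq> ?D" using L by (intro subset_plus_right) (auto intro!: image_eqI[of _ _ 0])
    have bnd: "mdiff (w # v # us) (E + zono x) \<le> B"
      if "cconvex E" "E \<subseteq> cball 0 (R + \<rho>)" "set x \<subseteq> set (vp @ vn @ vq)" "length x \<le> N"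
        "w \<in> set (vp @ vn @ vq)" "v \<in> set (vp @ vn @ vq)" for E x v w
      unfolding B_def
    proof (intro mdiff_le_ball_bound)
      show "cconvex (E + zono x)" using that by (simp add: cconvex_plus)
      have "E + zono x \<subseteq> cball 0 (R + \<rho> + real N * r)" using that by (intro plus_subset_cball zb)
      also have "\<dots> \<subseteq> cball 0 R1" using r2 by (simp add: R1_def subset_iff)
      finally show "E + zono x \<subseteq> cball 0 R1" .
      fix u assume "u \<in> set (w # v # us)"
      moreover have "R \<le> R1" "r \<le> R1" using r2 R \<rho> by (auto simp: R1_def)
      ultimately show "norm u \<le> R1" using rv that us by force
    qed (use us in auto)
    have QM: "(\<Sum>v\<leftarrow>map ((*\<^sub>R) \<epsilon>) ?Q. mdiff (v # us) E) \<le> \<epsilon> * M" if E: "cconvex E" "E \<subseteq> cball 0 (R + \<rho>)" for E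
    proof -
      have "(\<Sum>v\<leftarrow>map ((*\<^sub>R) \<epsilon>) ?Q. mdiff (v # us) E) = (\<Sum>v\<leftarrow>?Q. \<epsilon> * mdiff (v # us) E)"
        using mdiff_scaleR_Cons[OF E(1) \<epsilon>(1)] by (simp add: comp_def del: mdiff.simps)
      also have "\<dots> \<le> (\<Sum>v\<leftarrow>?Q. \<epsilon> * ball_bound TYPE('a) (R + \<rho> + 2) (Suc l))"
      proof (intro sum_list_mono mult_left_mono \<epsilon> mdiff_le_ball_bound E(1))
        fix v assume v: "v \<in> set ?Q"
        show "E \<subseteq> cball 0 (R + \<rho> + 2)" using E by (auto simp: subset_iff)
        fix u assume "u \<in> set (v # us)"
        then show "norm u \<le> R + \<rho> + 2" using norm_cube_vecs[OF v] us R \<rho> by force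
      qed (use us in auto)
      also have "\<dots> = \<epsilon> * M" by (simp add: M_def sum_list_triv length_cube_vecs)
      finally show ?thesis .
    qed
    have scl: "(*\<^sub>R) s ` zono z = zono (map ((*\<^sub>R) s) z)" for z
      by (rule zono_linear_image[OF linear_scaleR_right])
    have scp: "(*\<^sub>R) s ` (A + A') = (*\<^sub>R) s ` A + (*\<^sub>R) s ` A'" for A A' :: "'a set"
      by (rule set_plus_linear_image[OF linear_scaleR_right])
    have in1: "?sL + zono (map ((*\<^sub>R) s) zn) \<subseteq> zono (map ((*\<^sub>R) s) vp)"
    proof -
      have "(*\<^sub>R) s ` (L + zono zn) \<subseteq> (*\<^sub>R) s ` zono vp"
        using ap unfolding zono_approx_def vp_def by blast
      then show ?thesis unfolding scl scp .
    qed
    have in2: "zono (map ((*\<^sub>R) s) zp) \<subseteq> ?sL + zono (map ((*\<^sub>R) s) vn)"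
    proof -
      have "(*\<^sub>R) s ` zono zp \<subseteq> (*\<^sub>R) s ` (L + zono vn)"
        using ap unfolding zono_approx_def vn_def by blast
      then show ?thesis unfolding scl scp .
    qed
    let ?dp = "\<lambda>E. \<Sum>v\<leftarrow>zp. mdiff (v # us) E" and ?dn = "\<lambda>E. \<Sum>v\<leftarrow>zn. mdiff (v # us) E"
    have up: "mdiff us ?D \<le> mdiff us C + s * (?dp C - ?dn C) + s * \<epsilon> * M + s\<^sup>2 * K"
    proof -
      \<comment> \<open>The negative part \<open>zn\<close> is added to \<open>?D\<close>, so that
        both sides of the inclusion are sums to which segments have only been added.\<close>
      have "mdiff us ?D + s * ?dn ?D \<le> mdiff us (?D + zono (map ((*\<^sub>R) s) zn))"
        by (rule mdiff_plus_zono_ge[OF D s(1)])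
      also have "\<dots> \<le> mdiff us (C + zono (map ((*\<^sub>R) s) vp))"
        unfolding add.assoc by (intro mdiff_mono cconvex_plus cconvex_zono C sL set_plus_mono2 order_refl in1)
      also have "\<dots> \<le> mdiff us C + s * (\<Sum>v\<leftarrow>vp. mdiff (v # us) C) + s\<^sup>2 * ((real (length vp))\<^sup>2 * B)"
        using C \<rho> by (intro mdiff_plus_zono_le_quadratic s C bnd) (auto simp: N_def subset_iff)
      also have "(real (length vp))\<^sup>2 * B \<le> K"
      proof -
        have "(real (length vp))\<^sup>2 * B \<le> (real N)\<^sup>2 * B"
          using B0 by (intro mult_right_mono power_mono) (auto simp: N_def)
        then show ?thesis using B0 by (simp add: K_def add_increasing2)
      qed
      also have "(\<Sum>v\<leftarrow>vp. mdiff (v # us) C) \<le> ?dp C + \<epsilon> * M"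
        using QM[of C] C \<rho> by (fastforce simp: vp_def simp del: mdiff.simps)
      finally have "mdiff us ?D + s * ?dn ?D \<le> mdiff us C + s * (?dp C + \<epsilon> * M) + s\<^sup>2 * K"
        using s by (simp add: mult_left_mono)
      moreover have "?dn C \<le> ?dn ?D" using C D CD by (intro sum_list_mono mdiff_mono)
      then have "s * ?dn C \<le> s * ?dn ?D" using s by (intro mult_left_mono)
      ultimately show ?thesis by (simp add: algebra_simps del: mdiff.simps)
    qed
    have lo: "mdiff us C + s * (?dp C - ?dn C) \<le> mdiff us ?D + s * \<epsilon> * M + s\<^sup>2 * K"
    proof -
      have "mdiff us C + s * ?dp C \<le> mdiff us (C + zono (map ((*\<^sub>R) s) zp))"
        by (rule mdiff_plus_zono_ge[OF C(1) s(1)])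
      also have "\<dots> \<le> mdiff us (?D + zono (map ((*\<^sub>R) s) vn))"
        unfolding add.assoc by (intro mdiff_mono cconvex_plus cconvex_zono C sL set_plus_mono2 order_refl in2)
      also have "\<dots> \<le> mdiff us ?D + s * (\<Sum>v\<leftarrow>vn. mdiff (v # us) ?D) + s\<^sup>2 * ((real (length vn))\<^sup>2 * B)"
        using D D\<rho> by (intro mdiff_plus_zono_le_quadratic s D bnd) (auto simp: N_def)
      also have "(real (length vn))\<^sup>2 * B \<le> (real N)\<^sup>2 * B"
        using B0 by (intro mult_right_mono power_mono) (auto simp: N_def)
      also have "(\<Sum>v\<leftarrow>vn. mdiff (v # us) ?D) \<le> ?dn ?D + \<epsilon> * M"
        using QM[OF D D\<rho>] by (simp add: vn_def del: mdiff.simps)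
      \<comment> \<open>The slopes at \<open>?D\<close> have to be brought back to \<open>C\<close>.
        Since \<open>?sL\<close> fits into \<open>s\<close> times the zonotope of \<open>vq\<close>,
        this costs only a term of order \<open>s\<close>, hence of order \<open>s\<^sup>2\<close> in
        total.\<close>
      also have "?dn ?D \<le> (\<Sum>v\<leftarrow>zn. mdiff (v # us) C + s * (real N * B))"
      proof (intro sum_list_mono)
        fix v assume v: "v \<in> set zn"
        have "?sL \<subseteq> zono (map ((*\<^sub>R) s) vq)"
        proof -
          have "L \<subseteq> zono vq" unfolding vq_def using L scaleR_cball_subset_cube[OF \<rho>] by blast
          then have "(*\<^sub>R) s ` L \<subseteq> (*\<^sub>R) s ` zono vq" by blast
          then show ?thesis unfolding scl .
        qed
        then have "mdiff (v # us) ?D \<le> mdiff (v # us) (C + zono (map ((*\<^sub>R) s) vq))"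
          using C sL by (intro mdiff_mono cconvex_plus cconvex_zono set_plus_mono2) auto
        also have "\<dots> \<le> mdiff (v # us) C + s * (\<Sum>w\<leftarrow>vq. mdiff (w # v # us) (C + zono vq))"
          using zono_scaleR_mono[of s 1 vq] s
          by (intro mdiff_plus_zono_le C s cconvex_plus cconvex_zono set_plus_mono2 order_refl)
            (simp_all add: map_idI)
        also have "(\<Sum>w\<leftarrow>vq. mdiff (w # v # us) (C + zono vq)) \<le> (\<Sum>w\<leftarrow>vq. B)"
          using C v \<rho> by (intro sum_list_mono bnd) (auto simp: N_def vn_def subset_iff)
        also have "(\<Sum>w\<leftarrow>vq. B) \<le> real N * B" using B0 by (simp add: sum_list_triv N_def mult_right_mono)
        finally show "mdiff (v # us) ?D \<le> mdiff (v # us) C + s * (real N * B)" using s by (simp add: mult_left_mono)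
      qed
      also have "\<dots> = ?dn C + real (length zn) * (s * (real N * B))" by (simp add: sum_list_addf sum_list_triv)
      also have "real (length zn) * (s * (real N * B)) \<le> real N * (s * (real N * B))"
        using B0 s by (intro mult_right_mono) (auto simp: N_def vn_def)
      finally have "mdiff us C + s * ?dp C \<le> mdiff us ?D +
          s * (?dn C + real N * (s * (real N * B)) + \<epsilon> * M) + s\<^sup>2 * ((real N)\<^sup>2 * B)"
        using s by (simp add: mult_left_mono)
      then show ?thesis by (simp add: K_def algebra_simps power2_eq_square del: mdiff.simps)
    qed
    show "\<bar>mdiff us ?D - mdiff us C - s * (?dp C - ?dn C)\<bar>
      \<le> s * \<epsilon> * (real DIM('a) * ball_bound TYPE('a) (R + \<rho> + 2) (Suc l)) + s\<^sup>2 * K"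
      using up lo unfolding M_def[symmetric] abs_le_iff by linarith
  qed
qed

section \<open>Iterated limits and the Minkowski polynomial\<close>

text \<open>The limit over the last vector is taken first and the one over the first vector last,
  each uniformly in the parameter \<open>p\<close>. The function \<open>f\<close> must exist for
  every vector \<open>u\<close>, not only for those in the approximating lists.\<close>

primrec iter_lim :: "(nat \<Rightarrow> 'a list) \<Rightarrow> (nat \<Rightarrow> 'a list) \<Rightarrow> nat \<Rightarrow> 'p set \<Rightarrow>
    ('a list \<Rightarrow> 'p \<Rightarrow> real) \<Rightarrow> ('p \<Rightarrow> real) \<Rightarrow> bool" where
  "iter_lim zp zn 0 P q \<Phi> \<longleftrightarrow> (\<forall>p\<in>P. \<Phi> p = q [] p)"
| "iter_lim zp zn (Suc m) P q \<Phi> \<longleftrightarrow> (\<exists>f. (\<forall>u. iter_lim zp zn m P (\<lambda>us. q (u # us)) (f u)) \<and>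
     uniform_limit P (\<lambda>r p. (\<Sum>u\<leftarrow>zp r. f u p) - (\<Sum>u\<leftarrow>zn r. f u p)) \<Phi> sequentially)"

lemma iter_lim_unique:
  "iter_lim zp zn m P q \<Phi> \<Longrightarrow> iter_lim zp zn m P q \<Psi> \<Longrightarrow> p \<in> P \<Longrightarrow> \<Phi> p = \<Psi> p"
proof (induction m arbitrary: q \<Phi> \<Psi>)
  case (Suc m)
  obtain f where f: "\<And>u. iter_lim zp zn m P (\<lambda>us. q (u # us)) (f u)"
    "uniform_limit P (\<lambda>r p. (\<Sum>u\<leftarrow>zp r. f u p) - (\<Sum>u\<leftarrow>zn r. f u p)) \<Phi> sequentially"
    using Suc.prems by auto
  obtain g where g: "\<And>u. iter_lim zp zn m P (\<lambda>us. q (u # us)) (g u)"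
    "uniform_limit P (\<lambda>r p. (\<Sum>u\<leftarrow>zp r. g u p) - (\<Sum>u\<leftarrow>zn r. g u p)) \<Psi> sequentially"
    using Suc.prems by auto
  have fg: "f u p = g u p" for u using Suc.IH[OF f(1) g(1) Suc.prems(3)] .
  have "(\<lambda>r. (\<Sum>u\<leftarrow>zp r. f u p) - (\<Sum>u\<leftarrow>zn r. f u p)) \<longlonglongrightarrow> \<Phi> p"
    using tendsto_uniform_limitI[OF f(2) Suc.prems(3)] .
  moreover have "(\<lambda>r. (\<Sum>u\<leftarrow>zp r. f u p) - (\<Sum>u\<leftarrow>zn r. f u p)) \<longlonglongrightarrow> \<Psi> p"
    using tendsto_uniform_limitI[OF g(2) Suc.prems(3)] by (simp add: fg)
  ultimately show ?case by (rule LIMSEQ_unique)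
qed simp

lemma iter_lim_cong:
  assumes "\<And>us p. length us = m \<Longrightarrow> p \<in> P \<Longrightarrow> q us p = q' us p" "\<And>p. p \<in> P \<Longrightarrow> \<Phi> p = \<Phi>' p"
    "iter_lim zp zn m P q \<Phi>"
  shows "iter_lim zp zn m P q' \<Phi>'"
  using assms
proof (induction m arbitrary: q q' \<Phi> \<Phi>')
  case (Suc m)
  then obtain f where f: "\<And>u. iter_lim zp zn m P (\<lambda>us. q (u # us)) (f u)"
    "uniform_limit P (\<lambda>r p. (\<Sum>u\<leftarrow>zp r. f u p) - (\<Sum>u\<leftarrow>zn r. f u p)) \<Phi> sequentially"
    by auto
  have "iter_lim zp zn m P (\<lambda>us. q' (u # us)) (f u)" for u
    by (rule Suc.IH[OF _ _ f(1)]) (use Suc.prems in auto)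
  moreover have "uniform_limit P (\<lambda>r p. (\<Sum>u\<leftarrow>zp r. f u p) - (\<Sum>u\<leftarrow>zn r. f u p)) \<Phi>' sequentially"
    using f(2) Suc.prems(2) by (subst uniform_limit_cong'[where g = "\<lambda>r p. (\<Sum>u\<leftarrow>zp r. f u p) - (\<Sum>u\<leftarrow>zn r. f u p)" and i = \<Phi>]) auto
  ultimately show ?case by auto
qed simp

lemma iter_lim_mult_bounded:
  assumes b: "\<And>p. p \<in> P \<Longrightarrow> \<bar>b p\<bar> \<le> B" and "iter_lim zp zn m P q \<Phi>"
  shows "iter_lim zp zn m P (\<lambda>us p. b p * q us p) (\<lambda>p. b p * \<Phi> p)"
  using assms(2)
proof (induction m arbitrary: q \<Phi>)
  case (Suc m)
  then obtain f where f: "\<And>u. iter_lim zp zn m P (\<lambda>us. q (u # us)) (f u)"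
    "uniform_limit P (\<lambda>r p. (\<Sum>u\<leftarrow>zp r. f u p) - (\<Sum>u\<leftarrow>zn r. f u p)) \<Phi> sequentially"
    by auto
  have "uniform_limit P (\<lambda>r p. b p * ((\<Sum>u\<leftarrow>zp r. f u p) - (\<Sum>u\<leftarrow>zn r. f u p))) (\<lambda>p. b p * \<Phi> p) sequentially"
  proof (rule uniform_limitI)
    fix e :: real assume e: "e > 0"
    define B' where "B' = \<bar>B\<bar> + 1"
    have B': "B' > 0" "\<And>p. p \<in> P \<Longrightarrow> \<bar>b p\<bar> \<le> B'" using b by (force simp: B'_def)+
    have "\<forall>\<^sub>F r in sequentially. \<forall>p\<in>P. dist ((\<Sum>u\<leftarrow>zp r. f u p) - (\<Sum>u\<leftarrow>zn r. f u p)) (\<Phi> p) < e / B'"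
      using uniform_limitD[OF f(2), of "e / B'"] e B' by simp
    then show "\<forall>\<^sub>F r in sequentially. \<forall>p\<in>P.
        dist (b p * ((\<Sum>u\<leftarrow>zp r. f u p) - (\<Sum>u\<leftarrow>zn r. f u p))) (b p * \<Phi> p) < e"
    proof eventually_elim
      case (elim r)
      show ?case
      proof
        fix p assume p: "p \<in> P"
        let ?d = "(\<Sum>u\<leftarrow>zp r. f u p) - (\<Sum>u\<leftarrow>zn r. f u p) - \<Phi> p"
        have "\<bar>b p * ?d\<bar> \<le> B' * \<bar>?d\<bar>" unfolding abs_mult using B'(2)[OF p] by (intro mult_right_mono) auto
        also have "\<dots> < B' * (e / B')" using elim p B'(1) by (intro mult_strict_left_mono) (auto simp: dist_real_def)
        finally show "dist (b p * ((\<Sum>u\<leftarrow>zp r. f u p) - (\<Sum>u\<leftarrow>zn r. f u p))) (b p * \<Phi> p) < e"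
          using B'(1) by (simp add: dist_real_def algebra_simps)
      qed
    qed
  qed
  moreover have "iter_lim zp zn m P (\<lambda>us p. b p * q (u # us) p) (\<lambda>p. b p * f u p)" for u
    by (rule Suc.IH[OF f(1)])
  ultimately show ?case
    by (auto simp: sum_list_const_mult right_diff_distrib intro!: exI[of _ "\<lambda>u p. b p * f u p"])
qed simp

lemma iter_lim_diff:
  assumes "iter_lim zp zn m P q \<Phi>" "iter_lim zp zn m P q' \<Phi>'"
  shows "iter_lim zp zn m P (\<lambda>us p. q us p - q' us p) (\<lambda>p. \<Phi> p - \<Phi>' p)"
  using assms
proof (induction m arbitrary: q \<Phi> q' \<Phi>')
  case (Suc m)
  obtain f where f: "\<And>u. iter_lim zp zn m P (\<lambda>us. q (u # us)) (f u)"
    "uniform_limit P (\<lambda>r p. (\<Sum>u\<leftarrow>zp r. f u p) - (\<Sum>u\<leftarrow>zn r. f u p)) \<Phi> sequentially"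
    using Suc.prems by auto
  obtain g where g: "\<And>u. iter_lim zp zn m P (\<lambda>us. q' (u # us)) (g u)"
    "uniform_limit P (\<lambda>r p. (\<Sum>u\<leftarrow>zp r. g u p) - (\<Sum>u\<leftarrow>zn r. g u p)) \<Phi>' sequentially"
    using Suc.prems by auto
  have "uniform_limit P (\<lambda>r p. (\<Sum>u\<leftarrow>zp r. f u p - g u p) - (\<Sum>u\<leftarrow>zn r. f u p - g u p))
      (\<lambda>p. \<Phi> p - \<Phi>' p) sequentially"
    using uniform_limit_minus[OF f(2) g(2)] by (simp add: sum_list_subtractf algebra_simps)
  moreover have "iter_lim zp zn m P (\<lambda>us p. q (u # us) p - q' (u # us) p) (\<lambda>p. f u p - g u p)" for u
    by (rule Suc.IH[OF f(1) g(1)])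
  ultimately show ?case by (auto intro!: exI[of _ "\<lambda>u p. f u p - g u p"])
qed simp

text \<open>Uniform limits preserve continuity; this is one of the two uses of the uniformity in
  \<open>iter_lim\<close>, the other being \<open>iter_lim_functional\<close>.\<close>

lemma iter_lim_continuous:
  assumes "\<And>us. length us = m \<Longrightarrow> continuous_on P (q us)" "iter_lim zp zn m P q \<Phi>"
  shows "continuous_on P \<Phi>"
  using assms
proof (induction m arbitrary: q \<Phi>)
  case 0
  then show ?case using continuous_on_cong[of P P \<Phi> "q []"] by simp
next
  case (Suc m)
  then obtain f where f: "\<And>u. iter_lim zp zn m P (\<lambda>us. q (u # us)) (f u)"
    "uniform_limit P (\<lambda>r p. (\<Sum>u\<leftarrow>zp r. f u p) - (\<Sum>u\<leftarrow>zn r. f u p)) \<Phi> sequentially"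
    by auto
  have "continuous_on P (f u)" for u
    by (rule Suc.IH[OF _ f(1)]) (use Suc.prems in auto)
  then have sl: "continuous_on P (\<lambda>p. \<Sum>u\<leftarrow>us. f u p)" for us
    by (induction us) (auto intro!: continuous_intros)
  show ?case
    by (rule uniform_limit_theorem[OF _ f(2)]) (auto intro!: always_eventually continuous_intros sl)
qed

text \<open>A bound in the supremum norm carries \<open>T\<close> through each uniform limit. The
  parameter is consumed by \<open>T\<close>, hence the one-point parameter set in the conclusion. In
  the application \<open>T\<close> is integration against a polynomial weight.\<close>

lemma iter_lim_functional:
  fixes q :: "'a list \<Rightarrow> 'p::topological_space \<Rightarrow> real" and T :: "('p \<Rightarrow> real) \<Rightarrow> real"
  assumes add: "\<And>f g. continuous_on P f \<Longrightarrow> continuous_on P g \<Longrightarrow> T (\<lambda>p. f p - g p) = T f - T g"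
    and bd: "\<And>f e. continuous_on P f \<Longrightarrow> (\<And>p. p \<in> P \<Longrightarrow> \<bar>f p\<bar> \<le> e) \<Longrightarrow> \<bar>T f\<bar> \<le> B * e"
    and q: "\<And>us. length us = m \<Longrightarrow> continuous_on P (q us)" "iter_lim zp zn m P q \<Phi>"
  shows "iter_lim zp zn m (UNIV :: unit set) (\<lambda>us _. T (q us)) (\<lambda>_. T \<Phi>)"
  using q
proof (induction m arbitrary: q \<Phi>)
  case 0
  then have "continuous_on P (q [])" by simp
  moreover from this have "continuous_on P \<Phi>" using 0 continuous_on_cong[of P P \<Phi> "q []"] by simp
  ultimately have "T (\<lambda>p. \<Phi> p - q [] p) = T \<Phi> - T (q [])"
    "\<bar>T (\<lambda>p. \<Phi> p - q [] p)\<bar> \<le> B * 0"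
    using 0 by (intro add bd continuous_intros; simp)+
  then show ?case by simp
next
  case (Suc m)
  then obtain f where f: "\<And>u. iter_lim zp zn m P (\<lambda>us. q (u # us)) (f u)"
    "uniform_limit P (\<lambda>r p. (\<Sum>u\<leftarrow>zp r. f u p) - (\<Sum>u\<leftarrow>zn r. f u p)) \<Phi> sequentially"
    by auto
  have cf: "continuous_on P (f u)" for u
    by (rule iter_lim_continuous[OF _ f(1)]) (use Suc.prems in auto)
  have sl: "continuous_on P (\<lambda>p. \<Sum>u\<leftarrow>us. f u p)" for us
    by (induction us) (auto intro!: continuous_intros cf)
  have c\<Phi>: "continuous_on P \<Phi>"
    using iter_lim_continuous[OF Suc.prems] by simp
  have T0: "T (\<lambda>p. 0) = 0" using add[of "\<lambda>p. 0" "\<lambda>p. 0"] by simp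
  have Tneg: "T (\<lambda>p. - g p) = - T g" if "continuous_on P g" for g
    using add[of "\<lambda>p. 0" g] that T0 by simp
  have Tadd: "T (\<lambda>p. g p + h p) = T g + T h" if "continuous_on P g" "continuous_on P h" for g h
    using add[of g "\<lambda>p. - h p"] that Tneg by (simp add: continuous_on_minus)
  have Tsl: "T (\<lambda>p. \<Sum>u\<leftarrow>us. f u p) = (\<Sum>u\<leftarrow>us. T (f u))" for us
    by (induction us) (simp_all add: T0 Tadd cf sl)
  have "iter_lim zp zn m (UNIV :: unit set) (\<lambda>us _. T (q (u # us))) (\<lambda>_. T (f u))" for u
    by (rule Suc.IH[OF _ f(1)]) (use Suc.prems in auto)
  moreover have "(\<lambda>r. (\<Sum>u\<leftarrow>zp r. T (f u)) - (\<Sum>u\<leftarrow>zn r. T (f u))) \<longlonglongrightarrow> T \<Phi>"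
  proof (rule metric_LIMSEQ_I)
    fix e :: real assume e: "e > 0"
    define e' where "e' = e / (\<bar>B\<bar> + 1)"
    have e': "e' > 0" using e by (simp add: e'_def add_nonneg_pos)
    obtain N where N: "\<And>r p. r \<ge> N \<Longrightarrow> p \<in> P \<Longrightarrow> dist ((\<Sum>u\<leftarrow>zp r. f u p) - (\<Sum>u\<leftarrow>zn r. f u p)) (\<Phi> p) < e'"
      using uniform_limitD[OF f(2) e'] unfolding eventually_sequentially by blast
    show "\<exists>N. \<forall>r\<ge>N. dist ((\<Sum>u\<leftarrow>zp r. T (f u)) - (\<Sum>u\<leftarrow>zn r. T (f u))) (T \<Phi>) < e"
    proof (intro exI[of _ N] allI impI)
      fix r assume r: "r \<ge> N"
      have "T (\<lambda>p. (\<Sum>u\<leftarrow>zp r. f u p) - (\<Sum>u\<leftarrow>zn r. f u p) - \<Phi> p) =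
          (\<Sum>u\<leftarrow>zp r. T (f u)) - (\<Sum>u\<leftarrow>zn r. T (f u)) - T \<Phi>"
        by (subst add, auto intro!: continuous_intros sl c\<Phi>, subst add, auto intro!: sl simp: Tsl)
      moreover have "\<bar>T (\<lambda>p. (\<Sum>u\<leftarrow>zp r. f u p) - (\<Sum>u\<leftarrow>zn r. f u p) - \<Phi> p)\<bar> \<le> B * e'"
        using N[OF r] by (intro bd) (auto intro!: continuous_intros sl c\<Phi> less_imp_le simp: dist_real_def)
      moreover have "B * e' < e"
      proof -
        have "B * e' \<le> \<bar>B\<bar> * e'" using e' by (intro mult_right_mono) auto
        also have "\<dots> < (\<bar>B\<bar> + 1) * e'" using e' by simp
        also have "\<dots> = e" by (simp add: e'_def)
        finally show ?thesis .
      qed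
      ultimately show "dist ((\<Sum>u\<leftarrow>zp r. T (f u)) - (\<Sum>u\<leftarrow>zn r. T (f u))) (T \<Phi>) < e"
        by (simp add: dist_real_def)
    qed
  qed
  then have "uniform_limit (UNIV :: unit set) (\<lambda>r p. (\<Sum>u\<leftarrow>zp r. T (f u)) - (\<Sum>u\<leftarrow>zn r. T (f u))) (\<lambda>_. T \<Phi>) sequentially"
    by (simp add: uniform_limit_iff tendsto_iff)
  ultimately show ?case by (auto intro!: exI[of _ "\<lambda>u _. T (f u)"])
qed

text \<open>For kernels of finite rank the two iterated limits commute: subtracting
  \<open>\<kappa>(u, w\<^sub>0) \<kappa>(u\<^sub>0, w) / \<kappa>(u\<^sub>0, w\<^sub>0)\<close> lowers the rank and changes both iterated limits by the same amount.\<close>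

lemma iter_lim_interchange:
  fixes \<kappa> :: "'a list \<Rightarrow> 'a list \<Rightarrow> real"
  assumes "finite I"
    and "\<And>u w. length u = m \<Longrightarrow> length w = m \<Longrightarrow> \<kappa> u w = (\<Sum>a\<in>I. x a u * y a w)"
    and "\<And>w. length w = m \<Longrightarrow> iter_lim zp zn m (UNIV::unit set) (\<lambda>u _. \<kappa> u w) (\<lambda>_. \<alpha> w)"
    and "\<And>u. length u = m \<Longrightarrow> iter_lim zp' zn' m (UNIV::unit set) (\<lambda>w _. \<kappa> u w) (\<lambda>_. \<beta> u)"
    and "iter_lim zp' zn' m (UNIV::unit set) (\<lambda>w _. \<alpha> w) (\<lambda>_. A)"
    and "iter_lim zp zn m (UNIV::unit set) (\<lambda>u _. \<beta> u) (\<lambda>_. B)"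
  shows "A = B"
  using assms
proof (induction "card I" arbitrary: I \<kappa> x y \<alpha> \<beta> A B)
  case (0 I \<kappa>)
  show ?case
  proof -
    have z: "iter_lim z1 z2 k (UNIV::unit set) (\<lambda>u _. 0) (\<lambda>_. 0)" for z1 z2 :: "nat \<Rightarrow> 'a list" and k
      by (induction k) (auto intro!: exI[of _ "\<lambda>_ _. 0"] simp: uniform_limit_iff)
    have \<kappa>: "\<kappa> u w = 0" if "length u = m" "length w = m" for u w using 0 that by simp
    have "\<alpha> w = 0" if "length w = m" for w
      using iter_lim_unique[OF iter_lim_cong[OF _ _ 0(4)[OF that], of "\<lambda>_ _. 0" "\<lambda>_. \<alpha> w"] z] \<kappa> that by simp
    then have "A = 0"
      using iter_lim_unique[OF iter_lim_cong[OF _ _ 0(6), of "\<lambda>_ _. 0" "\<lambda>_. A"] z] by simp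
    have "\<beta> w = 0" if "length w = m" for w
      using iter_lim_unique[OF iter_lim_cong[OF _ _ 0(5)[OF that], of "\<lambda>_ _. 0" "\<lambda>_. \<beta> w"] z] \<kappa> that by simp
    then have "B = 0"
      using iter_lim_unique[OF iter_lim_cong[OF _ _ 0(7), of "\<lambda>_ _. 0" "\<lambda>_. B"] z] by simp
    with \<open>A = 0\<close> show ?thesis by simp
  qed
next
  case (Suc k I \<kappa> x y \<alpha> \<beta> A B)
  note prems = Suc.prems
  show ?case
  proof (cases "\<exists>u w. length u = m \<and> length w = m \<and> \<kappa> u w \<noteq> 0")
    case False
    \<comment> \<open>The kernel vanishes on all lists of length \<open>m\<close>, so any smaller
      index set represents it, with zero coefficients.\<close>
    obtain a where a: "a \<in> I" using Suc.hyps(2) by (metis card.empty ex_in_conv nat.simps(3))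
    show ?thesis
      by (rule Suc.hyps(1)[of "I - {a}" \<kappa> "\<lambda>_ _. 0" y \<alpha> \<beta>])
        (use False a prems Suc.hyps(2) in auto)
  next
    case True
    then obtain u0 w0 where uw: "length u0 = m" "length w0 = m" "\<kappa> u0 w0 \<noteq> 0" by blast
    have "\<exists>a\<in>I. x a u0 \<noteq> 0" using prems(2)[OF uw(1,2)] uw(3) by (metis (mono_tags, lifting) mult_zero_left sum.neutral)
    then obtain a0 where a0: "a0 \<in> I" "x a0 u0 \<noteq> 0" by blast
    define c where "c = \<kappa> u0 w0"
    \<comment> \<open>With this \<open>t\<close>, the function \<open>x' a0\<close> vanishes, so
      \<open>k1\<close> expresses the kernel by its row at \<open>u0\<close> and one summand
      fewer.\<close>
    define t where "t u = x a0 u / x a0 u0" for u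
    define x' where "x' a u = x a u - t u * x a u0" for a u
    define y' where "y' a w = y a w - y a w0 * \<kappa> u0 w / c" for a w
    define \<kappa>' where "\<kappa>' u w = \<kappa> u w - \<kappa> u w0 * (\<kappa> u0 w / c)" for u w
    have k1: "\<kappa> u w = t u * \<kappa> u0 w + (\<Sum>a\<in>I - {a0}. x' a u * y a w)"
      if "length u = m" "length w = m" for u w
    proof -
      have "(\<Sum>a\<in>I - {a0}. x' a u * y a w) = (\<Sum>a\<in>I. x' a u * y a w)"
        using a0 prems(1) by (subst sum.remove[of I a0]) (auto simp: x'_def t_def)
      also have "\<dots> = \<kappa> u w - t u * \<kappa> u0 w"
        using that uw by (simp add: prems(2) x'_def left_diff_distrib sum_subtractf sum_distrib_left mult.assoc)
      finally show ?thesis by simp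
    qed
    have k2: "\<kappa>' u w = (\<Sum>a\<in>I - {a0}. x' a u * y' a w)" if "length u = m" "length w = m" for u w
    proof -
      have "t u = (\<kappa> u w0 - (\<Sum>a\<in>I - {a0}. x' a u * y a w0)) / c"
        using k1[OF that(1) uw(2)] uw(3) by (simp add: c_def field_simps)
      then have "\<kappa>' u w = (\<Sum>a\<in>I - {a0}. x' a u * y a w) - (\<Sum>a\<in>I - {a0}. x' a u * y a w0) * (\<kappa> u0 w / c)"
        using k1[OF that] by (simp add: \<kappa>'_def diff_divide_distrib left_diff_distrib)
      also have "\<dots> = (\<Sum>a\<in>I - {a0}. x' a u * y' a w)"
        by (simp add: y'_def right_diff_distrib sum_subtractf sum_distrib_right sum_divide_distrib mult.assoc)
      finally show ?thesis .
    qed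
    have cmul: "iter_lim z1 z2 m (UNIV::unit set) (\<lambda>u _. q u * d) (\<lambda>_. Q * d)"
      if "iter_lim z1 z2 m (UNIV::unit set) (\<lambda>u _. q u) (\<lambda>_. Q)" for z1 z2 :: "nat \<Rightarrow> 'a list" and q Q d
      using iter_lim_mult_bounded[of UNIV "\<lambda>_. d" "\<bar>d\<bar>", OF _ that] by (simp add: mult.commute)
    \<comment> \<open>Both sides are corrected by \<open>\<alpha> w0 * \<beta> u0 / c\<close>,
      because a product of a function of \<open>u\<close> and a function of \<open>w\<close> has the
      product of the two limits as its iterated limit in either order.\<close>
    have "A - \<alpha> w0 * (\<beta> u0 / c) = B - \<beta> u0 / c * \<alpha> w0"
    proof (rule Suc.hyps(1)[of "I - {a0}" \<kappa>' x' y' "\<lambda>w. \<alpha> w - \<alpha> w0 * (\<kappa> u0 w / c)" "\<lambda>u. \<beta> u - \<kappa> u w0 * (\<beta> u0 / c)"])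
      show "k = card (I - {a0})" using Suc.hyps(2) a0 prems(1) by simp
      show "finite (I - {a0})" using prems(1) by simp
      show "iter_lim zp zn m (UNIV::unit set) (\<lambda>u _. \<kappa>' u w) (\<lambda>_. \<alpha> w - \<alpha> w0 * (\<kappa> u0 w / c))" if "length w = m" for w
        unfolding \<kappa>'_def using iter_lim_diff[OF prems(3)[OF that] cmul[OF prems(3)[OF uw(2)]]] .
      show "iter_lim zp' zn' m (UNIV::unit set) (\<lambda>w _. \<kappa>' u w) (\<lambda>_. \<beta> u - \<kappa> u w0 * (\<beta> u0 / c))" if "length u = m" for u
        unfolding \<kappa>'_def
        using iter_lim_diff[OF prems(4)[OF that] cmul[OF prems(4)[OF uw(1)], of "\<kappa> u w0 / c"]] by (simp add: mult.commute)
      show "iter_lim zp' zn' m (UNIV::unit set) (\<lambda>w _. \<alpha> w - \<alpha> w0 * (\<kappa> u0 w / c)) (\<lambda>_. A - \<alpha> w0 * (\<beta> u0 / c))"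
        using iter_lim_diff[OF prems(5) cmul[OF prems(4)[OF uw(1)], of "\<alpha> w0 / c"]] by (simp add: mult.commute)
      show "iter_lim zp zn m (UNIV::unit set) (\<lambda>u _. \<beta> u - \<kappa> u w0 * (\<beta> u0 / c)) (\<lambda>_. B - \<beta> u0 / c * \<alpha> w0)"
        using iter_lim_diff[OF prems(6) cmul[OF prems(3)[OF uw(2)], of "\<beta> u0 / c"]] by (simp add: mult.commute)
    qed (use k2 in auto)
    then show ?thesis by (simp add: mult.commute)
  qed
qed

text \<open>Subtracting the value at \<open>2 * t\<close> from \<open>2 ^ k\<close> times the value
  at \<open>t\<close> removes the term of degree \<open>k\<close> and multiplies the others by
  nonzero constants. Once the lower coefficients converge, the top one is read off at
  \<open>t = 1\<close>.\<close>

lemma uniformly_convergent_coeffs: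
  fixes b :: "nat \<Rightarrow> nat \<Rightarrow> 'p \<Rightarrow> real"
  assumes "\<And>t::real. t > 0 \<Longrightarrow> uniformly_convergent_on P (\<lambda>r p. \<Sum>i<k. b r i p * t ^ i)" "i < k"
  shows "uniformly_convergent_on P (\<lambda>r p. b r i p)"
  using assms
proof (induction k arbitrary: b i)
  case (Suc k)
  have lower: "uniformly_convergent_on P (\<lambda>r p. b r i p)" if i: "i < k" for i
  proof -
    have "uniformly_convergent_on P (\<lambda>r p. \<Sum>i<k. ((2 ^ k - 2 ^ i) * b r i p) * t ^ i)" if t: "t > 0" for t :: real
    proof -
      have "uniformly_convergent_on P (\<lambda>r p. 2 ^ k * (\<Sum>i<Suc k. b r i p * t ^ i) - (\<Sum>i<Suc k. b r i p * (2 * t) ^ i))"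
        using t by (intro uniformly_convergent_minus uniformly_convergent_mult Suc.prems(1)) auto
      also have "(\<lambda>r p. 2 ^ k * (\<Sum>i<Suc k. b r i p * t ^ i) - (\<Sum>i<Suc k. b r i p * (2 * t) ^ i)) =
          (\<lambda>r p. \<Sum>i<k. ((2 ^ k - 2 ^ i) * b r i p) * t ^ i)"
        by (auto simp: fun_eq_iff sum_distrib_left algebra_simps power_mult_distrib simp flip: sum_subtractf intro!: sum.cong)
      finally show ?thesis .
    qed
    then have "uniformly_convergent_on P (\<lambda>r p. (2 ^ k - 2 ^ i) * b r i p)"
      using i by (intro Suc.IH[where b = "\<lambda>r i p. (2 ^ k - 2 ^ i) * b r i p"])
    then have "uniformly_convergent_on P (\<lambda>r p. inverse (2 ^ k - 2 ^ i) * ((2 ^ k - 2 ^ i) * b r i p))"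
      by (rule uniformly_convergent_mult)
    moreover have "(2::real) ^ k - 2 ^ i \<noteq> 0" using i by simp
    ultimately show ?thesis by (simp add: mult.assoc[symmetric])
  qed
  show ?case
  proof (cases "i < k")
    case True
    then show ?thesis by (rule lower)
  next
    case False
    then have ik: "i = k" using Suc.prems by simp
    have "uniformly_convergent_on P (\<lambda>r p. \<Sum>i<l. b r i p)" if "l \<le> k" for l
      using that
    proof (induction l)
      case (Suc l)
      then show ?case by (auto intro!: uniformly_convergent_add lower)
    qed auto
    then have "uniformly_convergent_on P (\<lambda>r p. (\<Sum>i<Suc k. b r i p * 1 ^ i) - (\<Sum>i<k. b r i p))"
      by (intro uniformly_convergent_minus Suc.prems(1)) auto
    then show ?thesis by (simp add: ik)
  qed
qed simp

text \<open>The estimate only concerns forward increments, but at all base points near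
  \<open>x\<close>. A backward quotient at \<open>x\<close> is a forward quotient at
  \<open>y < x\<close>, and continuity of \<open>G\<close> compares \<open>G y\<close> with
  \<open>G x\<close>. Both \<open>G\<close> and \<open>K\<close> may change with
  \<open>e\<close>.\<close>

lemma has_derivative_from_first_order:
  fixes g :: "real \<Rightarrow> real"
  assumes x: "0 \<le> x"
    and est: "\<And>e. e > 0 \<Longrightarrow> \<exists>G K. 0 \<le> K \<and> continuous_on {0..} G \<and> \<bar>G x - D\<bar> \<le> e \<and>
      (\<forall>t s. 0 \<le> t \<longrightarrow> t \<le> x + 1 \<longrightarrow> 0 \<le> s \<longrightarrow> s \<le> 1 \<longrightarrow> \<bar>g (t + s) - g t - s * G t\<bar> \<le> s * e + s\<^sup>2 * K)"
  shows "(g has_real_derivative D) (at x within {0..})"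
  unfolding has_field_derivative_iff
proof (rule tendstoI)
  fix e :: real assume e: "e > 0"
  \<comment> \<open>Two fifths of \<open>e\<close> go to the quotient, one to the continuity of
    \<open>G\<close> and one to the distance from \<open>G x\<close> to \<open>D\<close>; the total
    stays below \<open>e\<close>.\<close>
  obtain G K where K: "0 \<le> K" and G: "continuous_on {0..} G" "\<bar>G x - D\<bar> \<le> e / 5"
    and gs: "\<And>t s. 0 \<le> t \<Longrightarrow> t \<le> x + 1 \<Longrightarrow> 0 \<le> s \<Longrightarrow> s \<le> 1 \<Longrightarrow> \<bar>g (t + s) - g t - s * G t\<bar> \<le> s * (e / 5) + s\<^sup>2 * K"
    using est[of "e / 5"] e by auto
  obtain d where d: "d > 0" "\<And>y. 0 \<le> y \<Longrightarrow> \<bar>y - x\<bar> < d \<Longrightarrow> \<bar>G y - G x\<bar> < e / 5"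
    using G(1) x e unfolding continuous_on_iff dist_real_def
    by (metis atLeast_iff zero_less_divide_iff zero_less_numeral)
  define \<delta> where "\<delta> = min d (min 1 (e / 5 / (K + 1)))"
  have \<delta>: "\<delta> > 0" "\<delta> \<le> d" "\<delta> \<le> 1" "\<delta> \<le> e / 5 / (K + 1)" using d e K by (auto simp: \<delta>_def)
  have quot: "\<bar>(g b - g a) / (b - a) - G a\<bar> \<le> 2 * e / 5" if "0 \<le> a" "a \<le> x" "a < b" "b - a < \<delta>" for a b
  proof -
    have "\<bar>g (a + (b - a)) - g a - (b - a) * G a\<bar> \<le> (b - a) * (e / 5) + (b - a)\<^sup>2 * K"
      using that \<delta> by (intro gs) auto
    moreover have "(b - a) * ((g b - g a) / (b - a) - G a) = g (a + (b - a)) - g a - (b - a) * G a"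
      unfolding right_diff_distrib[of "b - a" "(g b - g a) / (b - a)"] using that by simp
    ultimately have "\<bar>(b - a) * ((g b - g a) / (b - a) - G a)\<bar> \<le> (b - a) * (e / 5 + (b - a) * K)"
      by (simp add: distrib_left power2_eq_square mult.assoc)
    then have "\<bar>(g b - g a) / (b - a) - G a\<bar> \<le> e / 5 + (b - a) * K"
      using that by (simp add: abs_mult)
    moreover have "(b - a) * K \<le> e / 5 / (K + 1) * (K + 1)"
      using that \<delta> K by (intro mult_mono) auto
    moreover have "e / 5 / (K + 1) * (K + 1) = e / 5"
      using K nonzero_eq_divide_eq[of "K + 1" "e / 5 / (K + 1)" "e / 5"] by linarith
    ultimately show ?thesis by linarith
  qed
  show "\<forall>\<^sub>F y in at x within {0..}. dist ((g y - g x) / (y - x)) D < e"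
    unfolding eventually_at
  proof (intro exI[of _ \<delta>] conjI ballI impI \<delta>(1))
    fix y :: real assume y: "y \<in> {0..}" "y \<noteq> x \<and> dist y x < \<delta>"
    show "dist ((g y - g x) / (y - x)) D < e"
    proof (cases "y > x")
      case True
      then have "\<bar>(g y - g x) / (y - x) - G x\<bar> \<le> 2 * e / 5" using y x by (intro quot) (auto simp: dist_real_def)
      then show ?thesis using G(2) e unfolding dist_real_def by linarith
    next
      case False
      then have "\<bar>(g x - g y) / (x - y) - G y\<bar> \<le> 2 * e / 5" using y by (intro quot) (auto simp: dist_real_def)
      moreover have "(g x - g y) / (x - y) = (g y - g x) / (y - x)"
        by (metis minus_diff_eq minus_divide_divide)
      moreover have "\<bar>G y - G x\<bar> < e / 5" using y \<delta> by (intro d) (auto simp: dist_real_def)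
      ultimately show ?thesis using G(2) e unfolding dist_real_def by linarith
    qed
  qed
qed

section \<open>The Minkowski polynomial for families of bodies\<close>

lemma convex_scaleR_add:
  assumes "convex L" "0 \<le> s" "0 \<le> t"
  shows "(*\<^sub>R) (s + t) ` L = (*\<^sub>R) s ` L + (*\<^sub>R) t ` L"
proof (intro equalityI subsetI)
  fix x assume "x \<in> (*\<^sub>R) (s + t) ` L"
  then show "x \<in> (*\<^sub>R) s ` L + (*\<^sub>R) t ` L" by (auto simp: scaleR_left_distrib)
next
  fix x assume "x \<in> (*\<^sub>R) s ` L + (*\<^sub>R) t ` L"
  then obtain a b where ab: "a \<in> L" "b \<in> L" "x = s *\<^sub>R a + t *\<^sub>R b" by (auto simp: set_plus_iff)
  show "x \<in> (*\<^sub>R) (s + t) ` L"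
  proof (cases "s + t = 0")
    case True
    then have "s = 0" "t = 0" using assms by auto
    then show ?thesis using ab by (auto intro!: image_eqI[of _ _ a])
  next
    case False
    then have pos: "s + t > 0" using assms by auto
    let ?c = "(s / (s + t)) *\<^sub>R a + (t / (s + t)) *\<^sub>R b"
    have "?c \<in> L" using assms ab pos by (intro convexD) (auto simp flip: add_divide_distrib)
    moreover have "x = (s + t) *\<^sub>R ?c" using ab pos by (simp add: scaleR_add_right)
    ultimately show ?thesis by blast
  qed
qed

lemma sum_list_sum_swap:
  "(\<Sum>u\<leftarrow>us. \<Sum>i<(k::nat). f u i * (c i :: real)) = (\<Sum>i<k. (\<Sum>u\<leftarrow>us. f u i) * c i)"
  by (induction us) (simp_all add: sum.distrib algebra_simps)

text \<open>Induction on the number of directions still free: with \<open>DIM('a) + 1\<close>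
  segments everything vanishes, and each segment removed raises the number of coefficients by one.
  The slopes \<open>G r p t\<close> are polynomials in \<open>t\<close> by induction; the
  first-order expansion forces them to converge, and the limit is the derivative of
  \<open>g p\<close>. Integrating divides by \<open>Suc i\<close>, which accounts for the factorials
  in the iterated limits. All bounds are uniform over the family \<open>P\<close>.\<close>

theorem mdiff_polynomial_family:
  fixes L :: "'a::euclidean_space set"
  assumes L: "cconvex L" "0 \<in> L"
    and ap: "\<And>r. zono_approx L (\<epsilon> r) (zp r) (zn r)" and \<epsilon>: "\<epsilon> \<longlonglongrightarrow> 0"
    and C: "\<And>p. p \<in> P \<Longrightarrow> cconvex (C p)" "\<And>p. p \<in> P \<Longrightarrow> C p \<subseteq> cball 0 R"
    and us: "\<And>p u. p \<in> P \<Longrightarrow> u \<in> set (us p) \<Longrightarrow> norm u \<le> R"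
      "\<And>p. p \<in> P \<Longrightarrow> length (us p) + k = Suc DIM('a)"
    and R: "0 \<le> R"
  shows "\<exists>a. (\<forall>p\<in>P. \<forall>t\<ge>0. mdiff (us p) (C p + (*\<^sub>R) t ` L) = (\<Sum>i<k. a i p * t ^ i)) \<and>
    (\<forall>i<k. iter_lim zp zn i P (\<lambda>vs p. mdiff (us p @ vs) (C p)) (\<lambda>p. fact i * a i p))"
  using C(2) us R
proof (induction k arbitrary: us R)
  case 0
  then have "mdiff (us p) (C p + (*\<^sub>R) t ` L) = 0" if "p \<in> P" for p t
    using that C L by (intro mdiff_eq_0_of_long) (auto simp: cconvex_plus cconvex_scaleR)
  then show ?case by simp
next
  case (Suc k)
  note CR = Suc.prems(1) and us = Suc.prems(2,3) and R = Suc.prems(4)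
  define l where "l = DIM('a) - k"
  have len: "length (us p) = l" if "p \<in> P" for p using us(2)[OF that] by (simp add: l_def)
  obtain \<rho> where \<rho>: "L \<subseteq> cball 0 \<rho>"
    using L(1) compact_imp_bounded[of L] by (auto simp: cconvex_def bounded_iff subset_iff)
  have \<rho>0: "\<rho> \<ge> 0" using \<rho> L(2) by auto
  have "\<exists>a. (\<forall>p\<in>P. \<forall>t\<ge>0. mdiff (us p @ [u]) (C p + (*\<^sub>R) t ` L) = (\<Sum>i<k. a i p * t ^ i)) \<and>
    (\<forall>i<k. iter_lim zp zn i P (\<lambda>vs p. mdiff ((us p @ [u]) @ vs) (C p)) (\<lambda>p. fact i * a i p))" for u
  proof (rule Suc.IH[where R = "max R (norm u)"])
    show "C p \<subseteq> cball 0 (max R (norm u))" if "p \<in> P" for p using CR[OF that] by (auto simp: le_max_iff_disj)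
    show "norm v \<le> max R (norm u)" if "p \<in> P" "v \<in> set (us p @ [u])" for p v
      using us(1)[OF that(1)] that(2) by (fastforce simp: le_max_iff_disj)
    show "length (us p @ [u]) + k = Suc DIM('a)" if "p \<in> P" for p using us(2)[OF that] by simp
    show "0 \<le> max R (norm u)" using R by simp
  qed
  then have "\<exists>A. \<forall>u. (\<forall>p\<in>P. \<forall>t\<ge>0. mdiff (us p @ [u]) (C p + (*\<^sub>R) t ` L) = (\<Sum>i<k. A u i p * t ^ i)) \<and>
    (\<forall>i<k. iter_lim zp zn i P (\<lambda>vs p. mdiff ((us p @ [u]) @ vs) (C p)) (\<lambda>p. fact i * A u i p))"
    by (intro choice allI)
  then obtain A where A: "\<And>u p t. p \<in> P \<Longrightarrow> t \<ge> 0 \<Longrightarrow> mdiff (us p @ [u]) (C p + (*\<^sub>R) t ` L) = (\<Sum>i<k. A u i p * t ^ i)"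
      and AL: "\<And>u i. i < k \<Longrightarrow> iter_lim zp zn i P (\<lambda>vs p. mdiff ((us p @ [u]) @ vs) (C p)) (\<lambda>p. fact i * A u i p)"
    by blast
  define g where "g p t = mdiff (us p) (C p + (*\<^sub>R) t ` L)" for p t
  define b where "b r i p = (\<Sum>u\<leftarrow>zp r. A u i p) - (\<Sum>u\<leftarrow>zn r. A u i p)" for r i p
  define G where "G r p t = (\<Sum>i<k. b r i p * t ^ i)" for r p t
  \<comment> \<open>The new vector is appended in the induction hypothesis, to fit the argument
    order of \<open>iter_lim\<close>, but prepended in the first-order expansion.\<close>
  have mD: "mdiff (u # us p) D = mdiff (us p @ [u]) D" for u p D using mdiff_append_Cons[of "us p" u "[]" D] by simp
  have G: "(\<Sum>u\<leftarrow>zp r. mdiff (u # us p) (C p + (*\<^sub>R) t ` L)) - (\<Sum>u\<leftarrow>zn r. mdiff (u # us p) (C p + (*\<^sub>R) t ` L)) = G r p t"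
    if "p \<in> P" "t \<ge> 0" for r p t
    unfolding mD A[OF that] G_def b_def sum_list_sum_swap by (simp add: left_diff_distrib sum_subtractf)
  define M where "M T = real DIM('a) * ball_bound TYPE('a) (R + T * \<rho> + \<rho> + 2) (Suc l)" for T
  have M0: "M T \<ge> 0" for T by (simp add: M_def ball_bound_nonneg)
  have \<epsilon>0: "\<epsilon> r \<ge> 0" for r using ap[of r] by (simp add: zono_approx_def)
  have est: "\<exists>K\<ge>0. \<forall>p\<in>P. \<forall>t s. 0 \<le> t \<longrightarrow> t \<le> T \<longrightarrow> 0 \<le> s \<longrightarrow> s \<le> 1 \<longrightarrow>
      \<bar>g p (t + s) - g p t - s * G r p t\<bar> \<le> s * (\<epsilon> r * M T) + s\<^sup>2 * K" if T: "T \<ge> 0" for r T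
  proof -
    have "R + T * \<rho> \<ge> 0" using R \<rho>0 T by simp
    from mdiff_first_order[OF L \<rho> ap[of r] this, of l] obtain K where K: "K \<ge> 0"
      and KK: "\<And>C us s. cconvex C \<Longrightarrow> C \<subseteq> cball 0 (R + T * \<rho>) \<Longrightarrow> (\<forall>u\<in>set us. norm u \<le> R + T * \<rho>) \<Longrightarrow>
        length us = l \<Longrightarrow> 0 \<le> s \<Longrightarrow> s \<le> 1 \<Longrightarrow>
        \<bar>mdiff us (C + (*\<^sub>R) s ` L) - mdiff us C
          - s * ((\<Sum>v\<leftarrow>zp r. mdiff (v # us) C) - (\<Sum>v\<leftarrow>zn r. mdiff (v # us) C))\<bar>
        \<le> s * \<epsilon> r * M T + s\<^sup>2 * K" unfolding M_def by blast
    show ?thesis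
    proof (intro exI[of _ K] conjI K ballI allI impI)
      fix p t s assume p: "p \<in> P" and t: "0 \<le> t" "t \<le> T" and s: "0 \<le> s" "s \<le> (1::real)"
      let ?D = "C p + (*\<^sub>R) t ` L"
      have tL: "(*\<^sub>R) t ` L \<subseteq> cball 0 (T * \<rho>)"
      proof -
        have "t * norm x \<le> T * \<rho>" if "x \<in> L" for x using that \<rho> t by (intro mult_mono) auto
        then show ?thesis using t by auto
      qed
      have "?D + (*\<^sub>R) s ` L = C p + (*\<^sub>R) (t + s) ` L"
        using convex_scaleR_add[of L t s] L t s by (simp add: add.assoc cconvex_def)
      then have gts: "g p (t + s) = mdiff (us p) (?D + (*\<^sub>R) s ` L)" by (simp add: g_def)
      have "norm u \<le> R + T * \<rho>" if "u \<in> set (us p)" for u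
        using us(1)[OF p that] mult_nonneg_nonneg[OF T \<rho>0] by linarith
      then show "\<bar>g p (t + s) - g p t - s * G r p t\<bar> \<le> s * (\<epsilon> r * M T) + s\<^sup>2 * K"
        using KK[of ?D "us p" s] C(1)[OF p] L(1) plus_subset_cball[OF CR[OF p] tL] len[OF p] s
        unfolding gts G[OF p t(1)] by (simp add: cconvex_plus cconvex_scaleR g_def mult.assoc)
    qed
  qed
  \<comment> \<open>Since \<open>g\<close> does not involve the approximation, the expansions for
    \<open>r\<close> and \<open>r'\<close> describe the same increment; dividing by \<open>s\<close>
    and letting \<open>s\<close> tend to 0 removes \<open>K\<close> and \<open>K'\<close>.\<close>
  have cauchy: "\<bar>G r p t - G r' p t\<bar> \<le> (\<epsilon> r + \<epsilon> r') * M t" if p: "p \<in> P" and t: "t \<ge> 0" for r r' p t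
  proof (rule field_le_epsilon)
    fix e :: real assume e: "e > 0"
    obtain K where K: "K \<ge> 0" "\<And>s. 0 \<le> s \<Longrightarrow> s \<le> 1 \<Longrightarrow> \<bar>g p (t + s) - g p t - s * G r p t\<bar> \<le> s * (\<epsilon> r * M t) + s\<^sup>2 * K"
      using est[OF t, of r] p t by blast
    obtain K' where K': "K' \<ge> 0" "\<And>s. 0 \<le> s \<Longrightarrow> s \<le> 1 \<Longrightarrow> \<bar>g p (t + s) - g p t - s * G r' p t\<bar> \<le> s * (\<epsilon> r' * M t) + s\<^sup>2 * K'"
      using est[OF t, of r'] p t by blast
    define s where "s = min 1 (e / (K + K' + 1))"
    have s: "0 < s" "s \<le> 1" "s \<le> e / (K + K' + 1)" using e K K' by (auto simp: s_def)
    have "s * (K + K') \<le> e / (K + K' + 1) * (K + K' + 1)" using s K K' e by (intro mult_mono) auto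
    then have sK: "s * (K + K') \<le> e" using K K' by (simp split: if_splits)
    have "\<bar>s * (G r p t - G r' p t)\<bar> \<le> s * ((\<epsilon> r + \<epsilon> r') * M t + s * (K + K'))"
      using K(2)[of s] K'(2)[of s] s unfolding abs_le_iff by (simp add: algebra_simps power2_eq_square)
    then have "\<bar>G r p t - G r' p t\<bar> \<le> (\<epsilon> r + \<epsilon> r') * M t + s * (K + K')"
      using s(1) by (simp add: abs_mult)
    then show "\<bar>G r p t - G r' p t\<bar> \<le> (\<epsilon> r + \<epsilon> r') * M t + e" using sK by linarith
  qed
  have "uniformly_convergent_on P (\<lambda>r p. G r p t)" if t: "t > 0" for t
  proof (rule Cauchy_uniformly_convergent, rule uniformly_Cauchy_onI)
    fix e :: real assume e: "e > 0"
    have "(\<lambda>r. \<epsilon> r * M t) \<longlonglongrightarrow> 0 * M t" by (intro tendsto_intros \<epsilon>)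
    then have "\<forall>\<^sub>F r in sequentially. \<epsilon> r * M t < e / 2" by (rule order_tendstoD(2)) (use e in simp)
    then obtain N where N: "\<And>r. r \<ge> N \<Longrightarrow> \<epsilon> r * M t < e / 2" unfolding eventually_sequentially by blast
    have "dist (G r p t) (G r' p t) < e" if "p \<in> P" "r \<ge> N" "r' \<ge> N" for p r r'
      using cauchy[OF that(1), of t r r'] t N[OF that(2)] N[OF that(3)] by (simp add: dist_real_def algebra_simps)
    then show "\<exists>N. \<forall>x\<in>P. \<forall>m\<ge>N. \<forall>n\<ge>N. dist (G m x t) (G n x t) < e" by blast
  qed
  \<comment> \<open>Convergence of the polynomials at each \<open>t > 0\<close> yields convergence
    of their coefficients, uniformly in \<open>p\<close>.\<close>
  then have "uniformly_convergent_on P (\<lambda>r p. b r i p)" if "i < k" for i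
    using that unfolding G_def by (rule uniformly_convergent_coeffs)
  then obtain \<beta> where \<beta>: "\<And>i. i < k \<Longrightarrow> uniform_limit P (\<lambda>r p. b r i p) (\<beta> i) sequentially"
    unfolding uniformly_convergent_on_def by metis
  define \<Gamma> where "\<Gamma> p t = (\<Sum>i<k. \<beta> i p * t ^ i)" for p t
  have Gconv: "(\<lambda>r. G r p t) \<longlonglongrightarrow> \<Gamma> p t" if "p \<in> P" for p t
    unfolding G_def \<Gamma>_def using tendsto_uniform_limitI[OF \<beta> that] by (intro tendsto_intros) auto
  have G\<Gamma>: "\<bar>G r p t - \<Gamma> p t\<bar> \<le> \<epsilon> r * M t" if p: "p \<in> P" and t: "t \<ge> 0" for r p t
  proof -
    have "(\<lambda>r'. \<bar>G r p t - G r' p t\<bar>) \<longlonglongrightarrow> \<bar>G r p t - \<Gamma> p t\<bar>" by (intro tendsto_intros Gconv p)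
    moreover have "(\<lambda>r'. (\<epsilon> r + \<epsilon> r') * M t) \<longlonglongrightarrow> (\<epsilon> r + 0) * M t" by (intro tendsto_intros \<epsilon>)
    ultimately show ?thesis using cauchy[OF p t] LIMSEQ_le by fastforce
  qed
  have deriv: "(g p has_real_derivative \<Gamma> p x) (at x within {0..})" if p: "p \<in> P" and x: "x \<ge> 0" for p x
  proof (rule has_derivative_from_first_order[OF x])
    fix e :: real assume e: "e > 0"
    have "(\<lambda>r. \<epsilon> r * M x) \<longlonglongrightarrow> 0 * M x" "(\<lambda>r. \<epsilon> r * M (x + 1)) \<longlonglongrightarrow> 0 * M (x + 1)" by (intro tendsto_intros \<epsilon>)+
    then have "\<forall>\<^sub>F r in sequentially. \<epsilon> r * M x < e \<and> \<epsilon> r * M (x + 1) < e"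
      using e by (auto intro: order_tendstoD eventually_conj)
    then obtain r where r: "\<epsilon> r * M x < e" "\<epsilon> r * M (x + 1) < e" unfolding eventually_sequentially by blast
    obtain K where K: "K \<ge> 0" "\<forall>t s. 0 \<le> t \<longrightarrow> t \<le> x + 1 \<longrightarrow> 0 \<le> s \<longrightarrow> s \<le> 1 \<longrightarrow>
      \<bar>g p (t + s) - g p t - s * G r p t\<bar> \<le> s * (\<epsilon> r * M (x + 1)) + s\<^sup>2 * K"
      using est[of "x + 1" r] p x by auto
    show "\<exists>Ga K. 0 \<le> K \<and> continuous_on {0..} Ga \<and> \<bar>Ga x - \<Gamma> p x\<bar> \<le> e \<and>
      (\<forall>t s. 0 \<le> t \<longrightarrow> t \<le> x + 1 \<longrightarrow> 0 \<le> s \<longrightarrow> s \<le> 1 \<longrightarrow> \<bar>g p (t + s) - g p t - s * Ga t\<bar> \<le> s * e + s\<^sup>2 * K)"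
    proof (intro exI[of _ "G r p"] exI[of _ K] conjI K allI impI)
      show "continuous_on {0..} (G r p)" unfolding G_def by (intro continuous_intros)
      show "\<bar>G r p x - \<Gamma> p x\<bar> \<le> e" using G\<Gamma>[OF p x, of r] r by linarith
      fix t s :: real assume ts: "0 \<le> t" "t \<le> x + 1" "0 \<le> s" "s \<le> 1"
      have "s * (\<epsilon> r * M (x + 1)) \<le> s * e" using ts r by (intro mult_left_mono) auto
      then show "\<bar>g p (t + s) - g p t - s * G r p t\<bar> \<le> s * e + s\<^sup>2 * K" using K(2) ts by fastforce
    qed
  qed
  \<comment> \<open>The value at \<open>t = 0\<close>, followed by the coefficients of the
    antiderivative of \<Gamma>.\<close>
  define a where "a i p = (case i of 0 \<Rightarrow> mdiff (us p) (C p) | Suc i' \<Rightarrow> \<beta> i' p / real (Suc i'))" for i p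
  have poly: "g p t = (\<Sum>i<Suc k. a i p * t ^ i)" if p: "p \<in> P" and t: "t \<ge> 0" for p t
  proof -
    define h where "h t = g p t - (\<Sum>i<k. \<beta> i p / real (Suc i) * t ^ Suc i)" for t
    have "(h has_real_derivative 0) (at x within {0..})" if "x \<in> {0..}" for x
    proof -
      have "((\<lambda>t. \<Sum>i<k. \<beta> i p / real (Suc i) * t ^ Suc i) has_real_derivative
          (\<Sum>i<k. \<beta> i p / real (Suc i) * (real (Suc i) * x ^ i))) (at x within {0..})"
        by (rule DERIV_sum, rule DERIV_cmult, rule derivative_eq_intros) auto
      then have "((\<lambda>t. \<Sum>i<k. \<beta> i p / real (Suc i) * t ^ Suc i) has_real_derivative \<Gamma> p x) (at x within {0..})"
        by (simp add: \<Gamma>_def del: of_nat_Suc power_Suc)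
      from DERIV_diff[OF deriv[OF p, of x] this] that show ?thesis unfolding h_def by simp
    qed
    then obtain c where c: "\<And>x. x \<in> {0..} \<Longrightarrow> h x = c"
      using has_field_derivative_zero_constant[of "{0..}" h] by auto
    have "h t = h 0" using c[of t] c[of 0] t by simp
    moreover have "h 0 = mdiff (us p) (C p)"
    proof -
      have "(*\<^sub>R) 0 ` L = {0}" using L(2) by auto
      then show ?thesis by (simp add: h_def g_def)
    qed
    ultimately have "g p t = mdiff (us p) (C p) + (\<Sum>i<k. \<beta> i p / real (Suc i) * t ^ Suc i)" by (simp add: h_def)
    then show ?thesis unfolding sum.lessThan_Suc_shift by (simp add: a_def del: of_nat_Suc power_Suc)
  qed
  have lims: "iter_lim zp zn i P (\<lambda>vs p. mdiff (us p @ vs) (C p)) (\<lambda>p. fact i * a i p)" if i: "i < Suc k" for i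
  proof (cases i)
    case 0
    then show ?thesis by (simp add: a_def)
  next
    case (Suc j)
    then have j: "j < k" using i by simp
    have "uniform_limit P (\<lambda>r p. fact j * b r j p) (\<lambda>p. fact j * \<beta> j p) sequentially"
      using bounded_linear.uniform_limit[OF bounded_linear_mult_right \<beta>[OF j]] by (simp add: comp_def)
    moreover have "fact j * \<beta> j p = fact (Suc j) * a (Suc j) p" for p
      unfolding a_def nat.case fact_Suc by (simp del: of_nat_Suc)
    ultimately have "uniform_limit P (\<lambda>r p. (\<Sum>u\<leftarrow>zp r. fact j * A u j p) - (\<Sum>u\<leftarrow>zn r. fact j * A u j p))
        (\<lambda>p. fact (Suc j) * a (Suc j) p) sequentially"
      by (simp only: b_def right_diff_distrib sum_list_const_mult)
    moreover have "iter_lim zp zn j P (\<lambda>vs p. mdiff (us p @ u # vs) (C p)) (\<lambda>p. fact j * A u j p)" for u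
      using AL[OF j, of u] by simp
    ultimately show ?thesis unfolding Suc by (auto intro!: exI[of _ "\<lambda>u p. fact j * A u j p"])
  qed
  show ?case using poly lims unfolding g_def by blast
qed

section \<open>Orthogonal invariance and volumes of projections\<close>

text \<open>Uniqueness of translation invariant measures: integrating \<open>1\<^sub>A(f x) 1\<^sub>B(y - f x)\<close> in both orders, where
  the unit ball \<open>B\<close> is invariant under \<open>f\<close>, shows that Lebesgue measure is invariant under \<open>f\<close>.\<close>

lemma lborel_orthogonal_transformation:
  fixes f :: "'a::euclidean_space \<Rightarrow> 'a"
  assumes f: "orthogonal_transformation f"
  shows "distr lborel borel f = lborel"
proof (rule measure_eqI)
  fix A :: "'a set" assume "A \<in> sets (distr lborel borel f)"
  then have A [measurable]: "A \<in> sets borel" by simp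
  have lin: "linear f" and nf: "\<And>x. norm (f x) = norm x" and sj: "surj f"
    using f by (auto simp: orthogonal_transformation orthogonal_transformation_surj)
  have fm [measurable]: "f \<in> borel_measurable borel"
    using lin by (intro borel_measurable_continuous_onI linear_continuous_on) (simp add: linear_conv_bounded_linear)
  define B where "B = ball (0::'a) 1"
  have B [measurable]: "B \<in> sets borel" by (simp add: B_def)
  have trans: "(\<integral>\<^sup>+x. g (c + x) \<partial>lborel) = (\<integral>\<^sup>+x. g x \<partial>lborel)" if "g \<in> borel_measurable borel" for g :: "'a \<Rightarrow> ennreal" and c
    by (subst (2) lborel_distr_plus[of c, symmetric], subst nn_integral_distr) (use that in simp_all)
  have "emeasure lborel (f -` A) * emeasure lborel B = (\<integral>\<^sup>+x. \<integral>\<^sup>+y. indicator A (f x) * indicator B (y - f x) \<partial>lborel \<partial>lborel)"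
  proof -
    have "(\<integral>\<^sup>+y. indicator A (f x) * indicator B (y - f x) \<partial>lborel) = indicator A (f x) * emeasure lborel B" for x
      using trans[of "\<lambda>y. indicator B y" "- f x"] B by (simp add: nn_integral_cmult)
    then have "(\<integral>\<^sup>+x. \<integral>\<^sup>+y. indicator A (f x) * indicator B (y - f x) \<partial>lborel \<partial>lborel) =
      (\<integral>\<^sup>+x. indicator (f -` A) x * emeasure lborel B \<partial>lborel)" by (simp add: indicator_def)
    also have "\<dots> = emeasure lborel (f -` A) * emeasure lborel B"
      using measurable_sets_borel[OF fm A] by (subst nn_integral_multc) auto
    finally show ?thesis by simp
  qed
  also have "\<dots> = (\<integral>\<^sup>+y. \<integral>\<^sup>+x. indicator A (f x) * indicator B (y - f x) \<partial>lborel \<partial>lborel)"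
    by (intro lborel_pair.Fubini') measurable
  also have "\<dots> = (\<integral>\<^sup>+y. \<integral>\<^sup>+x. indicator A (f x + y) * indicator B x \<partial>lborel \<partial>lborel)"
  proof (rule nn_integral_cong)
    fix y :: 'a
    \<comment> \<open>After translation by a preimage \<open>z\<close> of \<open>y\<close>, the
      vector \<open>y - f (z + x)\<close> equals \<open>- f x\<close>, which lies in the ball
      exactly when \<open>x\<close> does.\<close>
    obtain z where z: "f z = y" using sj by (metis surjD)
    have fz: "f (z + x) = f x + y" for x using z lin by (simp add: linear_add)
    have "(\<integral>\<^sup>+x. indicator A (f x) * indicator B (y - f x) \<partial>lborel) =
        (\<integral>\<^sup>+x. indicator A (f (z + x)) * indicator B (y - f (z + x)) \<partial>lborel)"
      by (rule trans[symmetric]) measurable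
    also have "\<dots> = (\<integral>\<^sup>+x. indicator A (f x + y) * indicator B x \<partial>lborel)"
      unfolding fz by (intro nn_integral_cong) (auto simp: B_def indicator_def nf)
    finally show "(\<integral>\<^sup>+x. indicator A (f x) * indicator B (y - f x) \<partial>lborel) = \<dots>" .
  qed
  also have "\<dots> = (\<integral>\<^sup>+x. \<integral>\<^sup>+y. indicator A (f x + y) * indicator B x \<partial>lborel \<partial>lborel)"
    by (intro lborel_pair.Fubini'[symmetric]) measurable
  also have "\<dots> = (\<integral>\<^sup>+x. emeasure lborel A * indicator B x \<partial>lborel)"
  proof (rule nn_integral_cong)
    fix x :: 'a
    show "(\<integral>\<^sup>+y. indicator A (f x + y) * indicator B x \<partial>lborel) = emeasure lborel A * indicator B x"
      using trans[of "\<lambda>y. indicator A y" "f x"] A by (simp add: nn_integral_multc)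
  qed
  also have "\<dots> = emeasure lborel A * emeasure lborel B" using B by (simp add: nn_integral_cmult)
  finally have "emeasure lborel (f -` A) * emeasure lborel B = emeasure lborel A * emeasure lborel B" .
  moreover have "emeasure lborel B \<noteq> 0" "emeasure lborel B \<noteq> \<infinity>"
    unfolding B_def using unit_ball_vol_pos[of "real DIM('a)"] by (simp_all add: emeasure_ball less_imp_neq[symmetric])
  ultimately have "emeasure lborel (f -` A) = emeasure lborel A"
    by (metis ennreal_mult_right_cong ennreal_mult_divide_eq infinity_ennreal_def mult.commute mult_divide_eq_ennreal)
  then show "emeasure (distr lborel borel f) A = emeasure lborel A"
    using A fm by (simp add: emeasure_distr)
qed simp

section \<open>Orthonormal lists and volumes of projections\<close>

definition orthonormal_list :: "'a::real_inner list \<Rightarrow> bool" where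
  "orthonormal_list us \<longleftrightarrow> (\<forall>i<length us. \<forall>j<length us. inner (us ! i) (us ! j) = (if i = j then 1 else 0))"

lemma orthonormal_list_norm: "orthonormal_list us \<Longrightarrow> u \<in> set us \<Longrightarrow> norm u = 1"
  by (auto simp: orthonormal_list_def in_set_conv_nth norm_eq_1)

lemma orthonormal_expansion:
  assumes us: "orthonormal_list us" and x: "x \<in> span (set us)"
  shows "(\<Sum>u\<leftarrow>us. inner x u *\<^sub>R u) = x"
  using x
proof (rule span_induct)
  show "subspace {x. (\<Sum>u\<leftarrow>us. inner x u *\<^sub>R u) = x}"
  proof (rule subspaceI)
    fix c x assume "x \<in> {x. (\<Sum>u\<leftarrow>us. inner x u *\<^sub>R u) = x}"
    then have "c *\<^sub>R (\<Sum>u\<leftarrow>us. inner x u *\<^sub>R u) = c *\<^sub>R x" by simp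
    moreover have "c *\<^sub>R (\<Sum>u\<leftarrow>us. inner x u *\<^sub>R u) = (\<Sum>u\<leftarrow>us. inner (c *\<^sub>R x) u *\<^sub>R u)"
      by (simp add: sum_list_sum_nth scaleR_sum_right)
    ultimately show "c *\<^sub>R x \<in> {x. (\<Sum>u\<leftarrow>us. inner x u *\<^sub>R u) = x}" by simp
  qed (simp_all add: inner_add_left scaleR_left_distrib sum_list_addf sum_list_triv)
next
  fix x assume "x \<in> set us"
  then obtain i where i: "i < length us" "x = us ! i" by (auto simp: in_set_conv_nth)
  have "(\<Sum>u\<leftarrow>us. inner x u *\<^sub>R u) = (\<Sum>k<length us. inner (us ! i) (us ! k) *\<^sub>R us ! k)"
    by (simp add: sum_list_sum_nth i(2) lessThan_atLeast0)
  also have "\<dots> = (\<Sum>k<length us. if i = k then us ! k else 0)"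
    using us i by (intro sum.cong) (auto simp: orthonormal_list_def)
  also have "\<dots> = x" using i by simp
  finally show "(\<Sum>u\<leftarrow>us. inner x u *\<^sub>R u) = x" .
qed

text \<open>Every slope in the upper estimate repeats a direction of \<open>us\<close> and therefore
  vanishes.\<close>

lemma mdiff_plus_zono_self:
  assumes "cconvex C" "s \<ge> 0" "set vs \<subseteq> set us"
  shows "mdiff us (C + zono (map ((*\<^sub>R) s) vs)) = mdiff us C"
proof -
  let ?D = "C + zono (map ((*\<^sub>R) s) vs)"
  have D: "cconvex ?D" using assms by (simp add: cconvex_plus)
  have "mdiff us ?D \<le> mdiff us C + s * (\<Sum>v\<leftarrow>vs. mdiff (v # us) ?D)"
    using assms D by (intro mdiff_plus_zono_le) auto
  also have "(\<Sum>v\<leftarrow>vs. mdiff (v # us) ?D) = (\<Sum>v\<leftarrow>vs. 0)"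
    using mdiff_repeat[OF D, of _ us] assms(3) by (intro arg_cong[of _ _ sum_list] map_cong refl) blast
  also have "\<dots> = 0" by (simp add: sum_list_triv)
  finally have "mdiff us ?D \<le> mdiff us C" by simp
  moreover have "mdiff us C \<le> mdiff us ?D"
    using assms D by (intro mdiff_mono subset_plus_right) auto
  ultimately show ?thesis by simp
qed

text \<open>Along orthonormal directions only the image modulo their span matters: \<open>D\<close>
  is covered by \<open>C\<close> plus a large box in these directions, and adding such a box changes
  nothing.\<close>

lemma mdiff_mono_mod_span:
  assumes us: "orthonormal_list us" and C: "cconvex C" and D: "cconvex D"
    and sub: "\<And>x. x \<in> D \<Longrightarrow> \<exists>y\<in>C. x - y \<in> span (set us)"
  shows "mdiff us D \<le> mdiff us C"
proof -
  have "bounded C" "bounded D" using C D by (auto simp: cconvex_def compact_imp_bounded)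
  then obtain r1 r2 where r: "\<And>x. x \<in> C \<Longrightarrow> norm x \<le> r1" "\<And>x. x \<in> D \<Longrightarrow> norm x \<le> r2"
    unfolding bounded_iff by blast
  \<comment> \<open>At least twice the norm of any difference of a point of \<open>D\<close> and a
    point of \<open>C\<close>.\<close>
  define \<rho> where "\<rho> = 2 * (\<bar>r1\<bar> + \<bar>r2\<bar>) + 1"
  have \<rho>: "\<rho> > 0" by (simp add: \<rho>_def add_nonneg_pos)
  have "D \<subseteq> C + zono (map ((*\<^sub>R) \<rho>) us)"
  proof
    fix x assume x: "x \<in> D"
    then obtain y where y: "y \<in> C" "x - y \<in> span (set us)" using sub by blast
    let ?d = "x - y"
    have nd: "2 * norm ?d \<le> \<rho>" using norm_triangle_ineq4[of x y] r(1)[OF y(1)] r(2)[OF x] by (simp add: \<rho>_def)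
    \<comment> \<open>Each \<open>u\<close> here is \<rho> times a unit vector, so the inner product
      contributes one factor \<rho> and the vector itself another; both cancel against
      \<open>\<rho>\<^sup>2\<close>.\<close>
    have "(\<Sum>u\<leftarrow>map ((*\<^sub>R) \<rho>) us. (inner ?d u / \<rho>\<^sup>2) *\<^sub>R u) = (\<Sum>u\<leftarrow>us. inner ?d u *\<^sub>R u)"
      using \<rho> by (simp add: comp_def power2_eq_square)
    also have "\<dots> = ?d" by (rule orthonormal_expansion[OF us y(2)])
    finally have "?d = (\<Sum>u\<leftarrow>map ((*\<^sub>R) \<rho>) us. (inner ?d u / \<rho>\<^sup>2) *\<^sub>R u)" by simp
    moreover have "\<bar>inner ?d u / \<rho>\<^sup>2\<bar> \<le> 1/2" if u: "u \<in> set (map ((*\<^sub>R) \<rho>) us)" for u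
    proof -
      obtain b where b: "b \<in> set us" "u = \<rho> *\<^sub>R b" using u by auto
      have "\<bar>inner ?d b\<bar> \<le> norm ?d" using Cauchy_Schwarz_ineq2[of ?d b] orthonormal_list_norm[OF us b(1)] by simp
      then have "\<bar>inner ?d b\<bar> / \<rho> \<le> 1/2" using nd \<rho> by (simp add: field_simps)
      then show ?thesis using b \<rho> by (simp add: power2_eq_square abs_mult abs_divide)
    qed
    ultimately have "?d \<in> zono (map ((*\<^sub>R) \<rho>) us)"
      using sum_list_mem_zono[of "map ((*\<^sub>R) \<rho>) us" "\<lambda>u. inner ?d u / \<rho>\<^sup>2"] by simp
    then have "y + ?d \<in> C + zono (map ((*\<^sub>R) \<rho>) us)" using y by blast
    then show "x \<in> C + zono (map ((*\<^sub>R) \<rho>) us)" by simp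
  qed
  then have "mdiff us D \<le> mdiff us (C + zono (map ((*\<^sub>R) \<rho>) us))"
    using C D by (intro mdiff_mono cconvex_plus) auto
  then show ?thesis using mdiff_plus_zono_self[OF C, of \<rho> us us] \<rho> by simp
qed

text \<open>Each long segment contributes \<open>t\<close> times the next difference plus a term of
  lower order, so the growth in \<open>t\<close> is governed by the difference along all of
  \<open>vs\<close>.\<close>

lemma mdiff_zono_asymptotics:
  assumes C: "cconvex C"
  shows "\<exists>K\<ge>0. \<forall>t\<ge>1. mdiff us (C + zono (map ((*\<^sub>R) t) vs)) \<le> t ^ length vs * (mdiff (vs @ us) C + K / t)"
proof (induction vs arbitrary: us)
  case Nil
  then show ?case by auto
next
  case (Cons v vs)
  obtain K1 where K1: "K1 \<ge> 0" "\<And>t. t \<ge> 1 \<Longrightarrow> mdiff us (C + zono (map ((*\<^sub>R) t) vs)) \<le> t ^ length vs * (mdiff (vs @ us) C + K1 / t)"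
    using Cons by blast
  obtain K2 where K2: "K2 \<ge> 0" "\<And>t. t \<ge> 1 \<Longrightarrow> mdiff (v # us) (C + zono (map ((*\<^sub>R) t) vs)) \<le> t ^ length vs * (mdiff (vs @ v # us) C + K2 / t)"
    using Cons[of "v # us"] by blast
  have M1: "mdiff (vs @ us) C \<ge> 0" by (rule mdiff_nonneg[OF C])
  show ?case
  proof (intro exI[of _ "mdiff (vs @ us) C + K1 + K2"] conjI allI impI)
    show "0 \<le> mdiff (vs @ us) C + K1 + K2" using M1 K1 K2 by simp
    fix t :: real assume t: "t \<ge> 1"
    let ?D = "C + zono (map ((*\<^sub>R) t) vs)"
    have "C + zono (map ((*\<^sub>R) t) (v # vs)) = ?D + seg (t *\<^sub>R v)" by (simp add: ac_simps)
    then have "mdiff us (C + zono (map ((*\<^sub>R) t) (v # vs))) = mdiff us ?D + t * mdiff (v # us) ?D"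
      using t C by (simp only: mdiff_plus_seg cconvex_plus cconvex_zono)
    also have "\<dots> \<le> t ^ length vs * (mdiff (vs @ us) C + K1 / t) + t * (t ^ length vs * (mdiff (vs @ v # us) C + K2 / t))"
      using t by (intro add_mono mult_left_mono K1 K2) auto
    also have "\<dots> = t ^ length (v # vs) * (mdiff (vs @ v # us) C + ((mdiff (vs @ us) C + K1 / t) + K2) / t)"
      using t by (simp add: field_simps)
    also have "\<dots> \<le> t ^ length (v # vs) * (mdiff (vs @ v # us) C + ((mdiff (vs @ us) C + K1) + K2) / t)"
    proof -
      have "K1 / t \<le> K1" using K1 t by (simp add: divide_le_eq mult_le_cancel_left1)
      then show ?thesis using t by (intro mult_left_mono add_left_mono divide_right_mono add_right_mono) auto
    qed
    finally show "mdiff us (C + zono (map ((*\<^sub>R) t) (v # vs))) \<le>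
        t ^ length (v # vs) * (mdiff ((v # vs) @ us) C + (mdiff (vs @ us) C + K1 + K2) / t)"
      by (simp only: mdiff_append_Cons append_Cons)
  qed
qed

text \<open>At \<open>t = 1\<close> the volume dominates the difference; as \<open>t\<close> tends
  to infinity the asymptotics give the reverse inequality.\<close>

lemma mdiff_eq_leading_coefficient:
  assumes C: "cconvex C" and V: "\<And>t. t \<ge> 1 \<Longrightarrow> measure lebesgue (C + zono (map ((*\<^sub>R) t) us)) = V * t ^ length us"
  shows "mdiff us C = V"
proof (rule antisym)
  have "zono (map ((*\<^sub>R) 1) us) = zono us" by (simp add: map_idI)
  then show "mdiff us C \<le> V" using mdiff_le_measure[OF C, of us] V[of 1] by simp
  obtain K where K: "K \<ge> 0" "\<And>t. t \<ge> 1 \<Longrightarrow> mdiff [] (C + zono (map ((*\<^sub>R) t) us)) \<le> t ^ length us * (mdiff (us @ []) C + K / t)"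
    using mdiff_zono_asymptotics[OF C] by blast
  have KV: "V \<le> mdiff us C + K / t" if t: "t \<ge> 1" for t
  proof -
    have "t ^ length us * V \<le> t ^ length us * (mdiff us C + K / t)" using K(2)[OF t] V[OF t] by (simp add: mult.commute)
    then show ?thesis using t by simp
  qed
  show "V \<le> mdiff us C"
  proof (rule field_le_epsilon)
    fix e :: real assume e: "e > 0"
    define t where "t = K / e + 1"
    have t: "t \<ge> 1" using K e by (simp add: t_def)
    have "K \<le> e * t" using e by (simp add: t_def field_simps)
    then have "K / t \<le> e" using t by (simp add: field_simps)
    then show "V \<le> mdiff us C + e" using KV[OF t] by simp
  qed
qed

lemma lborel_eq_distr_PiM_Basis:
  fixes e :: "nat \<Rightarrow> 'a::euclidean_space"
  assumes I: "finite I" and e: "bij_betw e I Basis"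
  shows "distr (PiM I (\<lambda>_. lborel)) borel (\<lambda>f. \<Sum>i\<in>I. f i *\<^sub>R e i) = lborel"
proof (rule lborel_eqI[symmetric])
  fix l u :: 'a assume lu: "\<And>b. b \<in> Basis \<Longrightarrow> inner l b \<le> inner u b"
  interpret product_sigma_finite "\<lambda>_::nat. lborel :: real measure" by standard
  have eB: "e i \<in> Basis" if "i \<in> I" for i using e that by (auto simp: bij_betw_def)
  have co: "inner (\<Sum>i\<in>I. f i *\<^sub>R e i) (e k) = f k" if "k \<in> I" for f k
  proof -
    have "inner (\<Sum>i\<in>I. f i *\<^sub>R e i) (e k) = (\<Sum>i\<in>I. f i * inner (e i) (e k))" by (simp add: inner_sum_left)
    also have "\<dots> = (\<Sum>i\<in>I. if i = k then f i else 0)"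
      using that e by (intro sum.cong) (auto simp: inner_Basis eB bij_betw_def inj_on_eq_iff)
    also have "\<dots> = f k" using I that by simp
    finally show ?thesis .
  qed
  have "emeasure (distr (PiM I (\<lambda>_. lborel)) borel (\<lambda>f. \<Sum>i\<in>I. f i *\<^sub>R e i)) (box l u) =
    emeasure (PiM I (\<lambda>_. lborel)) ((\<lambda>f. \<Sum>i\<in>I. f i *\<^sub>R e i) -` box l u \<inter> space (PiM I (\<lambda>_. lborel)))"
    by (rule emeasure_distr) (use I in measurable)
  also have "(\<lambda>f. \<Sum>i\<in>I. f i *\<^sub>R e i) -` box l u \<inter> space (PiM I (\<lambda>_. lborel)) =
      PiE I (\<lambda>i. {inner l (e i)<..<inner u (e i)})"
  proof -
    have "(\<Sum>i\<in>I. f i *\<^sub>R e i) \<in> box l u \<longleftrightarrow> (\<forall>i\<in>I. inner l (e i) < f i \<and> f i < inner u (e i))" for f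
    proof -
      have "(\<Sum>i\<in>I. f i *\<^sub>R e i) \<in> box l u \<longleftrightarrow> (\<forall>b\<in>e ` I. inner l b < inner (\<Sum>i\<in>I. f i *\<^sub>R e i) b \<and> inner (\<Sum>i\<in>I. f i *\<^sub>R e i) b < inner u b)"
        using e by (simp add: mem_box bij_betw_def)
      then show ?thesis by (simp add: co)
    qed
    then show ?thesis by (auto simp: space_PiM PiE_iff)
  qed
  also have "emeasure (PiM I (\<lambda>_. lborel)) \<dots> = (\<Prod>i\<in>I. emeasure lborel {inner l (e i)<..<inner u (e i)})"
    using I by (intro emeasure_PiM) auto
  also have "\<dots> = (\<Prod>i\<in>I. ennreal (inner (u - l) (e i)))"
    using lu eB by (intro prod.cong) (auto simp: inner_diff_left)
  also have "\<dots> = ennreal (\<Prod>i\<in>I. inner (u - l) (e i))"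
    using lu eB by (intro prod_ennreal) (auto simp: inner_diff_left)
  also have "(\<Prod>i\<in>I. inner (u - l) (e i)) = (\<Prod>b\<in>Basis. inner (u - l) b)"
    by (rule prod.reindex_bij_betw[OF e])
  finally show "emeasure (distr (PiM I (\<lambda>_. lborel)) borel (\<lambda>f. \<Sum>i\<in>I. f i *\<^sub>R e i)) (box l u) =
    (\<Prod>b\<in>Basis. inner (u - l) b)" .
qed simp

text \<open>An orthogonal transformation carries a numbering of the standard basis to
  \<open>e\<close>, and \<open>lborel\<close> is invariant under it.\<close>

lemma lborel_eq_distr_PiM_orthonormal:
  fixes e :: "nat \<Rightarrow> 'a::euclidean_space"
  assumes e: "\<And>i j. i < DIM('a) \<Longrightarrow> j < DIM('a) \<Longrightarrow> inner (e i) (e j) = (if i = j then 1 else 0)"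
  shows "distr (PiM {..<DIM('a)} (\<lambda>_. lborel)) borel (\<lambda>f. \<Sum>i<DIM('a). f i *\<^sub>R e i) = lborel"
proof -
  obtain b :: "nat \<Rightarrow> 'a" where b: "bij_betw b {..<DIM('a)} Basis"
    using ex_bij_betw_nat_finite[of "Basis :: 'a set"] by (auto simp: lessThan_atLeast0)
  define T where "T x = (\<Sum>i<DIM('a). inner x (b i) *\<^sub>R e i)" for x
  have lin: "linear T" unfolding T_def
    by (intro linear_compose_sum ballI) (auto intro!: linearI simp: inner_add_left scaleR_left_distrib)
  have "inner (T x) (T y) = inner x y" for x y
  proof -
    have "inner (T x) (T y) = (\<Sum>i<DIM('a). \<Sum>k<DIM('a). inner x (b i) * (inner y (b k) * inner (e i) (e k)))"
      unfolding T_def inner_sum_left by (simp add: inner_sum_right sum_distrib_left mult.left_commute)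
    also have "\<dots> = (\<Sum>i<DIM('a). \<Sum>k<DIM('a). if i = k then inner x (b i) * inner y (b k) else 0)"
      by (intro sum.cong refl) (auto simp: e)
    also have "\<dots> = (\<Sum>i<DIM('a). inner x (b i) * inner y (b i))" by simp
    also have "\<dots> = (\<Sum>v\<in>Basis. inner x v * inner y v)" by (rule sum.reindex_bij_betw[OF b])
    also have "\<dots> = inner x y" by (rule euclidean_inner[symmetric])
    finally show ?thesis .
  qed
  then have orth: "orthogonal_transformation T" using lin by (simp add: orthogonal_transformation_def)
  have Tm: "T \<in> borel_measurable borel"
    using lin by (intro borel_measurable_continuous_onI linear_continuous_on) (simp add: linear_conv_bounded_linear)
  have Tb: "T (b k) = e k" if "k < DIM('a)" for k
  proof -
    have "T (b k) = (\<Sum>i<DIM('a). if k = i then e i else 0)" unfolding T_def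
      using that bij_betwE[OF b] bij_betw_imp_inj_on[OF b]
      by (intro sum.cong refl) (auto simp: inner_Basis inj_on_eq_iff)
    then show ?thesis using that by simp
  qed
  have "lborel = distr lborel borel T" using lborel_orthogonal_transformation[OF orth] by simp
  also have "\<dots> = distr (distr (PiM {..<DIM('a)} (\<lambda>_. lborel)) borel (\<lambda>f. \<Sum>i<DIM('a). f i *\<^sub>R b i)) borel T"
    using lborel_eq_distr_PiM_Basis[OF _ b] by simp
  also have "\<dots> = distr (PiM {..<DIM('a)} (\<lambda>_. lborel)) borel (T \<circ> (\<lambda>f. \<Sum>i<DIM('a). f i *\<^sub>R b i))"
    by (rule distr_distr[OF Tm]) measurable
  also have "T \<circ> (\<lambda>f. \<Sum>i<DIM('a). f i *\<^sub>R b i) = (\<lambda>f. \<Sum>i<DIM('a). f i *\<^sub>R e i)"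
    by (auto simp: fun_eq_iff linear_sum[OF lin] linear_cmul[OF lin] Tb)
  finally show ?thesis by simp
qed

lemma mem_zono_iff:
  "z \<in> zono vs \<longleftrightarrow> (\<exists>c::nat \<Rightarrow> real. (\<forall>i<length vs. \<bar>c i\<bar> \<le> 1/2) \<and> z = (\<Sum>i<length vs. c i *\<^sub>R vs ! i))"
proof (induction vs arbitrary: z)
  case (Cons v vs)
  show ?case
  proof
    assume "z \<in> zono (v # vs)"
    then obtain x y where xy: "x \<in> seg v" "y \<in> zono vs" "z = x + y" by (auto simp: set_plus_iff)
    obtain t where t: "t \<in> {-(1/2)..1/2}" "x = t *\<^sub>R v" using xy(1) unfolding seg_def by blast
    obtain c where c: "\<And>i. i < length vs \<Longrightarrow> \<bar>c i\<bar> \<le> 1/2" "y = (\<Sum>i<length vs. c i *\<^sub>R vs ! i)"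
      using Cons xy(2) by blast
    have "z = (\<Sum>i<length (v # vs). (case i of 0 \<Rightarrow> t | Suc i \<Rightarrow> c i) *\<^sub>R (v # vs) ! i)"
      unfolding list.size add_0_right add_Suc_right sum.lessThan_Suc_shift by (simp add: xy t c)
    moreover have "\<bar>case i of 0 \<Rightarrow> t | Suc i \<Rightarrow> c i\<bar> \<le> 1/2" if "i < length (v # vs)" for i
      using that t c by (cases i) (auto simp: abs_le_iff)
    ultimately show "\<exists>c::nat \<Rightarrow> real. (\<forall>i<length (v # vs). \<bar>c i\<bar> \<le> 1/2) \<and> z = (\<Sum>i<length (v # vs). c i *\<^sub>R (v # vs) ! i)"
      by blast
  next
    assume "\<exists>c::nat \<Rightarrow> real. (\<forall>i<length (v # vs). \<bar>c i\<bar> \<le> 1/2) \<and> z = (\<Sum>i<length (v # vs). c i *\<^sub>R (v # vs) ! i)"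
    then obtain c :: "nat \<Rightarrow> real" where c: "\<And>i. i < length (v # vs) \<Longrightarrow> \<bar>c i\<bar> \<le> 1/2"
      "z = (\<Sum>i<length (v # vs). c i *\<^sub>R (v # vs) ! i)" by blast
    have "z = c 0 *\<^sub>R v + (\<Sum>i<length vs. c (Suc i) *\<^sub>R vs ! i)"
      unfolding c(2) list.size add_0_right add_Suc_right sum.lessThan_Suc_shift by simp
    moreover have "c 0 *\<^sub>R v \<in> seg v" unfolding seg_def using c(1)[of 0] by (intro imageI) (simp add: abs_le_iff, linarith)
    moreover have "(\<Sum>i<length vs. c (Suc i) *\<^sub>R vs ! i) \<in> zono vs"
      unfolding Cons by (rule exI[of _ "\<lambda>i. c (Suc i)"]) (use c(1) in auto)
    ultimately show "z \<in> zono (v # vs)" by (auto intro: set_plus_intro)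
  qed
qed simp

lemma orthonormal_list_append_iff:
  "orthonormal_list (us @ vs) \<longleftrightarrow> orthonormal_list us \<and> orthonormal_list vs \<and> (\<forall>u\<in>set us. \<forall>v\<in>set vs. inner u v = 0)"
proof
  assume o: "orthonormal_list (us @ vs)"
  have 1: "inner (us ! i) (us ! j) = (if i = j then 1 else 0)" if "i < length us" "j < length us" for i j
    using o[unfolded orthonormal_list_def, rule_format, of i j] that by (simp add: nth_append)
  have 2: "inner (vs ! i) (vs ! j) = (if i = j then 1 else 0)" if "i < length vs" "j < length vs" for i j
    using o[unfolded orthonormal_list_def, rule_format, of "length us + i" "length us + j"] that by (simp add: nth_append)
  have 3: "inner (us ! i) (vs ! j) = 0" if "i < length us" "j < length vs" for i j
    using o[unfolded orthonormal_list_def, rule_format, of i "length us + j"] that by (simp add: nth_append)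
  show "orthonormal_list us \<and> orthonormal_list vs \<and> (\<forall>u\<in>set us. \<forall>v\<in>set vs. inner u v = 0)"
    using 1 2 3 by (auto simp: orthonormal_list_def in_set_conv_nth)
next
  assume o: "orthonormal_list us \<and> orthonormal_list vs \<and> (\<forall>u\<in>set us. \<forall>v\<in>set vs. inner u v = 0)"
  then show "orthonormal_list (us @ vs)"
    by (auto simp: orthonormal_list_def nth_append inner_commute)
qed

lemma orthonormal_list_span:
  fixes us :: "'a::euclidean_space list"
  assumes us: "orthonormal_list us" and len: "length us = DIM('a)"
  shows "span (set us) = UNIV"
proof -
  have dist: "distinct us"
    using us unfolding distinct_conv_nth orthonormal_list_def by (metis zero_neq_one)
  have "pairwise orthogonal (set us)"
    using us by (auto simp: pairwise_def orthogonal_def orthonormal_list_def in_set_conv_nth)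
  moreover have "0 \<notin> set us" using orthonormal_list_norm[OF us] by force
  ultimately have "independent (set us)" by (rule pairwise_orthogonal_independent)
  then have "dim (set us) = DIM('a)" using dist len by (simp add: dim_eq_card_independent distinct_card)
  then show ?thesis by (simp add: dim_eq_full)
qed

text \<open>In the coordinates of \<open>e\<close> the set is a product, and the product measure
  splits into the first \<open>k\<close> indices and the rest.\<close>

lemma measure_orthonormal_cylinder:
  fixes e :: "nat \<Rightarrow> 'a::euclidean_space"
  assumes e: "\<And>i j. i < DIM('a) \<Longrightarrow> j < DIM('a) \<Longrightarrow> inner (e i) (e j) = (if i = j then 1 else 0)"
    and k: "k \<le> DIM('a)" and t: "t \<ge> 0" and X [measurable]: "X \<in> sets (PiM {..<k} (\<lambda>_. lborel))"
  shows "measure lborel {y. (\<lambda>i\<in>{..<k}. inner y (e i)) \<in> X \<and> (\<forall>i\<in>{k..<DIM('a)}. \<bar>inner y (e i)\<bar> \<le> t / 2)} =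
    measure (PiM {..<k} (\<lambda>_. lborel)) X * t ^ (DIM('a) - k)"
proof -
  interpret product_sigma_finite "\<lambda>_::nat. lborel :: real measure" by standard
  define I J where "I = {..<k}" and "J = {k..<DIM('a)}"
  have IJ: "I \<inter> J = {}" "I \<union> J = {..<DIM('a)}" "finite I" "finite J" using k by (auto simp: I_def J_def)
  let ?P = "\<lambda>A. PiM A (\<lambda>_::nat. lborel :: real measure)"
  define S where "S = {y. (\<lambda>i\<in>I. inner y (e i)) \<in> X \<and> (\<forall>i\<in>J. \<bar>inner y (e i)\<bar> \<le> t / 2)}"
  have Sm: "S \<in> sets borel"
  proof -
    have "(\<lambda>y. \<lambda>i\<in>I. inner y (e i)) \<in> borel \<rightarrow>\<^sub>M ?P I" by (intro measurable_restrict) simp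
    then have "(\<lambda>y. \<lambda>i\<in>I. inner y (e i)) -` X \<inter> space borel \<in> sets borel"
      using X unfolding I_def[symmetric] by (rule measurable_sets)
    moreover have "{y. \<forall>i\<in>J. \<bar>inner y (e i)\<bar> \<le> t / 2} \<in> sets borel"
      using IJ(4) by measurable
    moreover have "S = ((\<lambda>y. \<lambda>i\<in>I. inner y (e i)) -` X \<inter> space borel) \<inter> {y. \<forall>i\<in>J. \<bar>inner y (e i)\<bar> \<le> t / 2}"
      by (auto simp: S_def)
    ultimately show ?thesis by auto
  qed
  define F where "F f = (\<Sum>i<DIM('a). f i *\<^sub>R e i)" for f
  have Fe: "inner (F f) (e i) = f i" if "i < DIM('a)" for f i
  proof -
    have "inner (F f) (e i) = (\<Sum>l<DIM('a). f l * inner (e l) (e i))" by (simp add: F_def inner_sum_left)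
    also have "\<dots> = (\<Sum>l<DIM('a). if l = i then f l else 0)" using that by (intro sum.cong refl) (auto simp: e)
    finally show ?thesis using that by simp
  qed
  define Y where "Y = PiE J (\<lambda>_. {- (t/2)..t/2})"
  have XI: "X \<in> sets (?P I)" using X by (simp add: I_def)
  have Xs: "X \<subseteq> space (?P I)" by (rule sets.sets_into_space[OF XI])
  have Ym: "Y \<in> sets (?P J)" unfolding Y_def using IJ(4) by (intro sets_PiM_I_finite) auto
  have Fm: "F \<in> ?P (I \<union> J) \<rightarrow>\<^sub>M borel" unfolding F_def IJ(2) by measurable
  have mm: "merge I J \<in> ?P I \<Otimes>\<^sub>M ?P J \<rightarrow>\<^sub>M ?P (I \<union> J)" by measurable
  have "emeasure lborel S = emeasure (distr (?P (I \<union> J)) borel F) S"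
    unfolding IJ(2) F_def using lborel_eq_distr_PiM_orthonormal[OF e] by simp
  also have "\<dots> = emeasure (?P (I \<union> J)) (F -` S \<inter> space (?P (I \<union> J)))" by (rule emeasure_distr[OF Fm Sm])
  also have "\<dots> = emeasure (distr (?P I \<Otimes>\<^sub>M ?P J) (?P (I \<union> J)) (merge I J)) (F -` S \<inter> space (?P (I \<union> J)))"
    by (simp only: distr_merge[OF IJ(1,3,4)])
  also have "\<dots> = emeasure (?P I \<Otimes>\<^sub>M ?P J) (merge I J -` (F -` S \<inter> space (?P (I \<union> J))) \<inter> space (?P I \<Otimes>\<^sub>M ?P J))"
    by (rule emeasure_distr[OF mm]) (rule measurable_sets[OF Fm Sm])
  also have "merge I J -` (F -` S \<inter> space (?P (I \<union> J))) \<inter> space (?P I \<Otimes>\<^sub>M ?P J) = X \<times> Y"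
  proof -
    have "F (merge I J (f, g)) \<in> S \<longleftrightarrow> f \<in> X \<and> (\<forall>i\<in>J. g i \<in> {- (t/2)..t/2})"
      if fg: "f \<in> space (?P I)" "g \<in> space (?P J)" for f g
    proof -
      have "(\<lambda>i\<in>I. inner (F (merge I J (f, g))) (e i)) = (\<lambda>i\<in>I. f i)"
        using k by (intro restrict_ext) (auto simp: I_def Fe merge_def)
      also have "\<dots> = f" using fg(1) by (auto simp: space_PiM PiE_def extensional_restrict)
      finally have 1: "(\<lambda>i\<in>I. inner (F (merge I J (f, g))) (e i)) = f" .
      have 2: "inner (F (merge I J (f, g))) (e i) = g i" if "i \<in> J" for i
        using that IJ(1) by (subst Fe) (auto simp: J_def I_def merge_def)
      show ?thesis unfolding S_def mem_Collect_eq 1 by (auto simp: 2 abs_le_iff minus_le_iff)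
    qed
    then show ?thesis
      using Xs measurable_space[OF mm] by (auto simp: space_pair_measure Y_def space_PiM PiE_iff)
  qed
  also have "emeasure (?P I \<Otimes>\<^sub>M ?P J) (X \<times> Y) = emeasure (?P I) X * emeasure (?P J) Y"
  proof -
    interpret J: sigma_finite_measure "?P J" by (rule sigma_finite[OF IJ(4)])
    show ?thesis by (rule J.emeasure_pair_measure_Times[OF XI Ym])
  qed
  also have "emeasure (?P J) Y = ennreal (t ^ (DIM('a) - k))"
    unfolding Y_def using IJ(4) t by (subst emeasure_PiM) (auto simp: J_def ennreal_power)
  finally have "emeasure lborel S = emeasure (?P I) X * ennreal (t ^ (DIM('a) - k))" .
  then show ?thesis using t by (simp add: measure_def enn2real_mult S_def I_def J_def)
qed

lemma is_onb_ex:
  assumes "subspace E" "dim E = k"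
  shows "\<exists>b. is_onb E k b"
proof -
  obtain B where B: "B \<subseteq> E" "pairwise orthogonal B" "\<And>x. x \<in> B \<Longrightarrow> norm x = 1" "independent B" "card B = dim E" "span B = E"
    using orthonormal_basis_subspace[OF assms(1)] by metis
  have "finite B" using B(4) by (rule independent_imp_finite)
  then obtain b where b: "bij_betw b {..<k} B"
    using ex_bij_betw_nat_finite[of B] B(5) assms(2) by (auto simp: lessThan_atLeast0)
  then have "b ` {..<k} = B" "inj_on b {..<k}" by (auto simp: bij_betw_def)
  then show ?thesis using B unfolding is_onb_def
    by (intro exI[of _ b]) (auto simp: pairwise_def orthogonal_def inj_on_eq_iff)
qed

text \<open>If \<open>C\<close> is the projection of \<open>K\<close>, then \<open>C\<close> plus
  long segments along \<open>bs\<close> is a right cylinder over \<open>C\<close>, whose volume has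
  the measure of the base as leading coefficient. Passing from \<open>K\<close> to \<open>C\<close>
  moves points only within the span of \<open>bs\<close>, which the difference does not see.\<close>

lemma vol_sub_orth_proj:
  fixes K :: "'a::euclidean_space set"
  assumes E: "subspace E" "dim E = k" and K: "cconvex K"
    and bs: "orthonormal_list bs" "length bs = DIM('a) - k" "\<And>b x. b \<in> set bs \<Longrightarrow> x \<in> E \<Longrightarrow> inner b x = 0"
  shows "vol_sub k E (orth_proj E ` K) = mdiff bs K"
proof -
  \<comment> \<open>The very basis selected in \<open>vol_sub\<close>, so no independence of the
    choice of basis is invoked.\<close>
  define w where "w = (SOME b. is_onb E k b)"
  have w: "is_onb E k w" unfolding w_def by (rule someI_ex[OF is_onb_ex[OF E]])
  have kn: "k \<le> DIM('a)" using dim_subset_UNIV[of E] E(2) by simp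
  define ws where "ws = map w [0..<k]"
  have ws: "orthonormal_list ws" using w by (auto simp: orthonormal_list_def is_onb_def ws_def norm_eq_1)
  have wsE: "span (set ws) = E" using w by (auto simp: is_onb_def ws_def lessThan_atLeast0)
  have wE: "u \<in> E" if "u \<in> set ws" for u using that wsE span_base by blast
  define es where "es = ws @ bs"
  have es: "orthonormal_list es" "length es = DIM('a)"
    unfolding es_def orthonormal_list_append_iff using ws bs wE kn by (auto simp: inner_commute ws_def)
  have esw: "es ! i = w i" if "i < k" for i using that by (simp add: es_def ws_def nth_append)
  have esb: "es ! (k + i) = bs ! i" if "i < length bs" for i using that by (simp add: es_def ws_def nth_append)
  have exp: "(\<Sum>u\<leftarrow>es. inner x u *\<^sub>R u) = x" for x
    using orthonormal_expansion[OF es(1)] orthonormal_list_span[OF es] by simp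
  define p where "p x = (\<Sum>u\<leftarrow>ws. inner x u *\<^sub>R u)" for x
  have plin: "linear p"
    unfolding p_def
    by (rule linearI) (simp_all add: inner_add_left scaleR_left_distrib sum_list_sum_nth sum.distrib scaleR_sum_right)
  have pE: "p x \<in> E" for x
  proof -
    have "p x = (\<Sum>i<length ws. inner x (ws ! i) *\<^sub>R ws ! i)" unfolding p_def by (simp add: sum_list_sum_nth lessThan_atLeast0)
    also have "\<dots> \<in> E" using wE E(1) by (intro subspace_sum subspace_mul) auto
    finally show ?thesis .
  qed
  have xp: "x - p x = (\<Sum>u\<leftarrow>bs. inner x u *\<^sub>R u)" for x using exp[of x] unfolding es_def p_def by (simp add: algebra_simps)
  have xpb: "x - p x \<in> span (set bs)" for x
  proof -
    have "x - p x = (\<Sum>i<length bs. inner x (bs ! i) *\<^sub>R bs ! i)" unfolding xp by (simp add: sum_list_sum_nth lessThan_atLeast0)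
    also have "\<dots> \<in> span (set bs)" by (intro span_sum span_mul span_base) auto
    finally show ?thesis .
  qed
  have bE: "inner z x = 0" if "z \<in> span (set bs)" "x \<in> E" for z x
    using that(1)
  proof (rule span_induct)
    show "subspace {z. inner z x = 0}" by (rule subspaceI) (auto simp: inner_add_left)
  qed (use bs(3) that in auto)
  have op: "orth_proj E x = p x" for x
    unfolding orth_proj_def
  proof (rule the_equality)
    show "p x \<in> E \<and> (\<forall>z\<in>E. inner (x - p x) z = 0)" using pE bE[OF xpb] by blast
    fix y assume y: "y \<in> E \<and> (\<forall>z\<in>E. inner (x - y) z = 0)"
    have yE: "y - p x \<in> E" using y pE E(1) by (simp add: subspace_diff)
    have "inner (y - p x) (y - p x) = inner (x - p x) (y - p x) - inner (x - y) (y - p x)"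
      by (simp add: inner_diff_left)
    also have "\<dots> = 0" using y yE bE[OF xpb yE] by simp
    finally show "y = p x" by simp
  qed
  define C where "C = p ` K"
  have C: "cconvex C" unfolding C_def by (rule cconvex_linear_image[OF plin K])
  have CE: "x \<in> E" if "x \<in> C" for x using that pE by (auto simp: C_def)
  have pid: "p x = x" if "x \<in> E" for x unfolding p_def using orthonormal_expansion[OF ws] wsE that by simp
  let ?co = "\<lambda>x. \<lambda>i\<in>{..<k}. inner x (es ! i)"
  have coE: "?co x = (\<lambda>i\<in>{..<k}. inner x (w i))" for x by (intro restrict_ext) (simp add: esw)
  define X where "X = ?co ` C"
  have coinj: "x = y" if "?co x = ?co y" "x \<in> E" "y \<in> E" for x y
  proof -
    have "inner x u = inner y u" if u: "u \<in> set ws" for u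
    proof -
      obtain i where i: "i < k" "u = w i" using u by (auto simp: ws_def)
      then show ?thesis using fun_cong[OF \<open>?co x = ?co y\<close>, of i] by (simp add: esw)
    qed
    then have "p x = p y" unfolding p_def by (intro arg_cong[of _ _ sum_list] map_cong) auto
    then show ?thesis using pid that by simp
  qed
  \<comment> \<open>\<open>H\<close> rebuilds a point of \<open>E\<close> from its coordinates, so
    \<open>X\<close> is a preimage of the compact set \<open>C\<close> and thus measurable.\<close>
  have Xm: "X \<in> sets (PiM {..<k} (\<lambda>_. lborel))"
  proof -
    define H where "H f = (\<Sum>i<k. f i *\<^sub>R w i)" for f
    have Hm: "H \<in> PiM {..<k} (\<lambda>_. lborel) \<rightarrow>\<^sub>M borel" unfolding H_def by measurable
    have HE: "H f \<in> E" for f unfolding H_def using wE E(1) by (intro subspace_sum subspace_mul) (auto simp: ws_def)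
    have Hco: "?co (H f) = f" if "f \<in> space (PiM {..<k} (\<lambda>_. lborel))" for f
    proof
      fix i show "?co (H f) i = f i"
      proof (cases "i < k")
        case True
        have "inner (H f) (w i) = (\<Sum>l<k. f l * inner (w l) (w i))" by (simp add: H_def inner_sum_left)
        also have "\<dots> = (\<Sum>l<k. if l = i then f l else 0)"
          using w True by (intro sum.cong refl) (auto simp: is_onb_def norm_eq_1)
        finally show ?thesis using True by (simp add: esw)
      next
        case False
        then show ?thesis using that by (auto simp: space_PiM PiE_iff extensional_def)
      qed
    qed
    have "X = H -` C \<inter> space (PiM {..<k} (\<lambda>_. lborel))"
    proof (intro equalityI subsetI)
      fix f assume "f \<in> X"
      then obtain x where x: "x \<in> C" "f = ?co x" by (auto simp: X_def)
      have fs: "f \<in> space (PiM {..<k} (\<lambda>_. lborel))" unfolding x by (simp add: space_PiM)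
      have "H f = x" by (rule coinj) (use Hco[OF fs] x CE HE in auto)
      then show "f \<in> H -` C \<inter> space (PiM {..<k} (\<lambda>_. lborel))" using x fs by simp
    next
      fix f assume "f \<in> H -` C \<inter> space (PiM {..<k} (\<lambda>_. lborel))"
      then show "f \<in> X" unfolding X_def using Hco[of f] by (intro image_eqI[of _ _ "H f"]) auto
    qed
    then show ?thesis
      using measurable_sets[OF Hm, of C] C by (simp add: cconvex_def borel_compact)
  qed
  have cyl: "C + zono (map ((*\<^sub>R) t) bs) =
      {y. ?co y \<in> X \<and> (\<forall>i\<in>{k..<DIM('a)}. \<bar>inner y (es ! i)\<bar> \<le> t / 2)}" if t: "t \<ge> 1" for t
  proof (intro equalityI subsetI)
    fix y assume "y \<in> C + zono (map ((*\<^sub>R) t) bs)"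
    then obtain x z where xz: "x \<in> C" "z \<in> zono (map ((*\<^sub>R) t) bs)" "y = x + z" by (auto simp: set_plus_iff)
    obtain c where c: "\<And>i. i < length bs \<Longrightarrow> \<bar>c i\<bar> \<le> 1/2" "z = (\<Sum>i<length bs. c i *\<^sub>R (t *\<^sub>R bs ! i))"
      using xz(2) unfolding mem_zono_iff by auto
    have zb: "z \<in> span (set bs)" unfolding c(2) by (intro span_sum span_mul span_base) auto
    have "inner y u = inner x u" if "u \<in> set ws" for u
      using bE[OF zb wE[OF that]] by (simp add: xz inner_add_left)
    then have "?co y = ?co x" by (intro restrict_ext) (auto simp: esw ws_def)
    moreover have "\<bar>inner y (es ! i)\<bar> \<le> t / 2" if i: "i \<in> {k..<DIM('a)}" for i
    proof -
      define l where "l = i - k"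
      have l: "l < length bs" "i = k + l" using i bs(2) by (auto simp: l_def)
      have "inner x (bs ! l) = 0" using bs(3)[of "bs ! l" x] CE[OF xz(1)] l by (simp add: inner_commute)
      moreover have "inner z (bs ! l) = (\<Sum>i<length bs. c i * (t * inner (bs ! i) (bs ! l)))" by (simp add: c(2) inner_sum_left mult.assoc)
      moreover have "\<dots> = (\<Sum>i<length bs. if i = l then c i * t else 0)"
        using bs(1) l by (intro sum.cong refl) (auto simp: orthonormal_list_def)
      ultimately have "inner y (es ! i) = c l * t" using l by (simp add: xz inner_add_left esb)
      moreover have "\<bar>c l * t\<bar> \<le> 1/2 * t" unfolding abs_mult using c(1)[OF l(1)] t by (intro mult_mono) auto
      ultimately show ?thesis by simp
    qed
    ultimately show "y \<in> {y. ?co y \<in> X \<and> (\<forall>i\<in>{k..<DIM('a)}. \<bar>inner y (es ! i)\<bar> \<le> t / 2)}"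
      using xz(1) by (auto simp: X_def)
  next
    fix y assume "y \<in> {y. ?co y \<in> X \<and> (\<forall>i\<in>{k..<DIM('a)}. \<bar>inner y (es ! i)\<bar> \<le> t / 2)}"
    then have y: "?co y \<in> X" and yb: "\<And>i. i \<in> {k..<DIM('a)} \<Longrightarrow> \<bar>inner y (es ! i)\<bar> \<le> t / 2" by auto
    obtain x where x: "x \<in> C" "?co y = ?co x" using y by (auto simp: X_def)
    have "?co (p y) = ?co y"
    proof (rule restrict_ext)
      fix i assume "i \<in> {..<k}"
      then have "w i \<in> E" "i < k" using wE[of "w i"] by (auto simp: ws_def)
      then show "inner (p y) (es ! i) = inner y (es ! i)"
        using bE[OF xpb, of "w i" y] by (simp add: esw inner_diff_left)
    qed
    then have "p y = x" using x by (intro coinj pE CE) auto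
    have "y - p y = (\<Sum>u\<leftarrow>map ((*\<^sub>R) t) bs. (inner y u / t\<^sup>2) *\<^sub>R u)"
      unfolding xp using t by (simp add: comp_def power2_eq_square)
    also have "\<dots> \<in> zono (map ((*\<^sub>R) t) bs)"
    proof (rule sum_list_mem_zono)
      fix u assume "u \<in> set (map ((*\<^sub>R) t) bs)"
      then obtain l where l: "l < length bs" "u = t *\<^sub>R bs ! l" by (auto simp: in_set_conv_nth)
      have "\<bar>inner y (bs ! l)\<bar> \<le> t / 2" using yb[of "k + l"] l bs(2) by (simp add: esb)
      then show "\<bar>inner y u / t\<^sup>2\<bar> \<le> 1/2" using t l by (simp add: power2_eq_square abs_mult abs_divide field_simps)
    qed
    finally have "x + (y - p y) \<in> C + zono (map ((*\<^sub>R) t) bs)" using x by blast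
    then show "y \<in> C + zono (map ((*\<^sub>R) t) bs)" using \<open>p y = x\<close> by simp
  qed
  have "mdiff bs C = measure (PiM {..<k} (\<lambda>_. lborel)) X"
  proof (rule mdiff_eq_leading_coefficient[OF C])
    fix t :: real assume t: "t \<ge> 1"
    let ?S = "C + zono (map ((*\<^sub>R) t) bs)"
    have "cconvex ?S" using C by (simp add: cconvex_plus)
    then have "measure lebesgue ?S = measure lborel ?S"
      by (intro measure_completion) (auto simp: cconvex_def borel_compact)
    also have "\<dots> = measure (PiM {..<k} (\<lambda>_. lborel)) X * t ^ (DIM('a) - k)"
      unfolding cyl[OF t] using es t kn Xm
      by (intro measure_orthonormal_cylinder) (auto simp: orthonormal_list_def)
    finally show "measure lebesgue ?S = measure (PiM {..<k} (\<lambda>_. lborel)) X * t ^ length bs" using bs(2) by simp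
  qed
  moreover have "mdiff bs C = mdiff bs K"
  proof (rule antisym)
    show "mdiff bs C \<le> mdiff bs K"
    proof (rule mdiff_mono_mod_span[OF bs(1) K C])
      fix x assume "x \<in> C"
      then obtain y where y: "y \<in> K" "x = p y" by (auto simp: C_def)
      have "x - y = - (y - p y)" using y by simp
      then have "x - y \<in> span (set bs)" using span_neg[OF xpb] by metis
      then show "\<exists>y\<in>K. x - y \<in> span (set bs)" using y by blast
    qed
    show "mdiff bs K \<le> mdiff bs C"
      by (rule mdiff_mono_mod_span[OF bs(1) C K]) (use xpb in \<open>auto simp: C_def\<close>)
  qed
  moreover have "vol_sub k E (orth_proj E ` K) = measure (PiM {..<k} (\<lambda>_. lborel)) X"
  proof -
    have "orth_proj E ` K = C" by (auto simp: C_def op)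
    then show ?thesis unfolding vol_sub_def w_def[symmetric] X_def coE by simp
  qed
  ultimately show ?thesis by simp
qed

section \<open>Differences of zonotopes are dense\<close>

text \<open>The support function of \<open>zono us\<close>, as \<open>zsupp_attained\<close> shows;
  the factor 1/2 comes from the centred segments.\<close>

definition zsupp :: "'a::euclidean_space list \<Rightarrow> 'a \<Rightarrow> real" where
  "zsupp us x = (\<Sum>u\<leftarrow>us. \<bar>inner x u\<bar> / 2)"

lemma zsupp_simps [simp]: "zsupp [] x = 0" "zsupp (u # us) x = \<bar>inner x u\<bar> / 2 + zsupp us x"
  "zsupp (us @ vs) x = zsupp us x + zsupp vs x"
  by (simp_all add: zsupp_def)

lemma zsupp_scaleR: "zsupp (map ((*\<^sub>R) c) us) x = \<bar>c\<bar> * zsupp us x"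
  by (induction us) (simp_all add: abs_mult algebra_simps)

text \<open>Membership in the closure, uniformly on the unit sphere, of the linear span of the
  functions \<open>\<bar>inner x u\<bar>\<close>. The goal is that every continuous even function on
  the sphere, in particular a support function of a symmetric body, belongs to it.\<close>

definition zono_dense :: "('a::euclidean_space \<Rightarrow> real) \<Rightarrow> bool" where
  "zono_dense f \<longleftrightarrow> (\<forall>e>0. \<exists>zp zn. \<forall>x. norm x = 1 \<longrightarrow> \<bar>f x - (zsupp zp x - zsupp zn x)\<bar> \<le> e)"

lemma zono_denseI:
  "(\<And>e. e > 0 \<Longrightarrow> \<exists>zp zn. \<forall>x. norm x = 1 \<longrightarrow> \<bar>f x - (zsupp zp x - zsupp zn x)\<bar> \<le> e) \<Longrightarrow> zono_dense f"
  by (simp add: zono_dense_def)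

lemma zono_denseD:
  assumes "zono_dense f" "e > 0"
  obtains zp zn where "\<And>x. norm x = 1 \<Longrightarrow> \<bar>f x - (zsupp zp x - zsupp zn x)\<bar> \<le> e"
  using assms unfolding zono_dense_def by blast

lemma zono_dense_cong:
  "(\<And>x. norm x = 1 \<Longrightarrow> f x = g x) \<Longrightarrow> zono_dense f \<Longrightarrow> zono_dense g"
  unfolding zono_dense_def by metis

lemma zono_dense_lim:
  assumes "\<And>e. e > 0 \<Longrightarrow> \<exists>g. zono_dense g \<and> (\<forall>x. norm x = 1 \<longrightarrow> \<bar>f x - g x\<bar> \<le> e)"
  shows "zono_dense f"
proof (rule zono_denseI)
  fix e :: real assume e: "e > 0"
  obtain g where g: "zono_dense g" "\<And>x. norm x = 1 \<Longrightarrow> \<bar>f x - g x\<bar> \<le> e / 2" using assms[of "e / 2"] e by auto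
  obtain zp zn where z: "\<And>x. norm x = 1 \<Longrightarrow> \<bar>g x - (zsupp zp x - zsupp zn x)\<bar> \<le> e / 2"
    using zono_denseD[OF g(1), of "e / 2"] e by auto
  have "\<bar>f x - (zsupp zp x - zsupp zn x)\<bar> \<le> e" if "norm x = 1" for x using g(2)[OF that] z[OF that] by linarith
  then show "\<exists>zp zn. \<forall>x. norm x = 1 \<longrightarrow> \<bar>f x - (zsupp zp x - zsupp zn x)\<bar> \<le> e" by blast
qed

lemma zono_dense_add:
  assumes "zono_dense f" "zono_dense g"
  shows "zono_dense (\<lambda>x. f x + g x)"
proof (rule zono_denseI)
  fix e :: real assume e: "e > 0"
  obtain zp zn where z: "\<And>x. norm x = 1 \<Longrightarrow> \<bar>f x - (zsupp zp x - zsupp zn x)\<bar> \<le> e / 2"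
    using zono_denseD[OF assms(1), of "e / 2"] e by auto
  obtain yp yn where y: "\<And>x. norm x = 1 \<Longrightarrow> \<bar>g x - (zsupp yp x - zsupp yn x)\<bar> \<le> e / 2"
    using zono_denseD[OF assms(2), of "e / 2"] e by auto
  have "\<bar>f x + g x - (zsupp (zp @ yp) x - zsupp (zn @ yn) x)\<bar> \<le> e" if "norm x = 1" for x
    using z[OF that] y[OF that] unfolding zsupp_simps by linarith
  then show "\<exists>zp zn. \<forall>x. norm x = 1 \<longrightarrow> \<bar>f x + g x - (zsupp zp x - zsupp zn x)\<bar> \<le> e" by blast
qed

lemma zono_dense_cmult:
  assumes "zono_dense f"
  shows "zono_dense (\<lambda>x. c * f x)"
proof (rule zono_denseI)
  fix e :: real assume e: "e > 0"
  define d where "d = e / (\<bar>c\<bar> + 1)"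
  have d: "d > 0" "\<bar>c\<bar> * d \<le> e"
  proof -
    show "d > 0" using e by (simp add: d_def add_nonneg_pos)
    have "\<bar>c\<bar> * d \<le> (\<bar>c\<bar> + 1) * d" using \<open>d > 0\<close> by (intro mult_right_mono) auto
    also have "\<dots> = e" by (simp add: d_def)
    finally show "\<bar>c\<bar> * d \<le> e" .
  qed
  obtain zp zn where z: "\<And>x. norm x = 1 \<Longrightarrow> \<bar>f x - (zsupp zp x - zsupp zn x)\<bar> \<le> d"
    using zono_denseD[OF assms d(1)] by auto
  have le: "\<bar>c * f x - c * (zsupp zp x - zsupp zn x)\<bar> \<le> e" if "norm x = 1" for x
  proof -
    have "\<bar>c\<bar> * \<bar>f x - (zsupp zp x - zsupp zn x)\<bar> \<le> \<bar>c\<bar> * d" using z[OF that] by (intro mult_left_mono) auto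
    then show ?thesis using d(2) unfolding right_diff_distrib[symmetric] abs_mult by linarith
  qed
  show "\<exists>zp zn. \<forall>x. norm x = 1 \<longrightarrow> \<bar>c * f x - (zsupp zp x - zsupp zn x)\<bar> \<le> e"
  proof (cases "c \<ge> 0")
    case True
    then show ?thesis using le
      by (intro exI[of _ "map ((*\<^sub>R) c) zp"] exI[of _ "map ((*\<^sub>R) c) zn"]) (auto simp: zsupp_scaleR algebra_simps)
  next
    case False
    then show ?thesis using le
      by (intro exI[of _ "map ((*\<^sub>R) c) zn"] exI[of _ "map ((*\<^sub>R) c) zp"]) (auto simp: zsupp_scaleR algebra_simps)
  qed
qed

lemma zono_dense_diff: "zono_dense f \<Longrightarrow> zono_dense g \<Longrightarrow> zono_dense (\<lambda>x. f x - g x)"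
  using zono_dense_add[of f "\<lambda>x. (-1) * g x"] zono_dense_cmult[of g "-1"] by simp

lemma finite_borel_partition:
  fixes S :: "'a::euclidean_space set"
  assumes S: "compact S" and d: "d > 0"
  shows "\<exists>I::nat set. \<exists>A c. finite I \<and> S = (\<Union>i\<in>I. A i) \<and> disjoint_family_on A I \<and>
    (\<forall>i\<in>I. A i \<in> sets borel \<and> A i \<subseteq> ball (c i) d)"
proof -
  obtain k where k: "finite k" "S \<subseteq> (\<Union>x\<in>k. ball x d)"
    using compactE_image[OF S, of S "\<lambda>x. ball x d"] d by (metis (no_types, lifting) UN_I centre_in_ball open_ball subsetI)
  obtain xs where xs: "set xs = k" using finite_list[OF k(1)] by blast
  define B where "B i = S \<inter> ball (xs ! i) d" for i
  define A where "A i = B i - (\<Union>j<i. B j)" for i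
  let ?I = "{..<length xs}"
  have Bm: "B i \<in> sets borel" for i unfolding B_def using S by (auto simp: borel_compact)
  have "disjoint_family_on A ?I"
    unfolding disjoint_family_on_def
  proof (intro ballI impI)
    fix i j :: nat assume "i \<noteq> j"
    then consider "i < j" | "j < i" by linarith
    then show "A i \<inter> A j = {}" by cases (auto simp: A_def)
  qed
  moreover have "S = (\<Union>i\<in>?I. A i)"
  proof (intro equalityI subsetI)
    fix x assume x: "x \<in> S"
    then obtain i where i: "i < length xs" "x \<in> B i" using k xs by (fastforce simp: B_def in_set_conv_nth)
    define l where "l = (LEAST l. x \<in> B l)"
    have "x \<in> B l" "l \<le> i" unfolding l_def using i by (auto intro: LeastI Least_le)
    moreover have "x \<notin> B j" if "j < l" for j using that unfolding l_def by (rule not_less_Least)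
    ultimately have "x \<in> A l" "l \<in> ?I" using i by (auto simp: A_def)
    then show "x \<in> (\<Union>i\<in>?I. A i)" by blast
  qed (auto simp: A_def B_def)
  moreover have "A i \<in> sets borel" for i unfolding A_def by (intro sets.Diff Bm sets.finite_UN) auto
  then have "\<forall>i\<in>?I. A i \<in> sets borel \<and> A i \<subseteq> ball (xs ! i) d"
    by (auto simp: A_def B_def)
  ultimately show ?thesis by (intro exI[of _ ?I] exI[of _ A] exI[of _ "\<lambda>i. xs ! i"]) auto
qed

text \<open>The ball and the measure are invariant under a reflection taking \<open>x\<close> to a
  multiple of a fixed basis vector, so the integral depends on \<open>x\<close> only through its
  norm.\<close>

lemma ball_abs_inner_integral:
  fixes x :: "'a::euclidean_space"
  shows "(LINT u:cball 0 1|lborel. \<bar>inner x u\<bar>) = norm x * (LINT u:cball (0::'a) 1|lborel. \<bar>inner (SOME b. b \<in> Basis) u\<bar>)"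
proof -
  define b :: 'a where "b = (SOME b. b \<in> Basis)"
  have b: "norm b = 1" unfolding b_def by (metis SOME_Basis norm_Basis)
  define y where "y = norm x *\<^sub>R b"
  have ny: "norm y = norm x" by (simp add: y_def b)
  define v where "v = x - y"
  \<comment> \<open>The reflection exchanging \<open>x\<close> and \<open>y\<close>, which have
    equal norm. For \<open>v = 0\<close> the division by zero makes it the identity, as
    required.\<close>
  define f where "f z = z - (2 * inner z v / inner v v) *\<^sub>R v" for z
  have lin: "linear f" unfolding f_def
    by (rule linearI) (simp_all add: inner_add_left algebra_simps add_divide_distrib)
  have "inner (f z) (f w) = inner z w" for z w
  proof (cases "v = 0")
    case False
    then have "inner v v \<noteq> 0" by simp
    then show ?thesis unfolding f_def
      by (simp add: inner_diff_left inner_diff_right inner_commute field_simps)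
  qed (simp add: f_def)
  then have orth: "orthogonal_transformation f" using lin by (simp add: orthogonal_transformation_def)
  have fx: "f x = y"
  proof (cases "v = 0")
    case False
    then have vv: "inner v v \<noteq> 0" by simp
    have "2 * inner x v = inner v v"
    proof -
      have "inner x x = inner y y" using ny by (simp add: norm_eq)
      then show ?thesis by (simp add: v_def inner_diff_left inner_diff_right inner_commute)
    qed
    then have "f x = x - v" using vv by (simp add: f_def)
    then show ?thesis by (simp add: v_def)
  qed (simp add: f_def v_def)
  have fm: "f \<in> borel_measurable borel"
    using lin by (intro borel_measurable_continuous_onI linear_continuous_on) (simp add: linear_conv_bounded_linear)
  have ii: "inner (f z) (f w) = inner z w" "norm (f z) = norm z" for z w
    using orth orthogonal_transformation[of f] by (auto simp: orthogonal_transformation_def)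
  have "(LINT u:cball 0 1|lborel. \<bar>inner y u\<bar>) = (LINT u|distr lborel borel f. indicator (cball 0 1) u *\<^sub>R \<bar>inner y u\<bar>)"
    unfolding lborel_orthogonal_transformation[OF orth] set_lebesgue_integral_def ..
  also have "\<dots> = (LINT u|lborel. indicator (cball 0 1) (f u) *\<^sub>R \<bar>inner y (f u)\<bar>)"
    using fm by (intro integral_distr borel_measurable_scaleR borel_measurable_indicator) auto
  also have "\<dots> = (LINT u:cball 0 1|lborel. \<bar>inner x u\<bar>)"
    unfolding fx[symmetric] ii set_lebesgue_integral_def by (simp add: indicator_def ii)
  finally have "(LINT u:cball 0 1|lborel. \<bar>inner x u\<bar>) = (LINT u:cball 0 1|lborel. norm x * \<bar>inner b u\<bar>)"
    by (simp add: y_def abs_mult)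
  then show ?thesis by (simp add: b_def)
qed

text \<open>Up to the constant \<gamma>, the norm of \<open>T x\<close> is the integral over the
  ball of \<open>\<bar>inner (T x) u\<bar>\<close>, which equals
  \<open>\<bar>inner x (adjoint T u)\<bar>\<close>. A Riemann sum of this integral is the support
  function of a single zonotope.\<close>

lemma zono_dense_norm_linear:
  fixes T :: "'a::euclidean_space \<Rightarrow> 'a"
  assumes T: "linear T"
  shows "zono_dense (\<lambda>x. norm (T x))"
proof -
  define b :: 'a where "b = (SOME b. b \<in> Basis)"
  have b: "b \<in> Basis" unfolding b_def by (rule SOME_Basis)
  define S where "S = cball (0::'a) 1"
  have S: "compact S" by (simp add: S_def)
  define \<gamma> where "\<gamma> = (LINT u:S|lborel. \<bar>inner b u\<bar>)"
  have inte: "set_integrable lborel S (\<lambda>u. \<bar>inner x u\<bar>)" for x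
    unfolding set_integrable_def by (intro borel_integrable_compact S continuous_intros)
  have \<gamma>: "\<gamma> > 0"
  proof -
    have "\<gamma> \<ge> 0" unfolding \<gamma>_def set_lebesgue_integral_def by (intro integral_nonneg_AE) auto
    moreover have "\<gamma> \<noteq> 0"
    proof
      assume "\<gamma> = 0"
      then have "AE u in lborel. indicator S u *\<^sub>R \<bar>inner b u\<bar> = 0"
        using integral_nonneg_eq_0_iff_AE[of lborel "\<lambda>u. indicator S u *\<^sub>R \<bar>inner b u\<bar>"] inte[of b]
        unfolding \<gamma>_def set_lebesgue_integral_def set_integrable_def by auto
      then have "AE u in lborel. u \<in> - (ball (b /\<^sub>R 2) (1/2))"
      proof eventually_elim
        case (elim u)
        show ?case
        proof
          assume "u \<in> ball (b /\<^sub>R 2) (1/2)"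
          then have d: "norm (b /\<^sub>R 2 - u) < 1/2" by (simp add: dist_norm)
          have nb: "norm (b /\<^sub>R 2) = 1/2" using b by simp
          have "norm u \<le> norm (b /\<^sub>R 2) + norm (b /\<^sub>R 2 - u)" by norm
          then have "u \<in> S" using d nb by (simp add: S_def)
          then have "inner b u = 0" using elim by simp
          moreover have "inner b (b /\<^sub>R 2 - u) \<le> norm b * norm (b /\<^sub>R 2 - u)" by (rule norm_cauchy_schwarz)
          ultimately have "inner b (b /\<^sub>R 2) < 1/2" using d b by (simp add: inner_diff_right)
          then show False using b by simp
        qed
      qed
      then have "emeasure lborel (ball (b /\<^sub>R 2) (1/2)) = 0"
        by (subst (asm) AE_iff_measurable[of "ball (b /\<^sub>R 2) (1/2)"]) auto
      then show False using unit_ball_vol_pos[of "real DIM('a)"]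
        by (simp add: emeasure_ball)
    qed
    ultimately show ?thesis by simp
  qed
  obtain BT where BT: "BT > 0" "\<And>x. norm (T x) \<le> BT * norm x" using linear_bounded_pos[OF T] by blast
  have adj: "inner x (adjoint T u) = inner (T x) u" for x u using adjoint_works[OF T] by simp
  show ?thesis
  proof (rule zono_denseI)
    fix e :: real assume e: "e > 0"
    define mS where "mS = measure lborel S"
    have mS: "mS \<ge> 0" by (simp add: mS_def)
    \<comment> \<open>The Riemann sum errs by at most \<open>BT * d * mS\<close>, which this choice
      keeps below \<open>e * \<gamma>\<close>; adding 1 keeps the denominator positive.\<close>
    define d where "d = e * \<gamma> / (BT * (mS + 1))"
    have d: "d > 0" using e \<gamma> BT mS by (simp add: d_def)
    obtain I :: "nat set" and A c where I: "finite I" "S = (\<Union>i\<in>I. A i)" "disjoint_family_on A I"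
      "\<And>i. i \<in> I \<Longrightarrow> A i \<in> sets borel" "\<And>i. i \<in> I \<Longrightarrow> A i \<subseteq> ball (c i) d"
      using finite_borel_partition[OF S d] by blast
    have Afin: "emeasure lborel (A i) < \<infinity>" if "i \<in> I" for i
    proof -
      have "emeasure lborel (A i) \<le> emeasure lborel S" using I(2) that S by (intro emeasure_mono) (auto simp: borel_compact)
      also have "\<dots> < \<infinity>" using S emeasure_compact_finite by blast
      finally show ?thesis .
    qed
    \<comment> \<open>The factor 2 cancels the 1/2 in \<open>zsupp\<close>, and \<gamma> normalises
      the integral.\<close>
    define us where "us = map (\<lambda>i. (2 * measure lborel (A i) / \<gamma>) *\<^sub>R adjoint T (c i)) (sorted_list_of_set I)"
    have zs: "zsupp us x = (\<Sum>i\<in>I. measure lborel (A i) * \<bar>inner (T x) (c i)\<bar>) / \<gamma>" for x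
    proof -
      have "zsupp us x = (\<Sum>i\<leftarrow>sorted_list_of_set I. measure lborel (A i) * \<bar>inner (T x) (c i)\<bar> / \<gamma>)"
        using \<gamma> by (simp add: zsupp_def us_def comp_def adj abs_mult abs_divide)
      also have "\<dots> = (\<Sum>i\<in>I. measure lborel (A i) * \<bar>inner (T x) (c i)\<bar> / \<gamma>)"
        using I(1) by (simp add: sum_list_distinct_conv_sum_set)
      finally show ?thesis by (simp add: sum_divide_distrib)
    qed
    have "\<bar>norm (T x) - zsupp us x\<bar> \<le> e" if x: "norm x = 1" for x
    proof -
      let ?y = "T x"
      have ny: "norm ?y \<le> BT" using BT(2)[of x] x by simp
      have iA: "set_integrable lborel (A i) (\<lambda>u. \<bar>inner ?y u\<bar>)" if "i \<in> I" for i
        by (rule set_integrable_subset[OF inte]) (use I that in auto)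
      have "(LINT u:S|lborel. \<bar>inner ?y u\<bar>) = (\<Sum>i\<in>I. LINT u:A i|lborel. \<bar>inner ?y u\<bar>)"
        unfolding I(2) using I iA by (intro set_integral_finite_Union) auto
      then have "norm ?y * \<gamma> = (\<Sum>i\<in>I. LINT u:A i|lborel. \<bar>inner ?y u\<bar>)"
        using ball_abs_inner_integral[of ?y] by (simp add: S_def \<gamma>_def b_def)
      then have "\<bar>norm ?y * \<gamma> - (\<Sum>i\<in>I. measure lborel (A i) * \<bar>inner ?y (c i)\<bar>)\<bar> =
          \<bar>\<Sum>i\<in>I. (LINT u:A i|lborel. \<bar>inner ?y u\<bar>) - measure lborel (A i) * \<bar>inner ?y (c i)\<bar>\<bar>"
        by (simp add: sum_subtractf)
      also have "\<dots> \<le> (\<Sum>i\<in>I. \<bar>(LINT u:A i|lborel. \<bar>inner ?y u\<bar>) - measure lborel (A i) * \<bar>inner ?y (c i)\<bar>\<bar>)"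
        by (rule sum_abs)
      also have "\<dots> \<le> (\<Sum>i\<in>I. BT * d * measure lborel (A i))"
      proof (rule sum_mono)
        fix i assume i: "i \<in> I"
        have ci: "set_integrable lborel (A i) (\<lambda>u. r)" for r :: real
          using I(4)[OF i] Afin[OF i] by (simp add: set_integrable_def)
        have cv: "(LINT u:A i|lborel. r) = measure lborel (A i) * r" for r :: real
          using I(4)[OF i] Afin[OF i] by (simp add: set_lebesgue_integral_def)
        have bnd: "\<bar>\<bar>inner ?y u\<bar> - \<bar>inner ?y (c i)\<bar>\<bar> \<le> BT * d" if u: "u \<in> A i" for u
        proof -
          have "\<bar>\<bar>inner ?y u\<bar> - \<bar>inner ?y (c i)\<bar>\<bar> \<le> \<bar>inner ?y (u - c i)\<bar>" by (simp add: inner_diff_right)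
          also have "\<dots> \<le> norm ?y * norm (u - c i)" by (rule Cauchy_Schwarz_ineq2)
          also have "\<dots> \<le> BT * d"
            using ny I(5)[OF i] u BT by (intro mult_mono) (auto simp: dist_norm norm_minus_commute subset_iff less_imp_le)
          finally show ?thesis .
        qed
        have "(LINT u:A i|lborel. \<bar>inner ?y u\<bar>) \<le> (LINT u:A i|lborel. \<bar>inner ?y (c i)\<bar> + BT * d)"
          using bnd by (intro set_integral_mono iA[OF i] ci) (auto simp: abs_le_iff algebra_simps)
        moreover have "(LINT u:A i|lborel. \<bar>inner ?y (c i)\<bar> - BT * d) \<le> (LINT u:A i|lborel. \<bar>inner ?y u\<bar>)"
          using bnd by (intro set_integral_mono iA[OF i] ci) (auto simp: abs_le_iff algebra_simps)
        ultimately show "\<bar>(LINT u:A i|lborel. \<bar>inner ?y u\<bar>) - measure lborel (A i) * \<bar>inner ?y (c i)\<bar>\<bar> \<le> BT * d * measure lborel (A i)"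
          unfolding cv by (simp add: abs_le_iff algebra_simps)
      qed
      also have "\<dots> = BT * d * mS"
      proof -
        have "mS = (\<Sum>i\<in>I. measure lborel (A i))"
          unfolding mS_def I(2) using I Afin by (intro measure_finite_Union) (auto simp: less_top[symmetric])
        then show ?thesis by (simp add: sum_distrib_left)
      qed
      also have "\<dots> \<le> e * \<gamma>"
      proof -
        have "BT * d * mS \<le> BT * d * (mS + 1)" using BT d by (intro mult_left_mono) auto
        also have "\<dots> = e * \<gamma>" using BT mS by (simp add: d_def)
        finally show ?thesis .
      qed
      finally have "\<bar>norm ?y * \<gamma> - \<gamma> * zsupp us x\<bar> \<le> e * \<gamma>" using \<gamma> by (simp add: zs)
      moreover have "norm ?y * \<gamma> - \<gamma> * zsupp us x = \<gamma> * (norm ?y - zsupp us x)" by (simp add: algebra_simps)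
      ultimately have "\<gamma> * \<bar>norm ?y - zsupp us x\<bar> \<le> \<gamma> * e"
        using \<gamma> by (simp add: abs_mult mult.commute)
      then show ?thesis using \<gamma> by simp
    qed
    then show "\<exists>zp zn. \<forall>x. norm x = 1 \<longrightarrow> \<bar>norm (T x) - (zsupp zp x - zsupp zn x)\<bar> \<le> e"
      by (intro exI[of _ us] exI[of _ "[]"]) auto
  qed
qed

section \<open>Powers of quadratic forms and even polynomials\<close>

definition quad_form :: "'a::euclidean_space list \<Rightarrow> 'a \<Rightarrow> real" where
  "quad_form ys x = inner x x + (\<Sum>y\<leftarrow>ys. (inner x y)\<^sup>2)"

lemma quad_form_ge: "quad_form ys x \<ge> inner x x"
  unfolding quad_form_def by (auto intro!: sum_list_nonneg)

text \<open>The map is built by rank-one updates. As \<open>T\<close> is injective,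
  \<open>inner x y\<close> can be written as \<open>inner (T x) z\<close>; adding a suitable
  multiple of this times \<open>z\<close> to \<open>T x\<close> increases the square of the norm by
  exactly the square of \<open>inner x y\<close>.\<close>

lemma quad_form_eq_norm: "\<exists>T :: 'a \<Rightarrow> 'a::euclidean_space. linear T \<and> (\<forall>x. (norm (T x))\<^sup>2 = quad_form ys x)"
proof (induction ys)
  case Nil
  then show ?case by (intro exI[of _ "\<lambda>x. x"]) (simp add: quad_form_def power2_norm_eq_inner linear_iff)
next
  case (Cons y ys)
  then obtain T :: "'a \<Rightarrow> 'a" where T: "linear T" "\<And>x. (norm (T x))\<^sup>2 = quad_form ys x" by blast
  have "inj T"
  proof (rule linear_injective_0[OF T(1), THEN iffD2], intro allI impI)
    fix x assume "T x = 0"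
    then have "quad_form ys x = 0" using T(2)[of x] by simp
    then have "inner x x \<le> 0" using quad_form_ge[of x ys] by simp
    then show "x = 0" by (metis inner_eq_zero_iff inner_ge_zero order_antisym)
  qed
  then have "surj (adjoint T)" using T(1) by simp
  then obtain z where z: "adjoint T z = y" by (metis surjD)
  have zx: "inner (T x) z = inner x y" for x using adjoint_works[OF T(1)] z by metis
  \<comment> \<open>\<open>1 / (1 + r)\<close> is the positive root of the equation
    \<open>2 * a + a\<^sup>2 * inner z z = 1\<close>, written so that it also covers
    \<open>z = 0\<close>.\<close>
  define r where "r = sqrt (1 + (norm z)\<^sup>2)"
  have r: "r \<ge> 1" "r\<^sup>2 = 1 + (norm z)\<^sup>2" by (auto simp: r_def)
  define a where "a = 1 / (1 + r)"
  have a: "2 * a + a\<^sup>2 * inner z z = 1"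
  proof -
    have "inner z z = (r - 1) * (r + 1)" using r(2) by (simp add: dot_square_norm algebra_simps power2_eq_square)
    moreover have ar: "a * (r + 1) = 1" using r(1) by (simp add: a_def)
    ultimately have "2 * a + a\<^sup>2 * inner z z = 2 * a + a * (r - 1) * (a * (r + 1))"
      by (simp add: power2_eq_square)
    also have "\<dots> = 2 * a + a * (r - 1)" unfolding ar by simp
    also have "\<dots> = a * (r + 1)" by (simp add: algebra_simps)
    finally show ?thesis using ar by simp
  qed
  have "(norm (T x + (a * inner (T x) z) *\<^sub>R z))\<^sup>2 = quad_form (y # ys) x" for x
  proof -
    have "(norm (T x + (a * inner (T x) z) *\<^sub>R z))\<^sup>2 = (norm (T x))\<^sup>2 + (2 * a + a\<^sup>2 * inner z z) * (inner (T x) z)\<^sup>2"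
      unfolding power2_norm_eq_inner
      by (simp add: inner_add_left inner_add_right inner_commute algebra_simps power2_eq_square)
    then show ?thesis by (simp add: a T(2) zx quad_form_def)
  qed
  moreover have "linear (\<lambda>x. T x + (a * inner (T x) z) *\<^sub>R z)"
    by (rule linearI) (simp_all add: linear_add[OF T(1)] linear_cmul[OF T(1)] inner_add_left algebra_simps)
  ultimately show ?case by blast
qed

text \<open>Two applications of the mean value theorem. With \<open>q \<ge> 1\<close> and
  \<open>a \<le> 2\<close> the second derivative is at most its coefficient, because
  \<open>w powr (a - 2) \<le> 1\<close>.\<close>

lemma powr_second_order:
  fixes q h a :: real
  assumes q: "q \<ge> 1" and h: "h \<ge> 0" and a: "a \<le> 2"
  shows "\<bar>(q + h) powr a - q powr a - h * (a * q powr (a - 1))\<bar> \<le> \<bar>a * (a - 1)\<bar> * h\<^sup>2"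
proof (cases "h = 0")
  case False
  then have h: "h > 0" using h by simp
  have "\<exists>z>q. z < q + h \<and> (q + h) powr a - q powr a = (q + h - q) * (a * z powr (a - 1))"
    using q h by (intro MVT2) (auto intro!: derivative_eq_intros)
  then obtain z where z: "q < z" "z < q + h" "(q + h) powr a - q powr a = h * (a * z powr (a - 1))" by auto
  have "\<exists>w>q. w < z \<and> a * z powr (a - 1) - a * q powr (a - 1) = (z - q) * (a * ((a - 1) * w powr (a - 1 - 1)))"
    using q z by (intro MVT2) (auto intro!: derivative_eq_intros)
  then obtain w where w: "q < w" "w < z" "a * z powr (a - 1) - a * q powr (a - 1) = (z - q) * (a * ((a - 1) * w powr (a - 1 - 1)))"
    by auto
  have "w powr (a - 1 - 1) \<le> 1 powr (a - 1 - 1)" using w q a by (intro powr_mono2') auto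
  then have w1: "w powr (a - 1 - 1) \<le> 1" by simp
  have "(q + h) powr a - q powr a - h * (a * q powr (a - 1)) = h * (a * z powr (a - 1) - a * q powr (a - 1))"
    using z(3) by (simp add: algebra_simps)
  also have "\<dots> = h * (z - q) * (a * (a - 1)) * w powr (a - 1 - 1)" using w(3) by simp
  finally have "\<bar>(q + h) powr a - q powr a - h * (a * q powr (a - 1))\<bar> = h * (z - q) * \<bar>a * (a - 1)\<bar> * w powr (a - 1 - 1)"
    using h z by (simp add: abs_mult)
  also have "\<dots> \<le> h * h * \<bar>a * (a - 1)\<bar> * 1"
    using h z w1 by (intro mult_mono) auto
  finally show ?thesis by (simp add: power2_eq_square mult.commute)
qed simp

lemma prod_list_sq_bound:
  assumes "norm x = 1"
  shows "0 \<le> (\<Prod>z\<leftarrow>zs. (inner x z)\<^sup>2) \<and> (\<Prod>z\<leftarrow>zs. (inner x z)\<^sup>2) \<le> (\<Prod>z\<leftarrow>zs. (norm z)\<^sup>2)"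
proof (induction zs)
  case (Cons z zs)
  have "(inner x z)\<^sup>2 \<le> (norm z)\<^sup>2" using Cauchy_Schwarz_ineq2[of x z] assms by (simp add: abs_le_square_iff[symmetric])
  then show ?case using Cons by (auto intro: mult_mono)
qed simp

text \<open>The square root of a quadratic form is a norm \<open>norm (T x)\<close>. Increasing the
  weight of \<open>(inner x z)\<^sup>2\<close> in the form and differentiating lowers the exponent
  by one and brings out the factor \<open>(inner x z)\<^sup>2\<close>; difference quotients stay in
  the class. The exponents are never zero, being 1/2 minus an integer, so the constant from
  differentiation can be divided out.\<close>

lemma zono_dense_quad_form_powr:
  fixes ys zs :: "'a::euclidean_space list"
  shows "zono_dense (\<lambda>x. quad_form ys x powr (1/2 - real (length zs)) * (\<Prod>z\<leftarrow>zs. (inner x z)\<^sup>2))"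
proof (induction zs arbitrary: ys)
  case Nil
  obtain T :: "'a \<Rightarrow> 'a" where T: "linear T" "\<And>x. (norm (T x))\<^sup>2 = quad_form ys x" using quad_form_eq_norm by blast
  have "norm (T x) = quad_form ys x powr (1/2)" for x
    by (metis T(2) norm_ge_zero powr_half_sqrt real_sqrt_pow2_iff real_sqrt_abs abs_norm_cancel zero_le_power2)
  then show ?case using zono_dense_norm_linear[OF T(1)] by simp
next
  case (Cons z zs)
  define a where "a = 1/2 - real (length zs)"
  have a0: "a \<noteq> 0" "a \<le> 2"
  proof -
    have "2 * real (length zs) \<noteq> 1" by (metis of_nat_1 of_nat_eq_iff of_nat_mult of_nat_numeral odd_one dvd_triv_left)
    then show "a \<noteq> 0" by (auto simp: a_def)
  qed (simp add: a_def)
  define pr where "pr x = (\<Prod>z\<leftarrow>zs. (inner x z)\<^sup>2)" for x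
  define B where "B = (\<Prod>z\<leftarrow>zs. (norm z)\<^sup>2)"
  have prB: "0 \<le> pr x" "pr x \<le> B" if "norm x = 1" for x using prod_list_sq_bound[OF that, of zs] by (auto simp: pr_def B_def)
  have qt: "quad_form ((sqrt t *\<^sub>R z) # ys) x = quad_form ys x + t * (inner x z)\<^sup>2" if "t \<ge> 0" for t x
    using that by (simp add: quad_form_def power_mult_distrib)
  have Ft: "zono_dense (\<lambda>x. (quad_form ys x + t * (inner x z)\<^sup>2) powr a * pr x)" if "t \<ge> 0" for t
    using Cons[of "(sqrt t *\<^sub>R z) # ys"] qt[OF that] by (simp add: a_def pr_def)
  have "zono_dense (\<lambda>x. a * (quad_form ys x powr (a - 1) * ((inner x z)\<^sup>2 * pr x)))"
  proof (rule zono_dense_lim)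
    fix e :: real assume e: "e > 0"
    \<comment> \<open>By \<open>powr_second_order\<close>, the difference quotient with step
      \<open>t\<close> errs by at most \<open>t * M\<close> on the sphere.\<close>
    define M where "M = \<bar>a * (a - 1)\<bar> * (norm z)^4 * \<bar>B\<bar> + 1"
    have M: "M > 0" by (simp add: M_def add_nonneg_pos)
    define t where "t = e / M"
    have t: "t > 0" using e M by (simp add: t_def)
    let ?g = "\<lambda>x. (1/t) * ((quad_form ys x + t * (inner x z)\<^sup>2) powr a * pr x - quad_form ys x powr a * pr x)"
    have "zono_dense ?g"
      using Ft[of t] Ft[of 0] t by (intro zono_dense_cmult zono_dense_diff) auto
    moreover have "\<bar>a * (quad_form ys x powr (a - 1) * ((inner x z)\<^sup>2 * pr x)) - ?g x\<bar> \<le> e" if x: "norm x = 1" for x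
    proof -
      define q p where "q = quad_form ys x" and "p = (inner x z)\<^sup>2"
      have q: "q \<ge> 1" using quad_form_ge[of x ys] x by (simp add: q_def dot_square_norm)
      have pz: "0 \<le> p" "p \<le> (norm z)\<^sup>2" using prod_list_sq_bound[OF x, of "[z]"] by (auto simp: p_def)
      have "\<bar>(q + t * p) powr a - q powr a - (t * p) * (a * q powr (a - 1))\<bar> \<le> \<bar>a * (a - 1)\<bar> * (t * p)\<^sup>2"
        using q pz t a0 by (intro powr_second_order) auto
      then have "\<bar>(q + t * p) powr a - q powr a - (t * p) * (a * q powr (a - 1))\<bar> * pr x \<le> (\<bar>a * (a - 1)\<bar> * (t * p)\<^sup>2) * \<bar>B\<bar>"
        using prB[OF x] by (intro mult_mono) auto
      moreover have "(\<bar>a * (a - 1)\<bar> * (t * p)\<^sup>2) * \<bar>B\<bar> \<le> t\<^sup>2 * M"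
      proof -
        have "p\<^sup>2 \<le> ((norm z)\<^sup>2)\<^sup>2" using pz by (intro power_mono)
        also have "\<dots> = (norm z)^4" by (simp flip: power_mult)
        finally have "\<bar>a * (a - 1)\<bar> * p\<^sup>2 * \<bar>B\<bar> \<le> \<bar>a * (a - 1)\<bar> * (norm z)^4 * \<bar>B\<bar>"
          by (intro mult_right_mono mult_left_mono) auto
        then have "\<bar>a * (a - 1)\<bar> * p\<^sup>2 * \<bar>B\<bar> \<le> M" by (simp add: M_def)
        then have "t\<^sup>2 * (\<bar>a * (a - 1)\<bar> * p\<^sup>2 * \<bar>B\<bar>) \<le> t\<^sup>2 * M" by (intro mult_left_mono) auto
        then show ?thesis by (simp add: power_mult_distrib mult_ac)
      qed
      ultimately have le: "\<bar>(q + t * p) powr a - q powr a - (t * p) * (a * q powr (a - 1))\<bar> * pr x \<le> t * (t * M)"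
        by (simp add: power2_eq_square)
      have "a * (q powr (a - 1) * (p * pr x)) - (1/t) * ((q + t * p) powr a * pr x - q powr a * pr x) =
          - (1/t) * (((q + t * p) powr a - q powr a - (t * p) * (a * q powr (a - 1))) * pr x)"
        using t by (simp add: field_simps)
      then have "\<bar>a * (q powr (a - 1) * (p * pr x)) - (1/t) * ((q + t * p) powr a * pr x - q powr a * pr x)\<bar> =
          (1/t) * (\<bar>(q + t * p) powr a - q powr a - (t * p) * (a * q powr (a - 1))\<bar> * pr x)"
        using t prB[OF x] by (simp add: abs_mult)
      also have "\<dots> \<le> (1/t) * (t * (t * M))" using le t by (intro mult_left_mono) auto
      also have "\<dots> = e" using t M by (simp add: t_def)
      finally show ?thesis by (simp add: q_def p_def)
    qed
    ultimately show "\<exists>g. zono_dense g \<and> (\<forall>x. norm x = 1 \<longrightarrow>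
        \<bar>a * (quad_form ys x powr (a - 1) * ((inner x z)\<^sup>2 * pr x)) - g x\<bar> \<le> e)" by blast
  qed
  then have "zono_dense (\<lambda>x. (1/a) * (a * (quad_form ys x powr (a - 1) * ((inner x z)\<^sup>2 * pr x))))"
    by (rule zono_dense_cmult)
  moreover have "a - 1 = 1/2 - real (length (z # zs))" by (simp add: a_def)
  ultimately show ?case using a0(1) by (simp add: pr_def del: length_Cons)
qed

text \<open>On the sphere the form without extra terms equals 1, so its power disappears and only
  the squares remain. Polarisation, a difference of squares of \<open>inner x (y + z)\<close> and
  \<open>inner x (y - z)\<close>, then turns squares into products.\<close>

lemma zono_dense_pairs:
  "zono_dense (\<lambda>x. (\<Prod>z\<leftarrow>zs. (inner x z)\<^sup>2) * (\<Prod>(y, z)\<leftarrow>ps. inner x y * inner x z))"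
proof (induction ps arbitrary: zs)
  case Nil
  have "quad_form [] x powr (1/2 - real (length zs)) * (\<Prod>z\<leftarrow>zs. (inner x z)\<^sup>2) = (\<Prod>z\<leftarrow>zs. (inner x z)\<^sup>2)"
    if "norm x = 1" for x using that by (simp add: quad_form_def dot_square_norm)
  then show ?case
    using zono_dense_cong[OF _ zono_dense_quad_form_powr[of "[]" zs]] by simp
next
  case (Cons p ps)
  obtain y z where p: "p = (y, z)" by fastforce
  have "zono_dense (\<lambda>x. (1/4) * ((\<Prod>v\<leftarrow>(y + z) # zs. (inner x v)\<^sup>2) * (\<Prod>(y, z)\<leftarrow>ps. inner x y * inner x z)) -
      (1/4) * ((\<Prod>v\<leftarrow>(y - z) # zs. (inner x v)\<^sup>2) * (\<Prod>(y, z)\<leftarrow>ps. inner x y * inner x z)))"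
    by (intro zono_dense_diff zono_dense_cmult Cons)
  moreover have "(1/4) * ((\<Prod>v\<leftarrow>(y + z) # zs. (inner x v)\<^sup>2) * P) - (1/4) * ((\<Prod>v\<leftarrow>(y - z) # zs. (inner x v)\<^sup>2) * P) =
      (\<Prod>z\<leftarrow>zs. (inner x z)\<^sup>2) * (inner x y * inner x z * P)" for x P
    by (simp add: inner_add_right inner_diff_right power2_eq_square algebra_simps)
  ultimately show ?case by (simp add: p)
qed

lemma zono_dense_even_monomial:
  assumes "even (length ws)"
  shows "zono_dense (\<lambda>x. \<Prod>w\<leftarrow>ws. inner x w)"
proof -
  have "\<exists>ps. \<forall>x. (\<Prod>w\<leftarrow>ws. inner x w) = (\<Prod>(y, z)\<leftarrow>ps. inner x y * inner x z)"
    using assms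
  proof (induction ws rule: induct_list012)
    case 1
    then show ?case by (intro exI[of _ "[]"]) simp
  next
    case (3 y z ws)
    then obtain ps where "\<forall>x. (\<Prod>w\<leftarrow>ws. inner x w) = (\<Prod>(y, z)\<leftarrow>ps. inner x y * inner x z)" by auto
    then show ?case by (intro exI[of _ "(y, z) # ps"]) simp
  qed simp
  then show ?thesis using zono_dense_pairs[of "[]"] by auto
qed

lemma real_polynomial_function_monomials:
  fixes p :: "'a::euclidean_space \<Rightarrow> real"
  assumes "real_polynomial_function p"
  shows "\<exists>ms. \<forall>x. p x = (\<Sum>(c, ws)\<leftarrow>ms. c * (\<Prod>w\<leftarrow>ws. inner x w))"
  using assms
proof (induction p rule: real_polynomial_function.induct)
  case (linear f)
  then have lin: "linear f" by (simp add: linear_conv_bounded_linear)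
  define w where "w = (\<Sum>b\<in>Basis. f b *\<^sub>R b)"
  have "f x = inner x w" for x
  proof -
    have "f x = f (\<Sum>b\<in>Basis. inner x b *\<^sub>R b)" by (simp add: euclidean_representation)
    also have "\<dots> = (\<Sum>b\<in>Basis. inner x b * f b)" by (simp add: linear_sum[OF lin] linear_cmul[OF lin])
    finally show ?thesis by (simp add: w_def inner_sum_right mult.commute)
  qed
  then show ?case by (intro exI[of _ "[(1, [w])]"]) simp
next
  case (const c)
  then show ?case by (intro exI[of _ "[(c, [])]"]) simp
next
  case (add f g)
  then obtain ms ns where "\<forall>x. f x = (\<Sum>(c, ws)\<leftarrow>ms. c * (\<Prod>w\<leftarrow>ws. inner x w))"
    "\<forall>x. g x = (\<Sum>(c, ws)\<leftarrow>ns. c * (\<Prod>w\<leftarrow>ws. inner x w))" by blast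
  then show ?case by (intro exI[of _ "ms @ ns"]) simp
next
  case (mult f g)
  then obtain ms ns where f: "\<forall>x. f x = (\<Sum>(c, ws)\<leftarrow>ms. c * (\<Prod>w\<leftarrow>ws. inner x w))"
    and g: "\<forall>x. g x = (\<Sum>(c, ws)\<leftarrow>ns. c * (\<Prod>w\<leftarrow>ws. inner x w))" by blast
  have one: "(\<Sum>(d, vs)\<leftarrow>map (\<lambda>(d, vs). (c * d, ws @ vs)) ns. d * (\<Prod>w\<leftarrow>vs. inner x w)) =
      c * (\<Prod>w\<leftarrow>ws. inner x w) * (\<Sum>(d, vs)\<leftarrow>ns. d * (\<Prod>w\<leftarrow>vs. inner x w))" for c ws x
    by (induction ns) (auto simp: algebra_simps)
  have "(\<Sum>(d, vs)\<leftarrow>concat (map (\<lambda>(c, ws). map (\<lambda>(d, vs). (c * d, ws @ vs)) ns) ms). d * (\<Prod>w\<leftarrow>vs. inner x w)) =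
      (\<Sum>(c, ws)\<leftarrow>ms. c * (\<Prod>w\<leftarrow>ws. inner x w)) * (\<Sum>(d, vs)\<leftarrow>ns. d * (\<Prod>w\<leftarrow>vs. inner x w))" for x
  proof (induction ms)
    case (Cons m ms)
    obtain c ws where m: "m = (c, ws)" by fastforce
    show ?case using Cons one[where c = c and ws = ws and x = x] by (simp add: m algebra_simps)
  qed simp
  then show ?case using f g
    by (intro exI[of _ "concat (map (\<lambda>(c, ws). map (\<lambda>(d, vs). (c * d, ws @ vs)) ns) ms)"]) simp
qed

text \<open>Monomials of odd degree cancel between \<open>x\<close> and \<open>- x\<close>; those of
  even degree double.\<close>

lemma zono_dense_even_part:
  fixes p :: "'a::euclidean_space \<Rightarrow> real"
  assumes "real_polynomial_function p"
  shows "zono_dense (\<lambda>x. p x + p (- x))"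
proof -
  obtain ms where ms: "\<And>x. p x = (\<Sum>(c, ws)\<leftarrow>ms. c * (\<Prod>w\<leftarrow>ws. inner x w))"
    using real_polynomial_function_monomials[OF assms] by blast
  have neg: "(\<Prod>w\<leftarrow>ws. inner (- x) w) = (-1) ^ length ws * (\<Prod>w\<leftarrow>ws. inner x w)" for x :: 'a and ws
    by (induction ws) auto
  have z: "zono_dense (\<lambda>x. 0)" by (rule zono_denseI, rule exI[of _ "[]"], rule exI[of _ "[]"]) simp
  have "zono_dense (\<lambda>x. (\<Sum>(c, ws)\<leftarrow>ms. c * (\<Prod>w\<leftarrow>ws. inner x w)) + (\<Sum>(c, ws)\<leftarrow>ms. c * (\<Prod>w\<leftarrow>ws. inner (- x) w)))"
  proof (induction ms)
    case Nil
    then show ?case using z by simp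
  next
    case (Cons m ms)
    obtain c ws where m: "m = (c, ws)" by fastforce
    have "zono_dense (\<lambda>x. c * (\<Prod>w\<leftarrow>ws. inner x w) + c * (\<Prod>w\<leftarrow>ws. inner (- x) w))"
    proof (cases "even (length ws)")
      case True
      have "zono_dense (\<lambda>x. (2 * c) * (\<Prod>w\<leftarrow>ws. inner x w))" by (intro zono_dense_cmult zono_dense_even_monomial True)
      then show ?thesis using True by (simp add: neg mult.assoc del: inner_minus_left)
    next
      case False
      then show ?thesis using z by (simp add: neg del: inner_minus_left)
    qed
    from zono_dense_add[OF this Cons] show ?case by (simp add: m algebra_simps del: inner_minus_left)
  qed
  then show ?thesis by (simp add: ms)
qed

section \<open>From support functions to inclusions of bodies\<close>

lemma zsupp_attained:
  "(\<forall>y\<in>zono us. inner x y \<le> zsupp us x) \<and> (\<exists>y\<in>zono us. inner x y = zsupp us x)"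
proof (induction us)
  case (Cons u us)
  have le: "inner x y \<le> \<bar>inner x u\<bar> / 2" if y: "y \<in> seg u" for y
  proof -
    obtain t where t: "t \<in> {-(1/2)..1/2}" "y = t *\<^sub>R u" using y unfolding seg_def by blast
    have "inner x y \<le> \<bar>t\<bar> * \<bar>inner x u\<bar>" unfolding t(2) by (simp flip: abs_mult)
    also have "\<dots> \<le> 1/2 * \<bar>inner x u\<bar>" using t(1) by (intro mult_right_mono) (auto simp: abs_le_iff)
    finally show ?thesis by simp
  qed
  have at: "\<exists>y\<in>seg u. inner x y = \<bar>inner x u\<bar> / 2"
  proof (cases "inner x u \<ge> 0")
    case True
    then show ?thesis unfolding seg_def by (intro bexI[of _ "(1/2) *\<^sub>R u"]) auto
  next
    case False
    then show ?thesis unfolding seg_def by (intro bexI[of _ "(-(1/2)) *\<^sub>R u"] image_eqI[of _ _ "-(1/2)"]) auto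
  qed
  obtain y z where "y \<in> seg u" "inner x y = \<bar>inner x u\<bar> / 2" "z \<in> zono us" "inner x z = zsupp us x"
    using at Cons by blast
  then have "\<exists>y\<in>zono (u # us). inner x y = zsupp (u # us) x"
    by (intro bexI[of _ "y + z"]) (auto simp: inner_add_right)
  moreover have "inner x y \<le> zsupp (u # us) x" if y: "y \<in> zono (u # us)" for y
  proof -
    obtain a b where ab: "a \<in> seg u" "b \<in> zono us" "y = a + b" using y by (auto simp: set_plus_iff)
    then show ?thesis using le[OF ab(1)] Cons by (force simp: inner_add_right)
  qed
  ultimately show ?case by blast
qed simp

lemma zsupp_cube_ge:
  assumes "norm x = 1"
  shows "zsupp (cube_vecs :: 'a::euclidean_space list) x \<ge> 1"
proof -
  have "x \<in> zono (cube_vecs :: 'a list)" using cball_subset_cube assms by force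
  then have "inner x x \<le> zsupp cube_vecs x" using zsupp_attained by blast
  then show ?thesis using assms by (simp add: dot_square_norm)
qed

lemma cconvex_subset_by_support:
  assumes B: "cconvex B" "B \<noteq> {}"
    and le: "\<And>x a. norm x = 1 \<Longrightarrow> a \<in> A \<Longrightarrow> \<exists>b\<in>B. inner x a \<le> inner x b"
  shows "A \<subseteq> B"
proof
  fix a assume a: "a \<in> A"
  show "a \<in> B"
  proof (rule ccontr)
    assume "a \<notin> B"
    then obtain v c where v: "inner v a < c" "\<forall>x\<in>B. inner v x > c"
      using separating_hyperplane_closed_point[of B a] B by (auto simp: cconvex_def compact_imp_closed)
    have "v \<noteq> 0" using v B(2) by auto
    define x where "x = - (v /\<^sub>R norm v)"
    have "norm x = 1" using \<open>v \<noteq> 0\<close> by (simp add: x_def)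
    then obtain b where b: "b \<in> B" "inner x a \<le> inner x b" using le[OF _ a] by blast
    have "inner v b \<le> inner v a" using b(2) \<open>v \<noteq> 0\<close> by (simp add: x_def)
    then show False using v b(1) by force
  qed
qed

text \<open>The support function is continuous and even, so a Weierstrass polynomial may be replaced
  by its even part. The uniform error on the sphere is absorbed by the scaled cube, whose support
  function is at least \<epsilon> there; inequalities of support functions then become
  inclusions.\<close>

theorem symmetric_zono_approx:
  fixes L :: "'a::euclidean_space set"
  assumes L: "cconvex L" "L \<noteq> {}" "\<And>x. x \<in> L \<Longrightarrow> - x \<in> L" and \<epsilon>: "0 < \<epsilon>" "\<epsilon> \<le> 1"
  shows "\<exists>zp zn. zono_approx L \<epsilon> zp zn"
proof -
  have cL: "compact L" using L(1) by (simp add: cconvex_def)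
  define h where "h x = (SUP y\<in>L. inner x y)" for x
  have att: "\<exists>y\<in>L. h x = inner x y \<and> (\<forall>z\<in>L. inner x z \<le> inner x y)" for x
  proof -
    have "continuous_on L (inner x)" by (intro continuous_intros)
    then obtain y where y: "y \<in> L" "\<forall>z\<in>L. inner x z \<le> inner x y"
      using continuous_attains_sup[OF cL L(2)] by blast
    then have "h x = inner x y" unfolding h_def by (intro cSup_eq_maximum) auto
    then show ?thesis using y by blast
  qed
  have le_h: "inner x y \<le> h x" if "y \<in> L" for x y using att[of x] that by auto
  have even: "h (- x) = h x" for x
  proof -
    obtain y where y: "y \<in> L" "h x = inner x y" using att by blast
    obtain z where z: "z \<in> L" "h (- x) = inner (- x) z" using att by blast
    have "h x \<le> h (- x)" using le_h[of "- y" "- x"] L(3)[OF y(1)] y by simp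
    moreover have "h (- x) \<le> h x" using le_h[of "- z" x] L(3)[OF z(1)] z by simp
    ultimately show ?thesis by simp
  qed
  obtain r where r: "\<And>x. x \<in> L \<Longrightarrow> norm x \<le> r" using compact_imp_bounded[OF cL] unfolding bounded_iff by blast
  have lip: "h x - h y \<le> r * norm (x - y)" for x y
  proof -
    obtain z where z: "z \<in> L" "h x = inner x z" using att by blast
    have "h x - h y \<le> inner (x - y) z" using le_h[OF z(1), of y] z by (simp add: inner_diff_left)
    also have "\<dots> \<le> norm (x - y) * norm z" by (rule norm_cauchy_schwarz)
    also have "\<dots> \<le> norm (x - y) * r" using r[OF z(1)] by (intro mult_left_mono) auto
    finally show ?thesis by (simp add: mult.commute)
  qed
  have "lipschitz_on \<bar>r\<bar> UNIV h"
  proof (rule lipschitz_onI)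
    fix x y :: 'a
    have "h x - h y \<le> \<bar>r\<bar> * norm (x - y)" for x y
    proof -
      have "r * norm (x - y) \<le> \<bar>r\<bar> * norm (x - y)" by (intro mult_right_mono) auto
      then show ?thesis using lip[of x y] by linarith
    qed
    from this[of x y] this[of y x] show "dist (h x) (h y) \<le> \<bar>r\<bar> * dist x y"
      by (simp add: dist_real_def dist_norm norm_minus_commute abs_le_iff)
  qed simp
  then have cont: "continuous_on UNIV h" by (rule lipschitz_on_continuous_on)
  have "zono_dense h"
  proof (rule zono_dense_lim)
    fix e :: real assume e: "e > 0"
    obtain g where g: "real_polynomial_function g" "\<And>x. x \<in> sphere 0 1 \<Longrightarrow> \<bar>h x - g x\<bar> < e"
      using Stone_Weierstrass_real_polynomial_function[OF compact_sphere continuous_on_subset[OF cont] e, of 0 1] by auto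
    have "\<bar>h x - (1/2) * (g x + g (- x))\<bar> \<le> e" if "norm x = 1" for x
    proof -
      have "\<bar>h x - g x\<bar> < e" "\<bar>h x - g (- x)\<bar> < e" using g(2)[of x] g(2)[of "- x"] that even[of x] by auto
      then show ?thesis unfolding abs_less_iff abs_le_iff by (simp add: field_simps)
    qed
    then show "\<exists>g. zono_dense g \<and> (\<forall>x. norm x = 1 \<longrightarrow> \<bar>h x - g x\<bar> \<le> e)"
      using zono_dense_cmult[OF zono_dense_even_part[OF g(1)], of "1/2"]
      by (intro exI[of _ "\<lambda>x. (1/2) * (g x + g (- x))"]) auto
  qed
  then obtain zp zn where z: "\<And>x. norm x = 1 \<Longrightarrow> \<bar>h x - (zsupp zp x - zsupp zn x)\<bar> \<le> \<epsilon>"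
    using zono_denseD[OF _ \<epsilon>(1)] by metis
  have cube: "\<epsilon> \<le> zsupp (map ((*\<^sub>R) \<epsilon>) (cube_vecs :: 'a list)) x" if "norm x = 1" for x :: 'a
    using zsupp_cube_ge[OF that] \<epsilon> by (simp add: zsupp_scaleR)
  have 1: "L + zono zn \<subseteq> zono (zp @ map ((*\<^sub>R) \<epsilon>) cube_vecs)"
  proof (rule cconvex_subset_by_support)
    show "zono (zp @ map ((*\<^sub>R) \<epsilon>) cube_vecs) \<noteq> {}" using zero_mem_zono by blast
    fix x a :: 'a assume x: "norm x = 1" and "a \<in> L + zono zn"
    then obtain y w where yw: "y \<in> L" "w \<in> zono zn" "a = y + w" by (auto simp: set_plus_iff)
    have "inner x a \<le> h x + zsupp zn x"
      using le_h[OF yw(1), of x] zsupp_attained[of zn x] yw by (simp add: inner_add_right add_mono)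
    also have "\<dots> \<le> zsupp (zp @ map ((*\<^sub>R) \<epsilon>) cube_vecs) x"
      using z[OF x] cube[OF x] unfolding zsupp_simps by linarith
    finally show "\<exists>b\<in>zono (zp @ map ((*\<^sub>R) \<epsilon>) cube_vecs). inner x a \<le> inner x b"
      using zsupp_attained[of "zp @ map ((*\<^sub>R) \<epsilon>) cube_vecs" x] by metis
  qed simp
  have 2: "zono zp \<subseteq> L + zono (zn @ map ((*\<^sub>R) \<epsilon>) cube_vecs)"
  proof (rule cconvex_subset_by_support)
    show "cconvex (L + zono (zn @ map ((*\<^sub>R) \<epsilon>) cube_vecs))" using L(1) by (simp add: cconvex_plus)
    show "L + zono (zn @ map ((*\<^sub>R) \<epsilon>) cube_vecs) \<noteq> {}"
      using L(2) zero_mem_zono by (metis ex_in_conv set_plus_intro)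
    fix x a :: 'a assume x: "norm x = 1" and a: "a \<in> zono zp"
    have "inner x a \<le> zsupp zp x" using zsupp_attained[of zp x] a by blast
    also have "\<dots> \<le> h x + zsupp (zn @ map ((*\<^sub>R) \<epsilon>) cube_vecs) x"
      using z[OF x] cube[OF x] unfolding zsupp_simps by linarith
    finally have le: "inner x a \<le> h x + zsupp (zn @ map ((*\<^sub>R) \<epsilon>) cube_vecs) x" .
    obtain y where y: "y \<in> L" "h x = inner x y" using att by blast
    obtain w where w: "w \<in> zono (zn @ map ((*\<^sub>R) \<epsilon>) cube_vecs)" "inner x w = zsupp (zn @ map ((*\<^sub>R) \<epsilon>) cube_vecs) x"
      using zsupp_attained by blast
    show "\<exists>b\<in>L + zono (zn @ map ((*\<^sub>R) \<epsilon>) cube_vecs). inner x a \<le> inner x b"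
      using le y w by (intro bexI[of _ "y + w"]) (auto simp: inner_add_right)
  qed
  show ?thesis using 1 2 \<epsilon> unfolding zono_approx_def by (intro exI[of _ zp] exI[of _ zn]) auto
qed

section \<open>Determinants\<close>

text \<open>Numbering the index type lets positions in a list serve as matrix columns, and lets
  blocks be cut off at position \<open>m\<close>.\<close>

definition idx :: "'n::finite \<Rightarrow> nat" where
  "idx = to_nat_on (UNIV :: 'n set)"

lemma bij_idx: "bij_betw idx (UNIV :: 'n::finite set) {..<CARD('n)}"
  unfolding idx_def by (rule to_nat_on_finite) simp

lemma idx_less: "idx (i :: 'n::finite) < CARD('n)"
  using bij_betwE[OF bij_idx] by auto

lemma idx_inject [simp]: "idx i = idx j \<longleftrightarrow> i = (j :: 'n::finite)"
  using bij_betw_imp_inj_on[OF bij_idx] by (auto simp: inj_on_def)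

lemma idx_surj: "k < CARD('n) \<Longrightarrow> \<exists>i::'n::finite. idx i = k"
  using bij_betw_imp_surj_on[OF bij_idx] by (metis imageE lessThan_iff)

lemma sum_idx: "(\<Sum>i\<in>(UNIV :: 'n::finite set). f (idx i)) = (\<Sum>k<CARD('n). f k)"
  by (rule sum.reindex_bij_betw[OF bij_idx])

definition mcols :: "(real ^ 'n) list \<Rightarrow> real ^ 'n ^ 'n" where
  "mcols us = (\<chi> r c. (us ! idx c) $ r)"

definition axes :: "(real ^ 'n) list" where
  "axes = map (\<lambda>k. axis (inv_into UNIV idx k) 1) [0..<CARD('n)]"

lemma length_axes [simp]: "length (axes :: (real ^ 'n) list) = CARD('n)"
  by (simp add: axes_def)

lemma nth_axes [simp]: "axes ! idx c = axis (c :: 'n::finite) 1"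
  using idx_less[of c] inv_into_f_f[OF bij_betw_imp_inj_on[OF bij_idx], of c] by (simp add: axes_def)

lemma mcols_axes: "A *v (axes ! idx c) = column c A"
  by (simp add: matrix_vector_mult_basis)

lemma map_mcols_axes: "length us = CARD('n) \<Longrightarrow> map ((*v) (mcols us)) axes = (us :: (real ^ 'n::finite) list)"
proof (rule nth_equalityI)
  fix k assume l: "length us = CARD('n)" and k: "k < length (map ((*v) (mcols us)) axes)"
  then obtain c :: 'n where c: "idx c = k" using idx_surj by (metis length_axes length_map)
  have "map ((*v) (mcols us)) axes ! k = mcols us *v (axes ! idx c)" using k c by simp
  also have "\<dots> = us ! k" unfolding mcols_axes c[symmetric] by (simp add: mcols_def column_def vec_eq_iff)
  finally show "map ((*v) (mcols us)) axes ! k = us ! k" .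
qed simp

lemma mcols_map: "length us = CARD('n) \<Longrightarrow> mcols (map ((*v) A) us) = A ** mcols (us :: (real ^ 'n::finite) list)"
  by (auto simp: mcols_def vec_eq_iff matrix_matrix_mult_def matrix_vector_mult_def idx_less)

lemma mcols_vector: "mcols us *v V = (\<Sum>c\<in>UNIV. V $ c *\<^sub>R us ! idx c)"
  by (simp add: vec_eq_iff matrix_vector_mult_def mcols_def mult.commute)

lemma transpose_mcols_mcols:
  "(transpose (mcols us) ** mcols vs) $ i $ k = inner (us ! idx i) (vs ! idx k)"
  by (simp add: matrix_matrix_mult_def transpose_def mcols_def inner_vec_def)

lemma orthogonal_mcols:
  assumes "orthonormal_list us" "length us = CARD('n)"
  shows "orthogonal_matrix (mcols (us :: (real ^ 'n::finite) list))"
  unfolding orthogonal_matrix vec_eq_iff transpose_mcols_mcols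
  using assms by (auto simp: orthonormal_list_def mat_def idx_less)

lemma mdiff_matrix_image:
  fixes A :: "real ^ 'n::{finite,wellorder} ^ 'n::_"
  assumes "cconvex C"
  shows "mdiff (map ((*v) A) us) ((*v) A ` C) = \<bar>det A\<bar> * mdiff us C"
  using assms
proof (induction us arbitrary: C)
  case Nil
  then show ?case using measure_linear_image[of "(*v) A" C] by (simp add: cconvex_measurable)
next
  case (Cons u us)
  have "(*v) A ` (C + seg u) = (*v) A ` C + seg (A *v u)"
    by (simp add: set_plus_linear_image seg_linear_image)
  then show ?case using Cons.IH[of C] Cons.IH[of "C + seg u"] Cons.prems by (simp add: cconvex_plus algebra_simps)
qed

lemma mdiff_zono_eq_0:
  assumes "length us + length vs < DIM('a)"
  shows "mdiff us (zono vs :: 'a::euclidean_space set) = 0"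
  using assms
proof (induction vs arbitrary: us)
  case Nil
  then show ?case by (simp add: mdiff_singleton_eq_0)
next
  case (Cons v vs)
  have "mdiff us (zono vs + seg (1 *\<^sub>R v)) = mdiff us (zono vs) + 1 * mdiff (v # us) (zono vs)"
    by (rule mdiff_plus_seg) auto
  then show ?case using Cons.IH[of us] Cons.IH[of "v # us"] Cons.prems by (simp add: add.commute)
qed

text \<open>Expanding the zonotope segment by segment, every term with fewer than n directions
  vanishes and only the full difference at \<open>{0}\<close> is left.\<close>

lemma mdiff_zono:
  assumes "length us + length vs = DIM('a)"
  shows "mdiff us (zono vs :: 'a::euclidean_space set) = mdiff (vs @ us) {0}"
  using assms
proof (induction vs arbitrary: us)
  case (Cons v vs)
  have "mdiff us (zono vs + seg (1 *\<^sub>R v)) = mdiff us (zono vs) + 1 * mdiff (v # us) (zono vs)"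
    by (rule mdiff_plus_seg) auto
  then have "mdiff us (zono (v # vs)) = mdiff (v # us) (zono vs)"
    using mdiff_zono_eq_0[of us vs] Cons.prems by (simp add: add.commute)
  also have "\<dots> = mdiff (vs @ v # us) {0}" using Cons.IH[of "v # us"] Cons.prems by simp
  also have "\<dots> = mdiff ((v # vs) @ us) {0}" by (simp only: mdiff_append_Cons append_Cons)
  finally show ?case .
qed simp

lemma mdiff_axes: "mdiff axes {0 :: real ^ 'n::{finite,wellorder}} = 1"
proof -
  have "zono (axes :: (real ^ 'n::_) list) = cbox (\<chi> i. - (1/2)) (\<chi> i. 1/2)"
  proof (intro equalityI subsetI)
    fix z :: "real ^ 'n::_" assume "z \<in> zono axes"
    then obtain c where c: "\<And>k. k < CARD('n) \<Longrightarrow> \<bar>c k\<bar> \<le> 1/2" "z = (\<Sum>k<CARD('n). c k *\<^sub>R axes ! k)"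
      unfolding mem_zono_iff by auto
    have "z = (\<Sum>i\<in>UNIV. c (idx i) *\<^sub>R axis i 1)"
      unfolding c(2) sum_idx[symmetric, of "\<lambda>k. c k *\<^sub>R axes ! k"] by simp
    then have "z $ i = c (idx i)" for i
      by (simp add: axis_def if_distrib cong: if_cong)
    moreover have "- (1/2) \<le> c (idx i) \<and> c (idx i) \<le> 1/2" for i :: 'n
      using c(1)[OF idx_less[of i]] by linarith
    ultimately show "z \<in> cbox (\<chi> i. - (1/2)) (\<chi> i. 1/2)" by (auto simp: mem_box_cart)
  next
    fix z :: "real ^ 'n::_" assume "z \<in> cbox (\<chi> i. - (1/2)) (\<chi> i. 1/2)"
    then have "- (1/2) \<le> z $ i" "z $ i \<le> 1/2" for i by (auto simp: mem_box_cart)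
    then have z: "\<bar>z $ i\<bar> \<le> 1/2" for i by (metis abs_le_iff minus_le_iff)
    define c where "c k = z $ inv_into UNIV idx k" for k
    have ci: "c (idx i) = z $ i" for i using inv_into_f_f[OF bij_betw_imp_inj_on[OF bij_idx], of i] by (simp add: c_def)
    have "z = (\<Sum>i\<in>(UNIV :: 'n set). c (idx i) *\<^sub>R axes ! idx i)"
      unfolding ci nth_axes by (simp add: vec_eq_iff axis_def if_distrib cong: if_cong)
    also have "\<dots> = (\<Sum>k<CARD('n). c k *\<^sub>R axes ! k)" by (rule sum_idx)
    finally show "z \<in> zono axes"
      unfolding mem_zono_iff using z by (intro exI[of _ c]) (auto simp: c_def)
  qed
  then have "mdiff [] (zono (axes :: (real ^ 'n::_) list)) = 1"
    by (simp add: content_cbox_cart interval_ne_empty_cart del: box_real interval_cbox_cart)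
  then show ?thesis using mdiff_zono[of "[]" "axes :: (real ^ 'n::_) list"] by simp
qed

lemma mdiff_eq_det:
  assumes "length us = CARD('n)"
  shows "mdiff us {0 :: real ^ 'n::{finite,wellorder}} = \<bar>det (mcols us)\<bar>"
proof -
  have "mdiff (map ((*v) (mcols us)) axes) ((*v) (mcols us) ` {0}) = \<bar>det (mcols us)\<bar> * mdiff axes {0 :: real ^ 'n::_}"
    by (intro mdiff_matrix_image) (simp add: cconvex_def)
  then show ?thesis using map_mcols_axes[OF assms] by (simp add: mdiff_axes)
qed

text \<open>The \<open>m\<close> by \<open>m\<close> matrix of inner products, padded by the
  identity to full size so that no index type with \<open>m\<close> elements is needed.\<close>

definition gram :: "nat \<Rightarrow> (real ^ 'n) list \<Rightarrow> (real ^ 'n) list \<Rightarrow> real ^ 'n ^ 'n" where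
  "gram m us ws = (\<chi> i k. if idx i < m \<and> idx k < m then inner (ws ! idx i) (us ! idx k) else if i = k then 1 else 0)"

definition gdet :: "nat \<Rightarrow> (real ^ 'n) list \<Rightarrow> (real ^ 'n) list \<Rightarrow> real" where
  "gdet m us ws = \<bar>det (gram m us ws)\<bar>"

lemma gdet_commute: "gdet m us ws = gdet m ws us"
proof -
  have "transpose (gram m us ws) = gram m ws us"
    by (auto simp: gram_def transpose_def vec_eq_iff inner_commute)
  then show ?thesis unfolding gdet_def by (metis det_transpose)
qed

lemma gdet_adjoint:
  fixes A :: "real ^ 'n ^ 'n"
  assumes "length us = m" "length ws = m"
  shows "gdet m (map ((*v) A) us) ws = gdet m us (map (\<lambda>w. w v* A) ws)"
proof -
  have "gram m (map ((*v) A) us) ws = gram m us (map (\<lambda>w. w v* A) ws)"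
    using assms by (auto simp: gram_def vec_eq_iff dot_lmul_matrix)
  then show ?thesis by (simp add: gdet_def)
qed

lemma matrix_mult_diff_right: "A ** (B - C) = A ** B - A ** (C :: real ^ 'n ^ 'm)"
  by (simp add: vec_eq_iff matrix_matrix_mult_def right_diff_distrib sum_subtractf)

lemma matrix_mult_diff_left: "(A - B) ** C = A ** C - B ** (C :: real ^ 'n ^ 'm)"
  by (simp add: vec_eq_iff matrix_matrix_mult_def left_diff_distrib sum_subtractf)

text \<open>As \<open>S ** S = 0\<close>, the matrix \<open>mat 1 + S\<close> is the inverse of
  \<open>mat 1 - S\<close>. It is also its conjugate under the sign matrix \<open>J\<close>, so both
  have the same determinant, whose square is 1.\<close>

lemma abs_det_shear:
  fixes S :: "real ^ 'n ^ 'n"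
  assumes S: "\<And>i k. S $ i $ k \<noteq> 0 \<Longrightarrow> \<not> P i \<and> P k"
  shows "\<bar>det (mat 1 - S)\<bar> = 1"
proof -
  define J :: "real ^ 'n ^ 'n" where "J = (\<chi> i k. if i = k then (if P i then 1 else -1) else 0)"
  have SS: "S ** S = 0"
  proof -
    have "S $ i $ l * S $ l $ k = 0" for i l k using S[of i l] S[of l k] by auto
    then show ?thesis by (simp only: vec_eq_iff matrix_matrix_mult_def) simp
  qed
  have JA: "(J ** A) $ i $ k = (if P i then 1 else -1) * A $ i $ k" for A :: "real ^ 'n ^ 'n" and i k
  proof -
    have "J $ i $ l * A $ l $ k = (if l = i then (if P i then 1 else -1) * A $ i $ k else 0)" for l
      by (auto simp: J_def)
    then show ?thesis by (simp add: matrix_matrix_mult_def)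
  qed
  have AJ: "(A ** J) $ i $ k = A $ i $ k * (if P k then 1 else -1)" for A :: "real ^ 'n ^ 'n" and i k
  proof -
    have "A $ i $ l * J $ l $ k = (if l = k then A $ i $ k * (if P k then 1 else -1) else 0)" for l
      by (auto simp: J_def)
    then show ?thesis by (simp add: matrix_matrix_mult_def)
  qed
  have JJ: "J ** J = mat 1"
    unfolding vec_eq_iff JA by (auto simp: J_def mat_def)
  have JSJ: "J ** S ** J = - S"
    unfolding vec_eq_iff AJ JA using S by auto
  have "(mat 1 - S) ** (mat 1 + S) = mat 1"
    by (simp add: matrix_mult_diff_left matrix_add_ldistrib SS)
  then have 1: "det (mat 1 - S) * det (mat 1 + S) = 1" by (metis det_I det_mul)
  have "J ** (mat 1 - S) ** J = mat 1 + S"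
    by (simp add: matrix_mult_diff_right matrix_mult_diff_left JJ JSJ)
  then have "det J * det (mat 1 - S) * det J = det (mat 1 + S)" by (metis det_mul)
  moreover have "det J * det J = 1" using JJ by (metis det_I det_mul)
  ultimately have "det (mat 1 + S) = det (mat 1 - S)" by (metis mult.assoc mult.commute mult.left_neutral)
  then have "(det (mat 1 - S))\<^sup>2 = 1" using 1 by (simp add: power2_eq_square)
  then show ?thesis by (auto simp: power2_eq_1_iff)
qed

text \<open>The product \<open>Y\<close> of the two column matrices is block triangular: the Gram
  block, a zero block because \<open>ws\<close> is orthogonal to \<open>bs\<close>, and an identity
  block. The shear by \<open>S\<close> clears the remaining block.\<close>

lemma gdet_eq_det_mult:
  fixes us ws bs :: "(real ^ 'n) list"
  assumes len: "length us = m" "length ws = m" "length bs = CARD('n) - m" "m \<le> CARD('n)"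
    and bs: "orthonormal_list bs" and orth: "\<And>w b. w \<in> set ws \<Longrightarrow> b \<in> set bs \<Longrightarrow> inner w b = 0"
  shows "gdet m us ws = \<bar>det (mcols (ws @ bs))\<bar> * \<bar>det (mcols (us @ bs))\<bar>"
proof -
  define Y where "Y = transpose (mcols (ws @ bs)) ** mcols (us @ bs)"
  define S :: "real ^ 'n ^ 'n" where "S = (\<chi> i k. if \<not> idx i < m \<and> idx k < m then Y $ i $ k else 0)"
  have Yik: "Y $ i $ k = inner ((ws @ bs) ! idx i) ((us @ bs) ! idx k)" for i k
    unfolding Y_def by (rule transpose_mcols_mcols)
  have Y1: "Y $ i $ k = inner (ws ! idx i) (us ! idx k)" if "idx i < m" "idx k < m" for i k
    using that len by (simp add: Yik nth_append)
  have Y2: "Y $ i $ k = 0" if "idx i < m" "\<not> idx k < m" for i k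
  proof -
    have "idx k - m < length bs" using that len idx_less[of k] by simp
    then show ?thesis using that len orth by (simp add: Yik nth_append)
  qed
  have Y3: "Y $ i $ k = (if i = k then 1 else 0)" if "\<not> idx i < m" "\<not> idx k < m" for i k
  proof -
    have "idx k - m < length bs" "idx i - m < length bs" using that len idx_less[of k] idx_less[of i] by auto
    moreover have "idx i - m = idx k - m \<longleftrightarrow> i = k" using that by (metis diff_is_0_eq eq_diff_iff idx_inject linorder_not_less)
    ultimately show ?thesis using that len bs by (simp add: Yik nth_append orthonormal_list_def)
  qed
  have YS: "(Y ** S) $ i $ k = S $ i $ k" for i k
  proof -
    have "Y $ i $ l * S $ l $ k = (if l = i then S $ i $ k else 0)" for l
    proof (cases "idx l < m")
      case True
      then show ?thesis by (auto simp: S_def)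
    next
      case False
      then show ?thesis using Y2[of i l] Y3[of i l] by (cases "idx i < m") (auto simp: S_def)
    qed
    then show ?thesis by (simp add: matrix_matrix_mult_def)
  qed
  have "gram m us ws = Y ** (mat 1 - S)"
  proof -
    have "gram m us ws $ i $ k = Y $ i $ k - S $ i $ k" for i k
      by (cases "idx i < m"; cases "idx k < m") (auto simp: gram_def S_def Y1 Y2 Y3)
    then show ?thesis by (simp add: vec_eq_iff matrix_mult_diff_right YS)
  qed
  then have "gdet m us ws = \<bar>det Y\<bar> * \<bar>det (mat 1 - S)\<bar>" by (simp add: gdet_def det_mul abs_mult)
  moreover have "\<bar>det (mat 1 - S)\<bar> = 1"
    by (rule abs_det_shear[where P = "\<lambda>i. idx i < m"]) (auto simp: S_def split: if_splits)
  ultimately show ?thesis by (simp add: Y_def det_mul det_transpose abs_mult)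
qed

text \<open>Dependence is counted by position, so a repeated vector already makes the list
  dependent.\<close>

definition lin_dep :: "'a::real_vector list \<Rightarrow> bool" where
  "lin_dep ws \<longleftrightarrow> (\<exists>v. (\<exists>i<length ws. v i \<noteq> 0) \<and> (\<Sum>i<length ws. v i *\<^sub>R ws ! i) = 0)"

lemma gdet_lin_dep:
  fixes ws :: "(real ^ 'n) list"
  assumes "lin_dep ws" "length ws = m" "m \<le> CARD('n)"
  shows "gdet m us ws = 0"
proof -
  obtain v k where v: "k < m" "v k \<noteq> 0" "(\<Sum>i<m. v i *\<^sub>R ws ! i) = 0" using assms unfolding lin_dep_def by blast
  define V :: "real ^ 'n" where "V = (\<chi> i. if idx i < m then v (idx i) else 0)"
  obtain i :: 'n where "idx i = k" using idx_surj[of k] v assms by (metis less_le_trans)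
  then have "V $ i \<noteq> 0" using v by (simp add: V_def)
  then have V0: "V \<noteq> 0" by auto
  have "(transpose (gram m us ws) *v V) $ k = 0" for k
  proof -
    have "(transpose (gram m us ws) *v V) $ k = (\<Sum>i\<in>UNIV. gram m us ws $ i $ k * V $ i)"
      by (simp add: vector_matrix_mult_def mult.commute)
    also have "\<dots> = (\<Sum>i\<in>(UNIV :: 'n set). (\<lambda>l. if l < m then v l * (if idx k < m then inner (ws ! l) (us ! idx k) else 0) else 0) (idx i))"
      by (intro sum.cong refl) (auto simp: gram_def V_def)
    also have "\<dots> = (\<Sum>l<CARD('n). if l < m then v l * (if idx k < m then inner (ws ! l) (us ! idx k) else 0) else 0)"
      by (rule sum_idx)
    also have "\<dots> = (\<Sum>l<m. v l * (if idx k < m then inner (ws ! l) (us ! idx k) else 0))"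
      using assms(3) by (subst sum.inter_filter[symmetric]) (auto intro!: sum.cong)
    also have "\<dots> = (if idx k < m then inner (\<Sum>l<m. v l *\<^sub>R ws ! l) (us ! idx k) else 0)"
      by (simp add: inner_sum_left)
    finally show ?thesis using v by simp
  qed
  then have "transpose (gram m us ws) *v V = 0" by (simp add: vec_eq_iff)
  then have "\<not> invertible (transpose (gram m us ws))"
    using V0 matrix_left_invertible_ker[of "transpose (gram m us ws)"] unfolding invertible_def by metis
  then have "det (transpose (gram m us ws)) = 0" using invertible_det_nz by blast
  then show ?thesis by (simp add: gdet_def det_transpose)
qed

lemma span_set_list: "x \<in> span (set zs) \<Longrightarrow> \<exists>a. x = (\<Sum>i<length zs. a i *\<^sub>R zs ! i)"
proof (induction zs arbitrary: x)
  case (Cons z zs)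
  then obtain k where "x - k *\<^sub>R z \<in> span (set zs)" by (auto simp: span_insert)
  then obtain a where "x - k *\<^sub>R z = (\<Sum>i<length zs. a i *\<^sub>R zs ! i)" using Cons.IH by blast
  then have "x = (\<Sum>i<length (z # zs). (case i of 0 \<Rightarrow> k | Suc j \<Rightarrow> a j) *\<^sub>R (z # zs) ! i)"
    unfolding list.size add_0_right add_Suc_right sum.lessThan_Suc_shift by (simp add: algebra_simps)
  then show ?case by blast
qed simp

text \<open>One vector is a combination of the others, so its segment fits into a zonotope spanned
  by long multiples of them, and adding that zonotope changes nothing.\<close>

lemma mdiff_lin_dep:
  fixes ws :: "'a::euclidean_space list"
  assumes C: "cconvex C" and dep: "lin_dep ws"
  shows "mdiff ws C = 0"
proof -
  obtain v k where v: "k < length ws" "v k \<noteq> 0" "(\<Sum>i<length ws. v i *\<^sub>R ws ! i) = 0"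
    using dep unfolding lin_dep_def by blast
  define zs where "zs = take k ws @ drop (Suc k) ws"
  have ws: "ws = take k ws @ ws ! k # drop (Suc k) ws" using v(1) by (simp add: id_take_nth_drop)
  have "mdiff ws C = mdiff (ws ! k # zs) C" by (subst ws) (simp only: mdiff_append_Cons zs_def)
  have mem: "ws ! i \<in> set zs" if "i < length ws" "i \<noteq> k" for i
  proof (cases "i < k")
    case True
    then show ?thesis using that by (auto simp: zs_def in_set_conv_nth intro!: disjI1 exI[of _ i])
  next
    case False
    then have "drop (Suc k) ws ! (i - Suc k) = ws ! i" "i - Suc k < length (drop (Suc k) ws)" using that by auto
    then show ?thesis by (metis UnI2 nth_mem set_append zs_def)
  qed
  have "(\<Sum>i<length ws. v i *\<^sub>R ws ! i) = v k *\<^sub>R ws ! k + (\<Sum>i\<in>{..<length ws} - {k}. v i *\<^sub>R ws ! i)"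
    using v(1) by (intro sum.remove) auto
  then have "v k *\<^sub>R ws ! k = - (\<Sum>i\<in>{..<length ws} - {k}. v i *\<^sub>R ws ! i)" using v(3) by (simp add: eq_neg_iff_add_eq_0)
  moreover have "\<dots> \<in> span (set zs)" using mem by (intro span_neg span_sum span_mul span_base) auto
  ultimately have "(1 / v k) *\<^sub>R (v k *\<^sub>R ws ! k) \<in> span (set zs)" by (metis span_mul)
  then have "ws ! k \<in> span (set zs)" using v(2) by simp
  then obtain a where a: "ws ! k = (\<Sum>i<length zs. a i *\<^sub>R zs ! i)" using span_set_list by blast
  define \<rho> where "\<rho> = 1 + (\<Sum>i<length zs. \<bar>a i\<bar>)"
  have \<rho>: "\<rho> > 0" by (simp add: \<rho>_def add_pos_nonneg sum_nonneg)
  have a\<rho>: "\<bar>a i\<bar> \<le> \<rho>" if "i < length zs" for i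
    using member_le_sum[of i "{..<length zs}" "\<lambda>i. \<bar>a i\<bar>"] that by (simp add: \<rho>_def)
  have "seg (ws ! k) \<subseteq> zono (map ((*\<^sub>R) \<rho>) zs)"
  proof
    fix x assume "x \<in> seg (ws ! k)"
    then obtain t where t: "t \<in> {-(1/2)..1/2}" "x = t *\<^sub>R ws ! k" unfolding seg_def by blast
    have "x = (\<Sum>i<length zs. (t * a i / \<rho>) *\<^sub>R (\<rho> *\<^sub>R zs ! i))"
      unfolding t(2) a using \<rho> by (simp add: scaleR_sum_right)
    moreover have "\<bar>t * a i / \<rho>\<bar> \<le> 1/2" if "i < length zs" for i
    proof -
      have "\<bar>t\<bar> * \<bar>a i\<bar> \<le> 1/2 * \<rho>" using t a\<rho>[OF that] \<rho> by (intro mult_mono) (auto simp: abs_le_iff)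
      then show ?thesis using \<rho> by (simp add: abs_mult abs_divide field_simps)
    qed
    ultimately show "x \<in> zono (map ((*\<^sub>R) \<rho>) zs)"
      unfolding mem_zono_iff by (intro exI[of _ "\<lambda>i. t * a i / \<rho>"]) auto
  qed
  then have "mdiff zs (C + seg (ws ! k)) \<le> mdiff zs (C + zono (map ((*\<^sub>R) \<rho>) zs))"
    using C by (intro mdiff_mono cconvex_plus cconvex_seg cconvex_zono set_plus_mono2) auto
  also have "\<dots> = mdiff zs C" using C \<rho> by (intro mdiff_plus_zono_self) auto
  finally have "mdiff (ws ! k # zs) C \<le> 0" by simp
  then show ?thesis using mdiff_nonneg[OF C, of "ws ! k # zs"] \<open>mdiff ws C = mdiff (ws ! k # zs) C\<close> by simp
qed

text \<open>Independence fixes the dimension of the span and of its orthogonal complement;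
  orthonormal bases of both are concatenated. The empty list is allowed and gives a basis of the
  whole space.\<close>

lemma not_lin_dep_frame:
  fixes ws :: "'a::euclidean_space list"
  assumes nd: "\<not> lin_dep ws"
  obtains hs bs where "length hs = length ws" "length bs = DIM('a) - length ws" "length ws \<le> DIM('a)"
    "orthonormal_list (hs @ bs)" "span (set hs) = span (set ws)"
proof -
  have dist: "distinct ws"
  proof (rule ccontr)
    assume "\<not> distinct ws"
    then obtain i j where ij: "i < length ws" "j < length ws" "i \<noteq> j" "ws ! i = ws ! j" unfolding distinct_conv_nth by blast
    have "(\<Sum>l<length ws. ((if l = i then 1 else 0) - (if l = j then 1 else 0)) *\<^sub>R ws ! l) =
       (\<Sum>l<length ws. (if l = i then ws ! l else 0)) - (\<Sum>l<length ws. (if l = j then ws ! l else 0))"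
      unfolding sum_subtractf[symmetric] by (intro sum.cong) auto
    also have "\<dots> = 0" using ij by simp
    finally have "lin_dep ws" unfolding lin_dep_def
      using ij by (intro exI[of _ "\<lambda>l. (if l = i then 1 else 0) - (if l = j then 1 else 0)"]) auto
    then show False using nd by simp
  qed
  have ind: "independent (set ws)"
  proof (rule ccontr)
    assume "\<not> independent (set ws)"
    then obtain u where u: "\<exists>x\<in>set ws. u x \<noteq> 0" "(\<Sum>x\<in>set ws. u x *\<^sub>R x) = 0"
      using dependent_finite[of "set ws"] by auto
    have "(\<Sum>i<length ws. u (ws ! i) *\<^sub>R ws ! i) = (\<Sum>x\<in>set ws. u x *\<^sub>R x)"
      using bij_betw_nth[OF dist, of "{..<length ws}" "set ws"] by (intro sum.reindex_bij_betw) auto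
    then have "lin_dep ws" unfolding lin_dep_def
      using u by (intro exI[of _ "\<lambda>i. u (ws ! i)"]) (auto simp: in_set_conv_nth)
    then show False using nd by simp
  qed
  define E where "E = span (set ws)"
  have dE: "dim E = length ws" using ind dist by (simp add: E_def dim_eq_card_independent distinct_card)
  have sE: "subspace E" by (simp add: E_def)
  obtain h where h: "is_onb E (length ws) h" using is_onb_ex[OF sE dE] by blast
  define F where "F = {y. \<forall>x\<in>E. orthogonal x y}"
  have sF: "subspace F" unfolding F_def by (rule subspaceI) (auto simp: orthogonal_clauses)
  have "dim {y \<in> UNIV. \<forall>x\<in>E. orthogonal x y} + dim E = dim (UNIV :: 'a set)"
    by (rule dim_subspace_orthogonal_to_vectors) (use sE in auto)
  then have dF: "dim F = DIM('a) - length ws" and le: "length ws \<le> DIM('a)" using dE by (auto simp: F_def dim_UNIV)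
  obtain b where b: "is_onb F (DIM('a) - length ws) b" using is_onb_ex[OF sF dF] by blast
  show ?thesis
  proof (rule that[of "map h [0..<length ws]" "map b [0..<DIM('a) - length ws]"])
    show "orthonormal_list (map h [0..<length ws] @ map b [0..<DIM('a) - length ws])"
      unfolding orthonormal_list_append_iff
    proof (intro conjI ballI)
      fix u v assume "u \<in> set (map h [0..<length ws])" "v \<in> set (map b [0..<DIM('a) - length ws])"
      then have "u \<in> E" "v \<in> F" using h b by (auto simp: is_onb_def)
      then show "inner u v = 0" by (auto simp: F_def orthogonal_def)
    qed (use h b in \<open>auto simp: orthonormal_list_def is_onb_def norm_eq_1\<close>)
    show "span (set (map h [0..<length ws])) = span (set ws)"
      using h by (auto simp: is_onb_def E_def lessThan_atLeast0)
  qed (use le in auto)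
qed

text \<open>Extends the projection hypothesis from orthonormal to arbitrary independent lists. The
  map \<open>T\<close> takes \<open>hs\<close> to \<open>ws\<close>, fixes \<open>bs\<close>, and
  moves every point only within the span of \<open>hs\<close>. Hence replacing \<open>K\<close> by
  its preimage under \<open>T\<close> leaves the difference along \<open>hs\<close> unchanged, and
  only the determinant of \<open>T\<close> remains.\<close>

lemma dual_mdiff:
  fixes K L :: "(real ^ 'n::{finite,wellorder}) set" and ws :: "(real ^ 'n::_) list"
  assumes K: "cconvex K" and ws: "length ws = m" and hs: "length hs = m" and bs: "length bs = CARD('n) - m" "m \<le> CARD('n)"
    and o: "orthonormal_list (hs @ bs)" and sp: "span (set hs) = span (set ws)" and nd: "\<not> lin_dep ws"
    and dual: "mdiff hs K = mdiff bs L"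
  shows "mdiff ws K = \<bar>det (mcols (ws @ bs))\<bar> * mdiff bs L"
proof -
  define H where "H = mcols (hs @ bs)"
  define X where "X = mcols (ws @ bs)"
  \<comment> \<open>\<open>H\<close> is orthogonal, so its transpose is its inverse, and
    \<open>T\<close> maps the columns of \<open>H\<close> to those of \<open>X\<close>.\<close>
  define T where "T = X ** transpose H"
  have len: "length (hs @ bs) = CARD('n)" "length (ws @ bs) = CARD('n)" using ws hs bs by auto
  have oH: "orthogonal_matrix H" unfolding H_def by (rule orthogonal_mcols[OF o len(1)])
  have hb: "inner h b = 0" if "h \<in> span (set hs)" "b \<in> set bs" for h b
    using that(1)
  proof (rule span_induct)
    show "subspace {h. inner h b = 0}" by (rule subspaceI) (auto simp: inner_add_left)
  qed (use o that(2) in \<open>auto simp: orthonormal_list_append_iff\<close>)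
  have Tz: "T *v z = (\<Sum>c\<in>(UNIV :: 'n set). inner ((hs @ bs) ! idx c) z *\<^sub>R (ws @ bs) ! idx c)" for z
  proof -
    have "(transpose H *v z) $ c = inner ((hs @ bs) ! idx c) z" for c :: 'n
      unfolding matrix_vector_mul_component by (simp add: H_def transpose_def mcols_def inner_vec_def)
    then show ?thesis
      unfolding T_def matrix_vector_mul_assoc[symmetric] X_def mcols_vector by (simp only:)
  qed
  have Tzk: "T *v z = (\<Sum>k<CARD('n). inner ((hs @ bs) ! k) z *\<^sub>R (ws @ bs) ! k)" for z
    unfolding Tz by (rule sum_idx)
  have Th: "map ((*v) T) hs = ws"
  proof (rule nth_equalityI)
    fix i assume i: "i < length (map ((*v) T) hs)"
    then have im: "i < m" using hs by simp
    have "T *v hs ! i = (\<Sum>k<CARD('n). if k = i then (ws @ bs) ! k else 0)"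
      unfolding Tzk
    proof (intro sum.cong refl)
      fix k assume "k \<in> {..<CARD('n)}"
      then have "inner ((hs @ bs) ! k) ((hs @ bs) ! i) = (if k = i then 1 else 0)"
        using o len im bs by (auto simp: orthonormal_list_def)
      then show "inner ((hs @ bs) ! k) (hs ! i) *\<^sub>R (ws @ bs) ! k = (if k = i then (ws @ bs) ! k else 0)"
        using im hs by (auto simp: nth_append)
    qed
    also have "\<dots> = ws ! i" using im bs ws by (simp add: nth_append)
    finally show "map ((*v) T) hs ! i = ws ! i" using i by simp
  qed (use ws hs in simp)
  have Tdiff: "T *v z - z \<in> span (set hs)" for z
  proof -
    have "z = (\<Sum>u\<leftarrow>hs @ bs. inner z u *\<^sub>R u)"
      using orthonormal_expansion[OF o] orthonormal_list_span[OF o] len by simp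
    also have "\<dots> = (\<Sum>k<CARD('n). inner ((hs @ bs) ! k) z *\<^sub>R (hs @ bs) ! k)"
      using len by (simp add: sum_list_sum_nth lessThan_atLeast0 inner_commute del: map_append)
    finally have zz: "z = (\<Sum>k<CARD('n). inner ((hs @ bs) ! k) z *\<^sub>R (hs @ bs) ! k)" .
    have "T *v z - z = (\<Sum>k<CARD('n). inner ((hs @ bs) ! k) z *\<^sub>R ((ws @ bs) ! k - (hs @ bs) ! k))"
      unfolding scaleR_diff_right sum_subtractf Tzk[symmetric] zz[symmetric] ..
    also have "\<dots> \<in> span (set hs)"
    proof (intro span_sum span_mul)
      fix k assume "k \<in> {..<CARD('n)}"
      show "(ws @ bs) ! k - (hs @ bs) ! k \<in> span (set hs)"
      proof (cases "k < m")
        case True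
        then have "ws ! k \<in> span (set ws)" "hs ! k \<in> span (set hs)" using ws hs by (auto intro: span_base)
        then have "ws ! k \<in> span (set hs)" "hs ! k \<in> span (set hs)" using sp by auto
        then show ?thesis using True ws hs by (simp add: nth_append span_diff)
      next
        case False
        then show ?thesis using ws hs by (simp add: nth_append span_zero)
      qed
    qed
    finally show ?thesis .
  qed
  have "invertible T"
  proof -
    \<comment> \<open>A vector in the kernel lies in the span of \<open>hs\<close> by
      \<open>Tdiff\<close>; there its image is a combination of \<open>ws\<close> with its
      coordinates as coefficients, so independence of \<open>ws\<close> makes them zero.\<close>
    have "z = 0" if z: "T *v z = 0" for z
    proof -
      have "z \<in> span (set hs)" using Tdiff[of z] z span_neg by fastforce
      then have zb: "inner b z = 0" if "b \<in> set bs" for b using hb[OF \<open>z \<in> span (set hs)\<close> that] by (simp add: inner_commute)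
      have "(\<Sum>k<CARD('n). inner ((hs @ bs) ! k) z *\<^sub>R (ws @ bs) ! k) = (\<Sum>k<m. inner (hs ! k) z *\<^sub>R ws ! k)"
      proof -
        have "(\<Sum>k<CARD('n). inner ((hs @ bs) ! k) z *\<^sub>R (ws @ bs) ! k) = (\<Sum>k<CARD('n). if k < m then inner (hs ! k) z *\<^sub>R ws ! k else 0)"
          using hs ws bs zb by (intro sum.cong) (auto simp: nth_append)
        also have "\<dots> = (\<Sum>k<m. inner (hs ! k) z *\<^sub>R ws ! k)"
          using bs by (subst sum.inter_filter[symmetric]) (auto intro!: sum.cong)
        finally show ?thesis .
      qed
      then have sm: "(\<Sum>k<m. inner (hs ! k) z *\<^sub>R ws ! k) = 0" using z Tzk by simp
      have zh: "inner (hs ! k) z = 0" if "k < m" for k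
      proof (rule ccontr)
        assume "inner (hs ! k) z \<noteq> 0"
        then have "lin_dep ws" unfolding lin_dep_def ws
          using that sm
          by (intro exI[of _ "\<lambda>k. inner (hs ! k) z"]) auto
        then show False using nd by simp
      qed
      have "z = (\<Sum>u\<leftarrow>hs. inner z u *\<^sub>R u)"
        using orthonormal_expansion[of hs z] o \<open>z \<in> span (set hs)\<close> by (simp add: orthonormal_list_append_iff)
      also have "\<dots> = 0" using zh hs by (simp add: sum_list_sum_nth inner_commute)
      finally show ?thesis .
    qed
    then show ?thesis
      using matrix_left_invertible_ker[of T] invertible_left_inverse[of T] by blast
  qed
  then obtain T' where T': "T ** T' = mat 1" "T' ** T = mat 1" unfolding invertible_def by blast
  define C where "C = (*v) T' ` K"
  have C: "cconvex C" unfolding C_def by (intro cconvex_linear_image K) simp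
  have KT: "(*v) T ` C = K" unfolding C_def image_image matrix_vector_mul_assoc T' by simp
  have "mdiff ws K = \<bar>det T\<bar> * mdiff hs C"
    using mdiff_matrix_image[OF C, of T hs] unfolding Th KT .
  moreover have "\<bar>det T\<bar> = \<bar>det X\<bar>"
    using det_orthogonal_matrix[OF oH] unfolding T_def det_mul det_transpose abs_mult by auto
  moreover have "mdiff hs C = mdiff hs K"
  proof (rule antisym)
    have oh: "orthonormal_list hs" using o by (simp add: orthonormal_list_append_iff)
    show "mdiff hs C \<le> mdiff hs K"
    proof (rule mdiff_mono_mod_span[OF oh K C])
      fix x assume x: "x \<in> C"
      have "T *v x \<in> K" using x KT by blast
      moreover have "x - T *v x \<in> span (set hs)" using span_neg[OF Tdiff[of x]] by simp
      ultimately show "\<exists>y\<in>K. x - y \<in> span (set hs)" by blast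
    qed
    show "mdiff hs K \<le> mdiff hs C"
      by (rule mdiff_mono_mod_span[OF oh C K]) (use KT Tdiff in blast)
  qed
  ultimately show ?thesis using dual by (simp add: X_def)
qed

section \<open>Averaging over matrices near the identity\<close>

lemma poly_coeff_unique:
  fixes a b :: "nat \<Rightarrow> real"
  assumes eq: "\<And>t. t > 0 \<Longrightarrow> (\<Sum>i<k. a i * t ^ i) = (\<Sum>i<k. b i * t ^ i)" and i: "i < k"
  shows "a i = b i"
proof -
  obtain n where k: "k = Suc n" using i by (cases k) auto
  have "{0<..} \<subseteq> {t. (\<Sum>i\<le>n. (a i - b i) * t ^ i) = 0}"
    using eq unfolding k lessThan_Suc_atMost by (auto simp: left_diff_distrib sum_subtractf)
  then have "infinite {t. (\<Sum>i\<le>n. (a i - b i) * t ^ i) = 0}"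
    using infinite_Ioi[of "0::real"] finite_subset by blast
  then have "a i - b i = 0"
    using polyfun_finite_roots[where n = n and c = "\<lambda>i. a i - b i"] i k by auto
  then show ?thesis by simp
qed

section \<open>The projection hypotheses as limits of determinants\<close>

lemma mdiff_append_commute: "mdiff (us @ vs) C = mdiff (vs @ us) C"
proof (induction us arbitrary: C)
  case (Cons u us)
  then show ?case unfolding append_Cons mdiff_append_Cons by simp
qed simp

text \<open>For fixed \<open>ws\<close>, the kernel and the difference of \<open>K\<close> carry the
  same factor \<open>f\<close>, which reduces both to the orthonormal list \<open>bs\<close>. The
  bound on \<open>f\<close> depends only on \<open>R\<close>, as uniformity over a family of lists
  requires.\<close>

lemma dual_frame:
  fixes K L :: "(real ^ 'n::{finite,wellorder}) set"
  assumes K: "cconvex K" and m: "m \<le> CARD('n)"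
    and dual: "\<And>us bs. length us = m \<Longrightarrow> length bs = CARD('n) - m \<Longrightarrow> orthonormal_list (us @ bs) \<Longrightarrow> mdiff us K = mdiff bs L"
    and ws: "length ws = m" "\<And>w. w \<in> set ws \<Longrightarrow> norm w \<le> R" and R: "R \<ge> 1"
  shows "\<exists>bs f. length bs = CARD('n) - m \<and> orthonormal_list bs \<and> 0 \<le> f \<and> f \<le> ball_bound TYPE(real ^ 'n::_) R (CARD('n)) \<and>
    (\<forall>us. length us = m \<longrightarrow> gdet m us ws = f * mdiff (us @ bs) {0}) \<and> mdiff ws K = f * mdiff bs L"
proof (cases "lin_dep ws")
  case True
  \<comment> \<open>In the dependent case \<open>f\<close> is 0 and any orthonormal list of the
    right length serves.\<close>
  have "\<not> lin_dep ([] :: (real ^ 'n::_) list)" by (simp add: lin_dep_def)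
  then obtain cs :: "(real ^ 'n::_) list" where cs: "length cs = CARD('n)" "orthonormal_list cs"
    using not_lin_dep_frame[of "[] :: (real ^ 'n::_) list"] by (metis DIM_cart DIM_real append_Nil diff_zero length_0_conv list.size(3) mult.right_neutral)
  define bs where "bs = take (CARD('n) - m) cs"
  have "orthonormal_list bs"
    using cs(2) orthonormal_list_append_iff[of "take (CARD('n) - m) cs" "drop (CARD('n) - m) cs"] by (simp add: bs_def)
  moreover have "length bs = CARD('n) - m" using cs by (simp add: bs_def)
  ultimately show ?thesis
    using gdet_lin_dep[OF True ws(1) m] mdiff_lin_dep[OF K True] ball_bound_nonneg
    by (intro exI[of _ bs] exI[of _ 0]) auto
next
  case False
  obtain hs bs where hb: "length hs = length ws" "length bs = DIM(real ^ 'n::_) - length ws"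
    "orthonormal_list (hs @ bs)" "span (set hs) = span (set ws)"
    using not_lin_dep_frame[OF False] by metis
  have lb: "length bs = CARD('n) - m" and lh: "length hs = m" using hb ws by auto
  have obs: "orthonormal_list bs" using hb(3) by (simp add: orthonormal_list_append_iff)
  define f where "f = \<bar>det (mcols (ws @ bs))\<bar>"
  have len: "length (ws @ bs) = CARD('n)" using ws lb m by simp
  have z0: "cconvex {0 :: real ^ 'n::_}" by (simp add: cconvex_def)
  have orth: "inner w b = 0" if w: "w \<in> set ws" and b: "b \<in> set bs" for w b
  proof -
    have "w \<in> span (set hs)" using hb(4) w span_base by blast
    then show ?thesis
    proof (rule span_induct)
      show "subspace {h. inner h b = 0}" by (rule subspaceI) (auto simp: inner_add_left)
    qed (use hb(3) b in \<open>auto simp: orthonormal_list_append_iff\<close>)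
  qed
  have "f = mdiff (ws @ bs) {0}" unfolding f_def using mdiff_eq_det[OF len] by simp
  also have "\<dots> \<le> ball_bound TYPE(real ^ 'n::_) R (CARD('n))"
  proof (rule mdiff_le_ball_bound[OF z0])
    show "{0} \<subseteq> cball (0 :: real ^ 'n::_) R" using R by simp
    show "norm u \<le> R" if "u \<in> set (ws @ bs)" for u
      using that ws(2) orthonormal_list_norm[OF obs] R by auto
  qed (rule len)
  finally have fb: "f \<le> ball_bound TYPE(real ^ 'n::_) R (CARD('n))" .
  have "gdet m us ws = f * mdiff (us @ bs) {0}" if "length us = m" for us
    using gdet_eq_det_mult[OF that ws(1) lb m obs orth] mdiff_eq_det[of "us @ bs"] that lb m by (simp add: f_def)
  moreover have "mdiff ws K = f * mdiff bs L"
    unfolding f_def by (rule dual_mdiff[OF K ws(1) lh lb m hb(3,4) False dual[OF lh lb hb(3)]])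
  ultimately show ?thesis using lb obs fb by (intro exI[of _ bs] exI[of _ f]) (auto simp: f_def)
qed

text \<open>By \<open>dual_frame\<close> the kernel is a bounded factor times a difference at
  \<open>{0}\<close>, whose iterated limit along \<open>L\<close> is \<open>fact m\<close> times a
  coefficient of the polynomial of \<open>L\<close> alone. The projection hypothesis converts this
  coefficient into a difference of \<open>K\<close>.\<close>

lemma gdet_iter_lim:
  fixes K L :: "(real ^ 'n::{finite,wellorder}) set" and ws :: "'p \<Rightarrow> (real ^ 'n::_) list"
  assumes L: "cconvex L" "0 \<in> L" and ap: "\<And>r. zono_approx L (\<epsilon> r) (zp r) (zn r)" and \<epsilon>: "\<epsilon> \<longlonglongrightarrow> 0"
    and K: "cconvex K" and m: "m \<le> CARD('n)"
    and dual: "\<And>us bs. length us = m \<Longrightarrow> length bs = CARD('n) - m \<Longrightarrow> orthonormal_list (us @ bs) \<Longrightarrow> mdiff us K = mdiff bs L"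
    and ws: "\<And>p. p \<in> P \<Longrightarrow> length (ws p) = m" "\<And>p w. p \<in> P \<Longrightarrow> w \<in> set (ws p) \<Longrightarrow> norm w \<le> R"
  shows "iter_lim zp zn m P (\<lambda>us p. gdet m us (ws p)) (\<lambda>p. fact m * mdiff (ws p) K)"
proof -
  define R' where "R' = max R 1"
  have "\<exists>bs f. length bs = CARD('n) - m \<and> orthonormal_list bs \<and> 0 \<le> f \<and> f \<le> ball_bound TYPE(real ^ 'n::_) R' (CARD('n)) \<and>
    (\<forall>us. length us = m \<longrightarrow> gdet m us (ws p) = f * mdiff (us @ bs) {0}) \<and> mdiff (ws p) K = f * mdiff bs L" if "p \<in> P" for p
    using ws[OF that] by (intro dual_frame[OF K m dual]) (auto simp: R'_def le_max_iff_disj)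
  then have "\<exists>bs. \<forall>p\<in>P. \<exists>f. length (bs p) = CARD('n) - m \<and> orthonormal_list (bs p) \<and> 0 \<le> f \<and> f \<le> ball_bound TYPE(real ^ 'n::_) R' (CARD('n)) \<and>
    (\<forall>us. length us = m \<longrightarrow> gdet m us (ws p) = f * mdiff (us @ bs p) {0}) \<and> mdiff (ws p) K = f * mdiff (bs p) L"
    by (intro bchoice ballI)
  then obtain bs where "\<forall>p\<in>P. \<exists>f. length (bs p) = CARD('n) - m \<and> orthonormal_list (bs p) \<and> 0 \<le> f \<and> f \<le> ball_bound TYPE(real ^ 'n::_) R' (CARD('n)) \<and>
    (\<forall>us. length us = m \<longrightarrow> gdet m us (ws p) = f * mdiff (us @ bs p) {0}) \<and> mdiff (ws p) K = f * mdiff (bs p) L" ..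
  from bchoice[OF this] obtain f where bs: "\<And>p. p \<in> P \<Longrightarrow> length (bs p) = CARD('n) - m" "\<And>p. p \<in> P \<Longrightarrow> orthonormal_list (bs p)"
    and f: "\<And>p. p \<in> P \<Longrightarrow> 0 \<le> f p" "\<And>p. p \<in> P \<Longrightarrow> f p \<le> ball_bound TYPE(real ^ 'n::_) R' (CARD('n))"
    and gd: "\<And>p us. p \<in> P \<Longrightarrow> length us = m \<Longrightarrow> gdet m us (ws p) = f p * mdiff (us @ bs p) {0}"
    and md: "\<And>p. p \<in> P \<Longrightarrow> mdiff (ws p) K = f p * mdiff (bs p) L"
    by blast
  have z0: "cconvex {0 :: real ^ 'n::_}" by (simp add: cconvex_def)
  have nb: "norm u \<le> 1" if "p \<in> P" "u \<in> set (bs p)" for p u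
    using orthonormal_list_norm[OF bs(2)[OF that(1)] that(2)] by simp
  have "\<exists>a. (\<forall>p\<in>P. \<forall>t\<ge>0. mdiff (bs p) ({0} + (*\<^sub>R) t ` L) = (\<Sum>i<Suc m. a i p * t ^ i)) \<and>
    (\<forall>i<Suc m. iter_lim zp zn i P (\<lambda>vs p. mdiff (bs p @ vs) {0}) (\<lambda>p. fact i * a i p))"
    by (rule mdiff_polynomial_family[OF L ap \<epsilon>, where R = 1])
      (use z0 bs(1) m nb in auto)
  then obtain a where a: "\<And>p t. p \<in> P \<Longrightarrow> t \<ge> 0 \<Longrightarrow> mdiff (bs p) ({0} + (*\<^sub>R) t ` L) = (\<Sum>i<Suc m. a i p * t ^ i)"
    and al: "iter_lim zp zn m P (\<lambda>vs p. mdiff (bs p @ vs) {0}) (\<lambda>p. fact m * a m p)" by blast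
  \<comment> \<open>The difference along \<open>n - m\<close> directions is homogeneous of degree
    \<open>m\<close> in \<open>L\<close>, so its polynomial has a single term.\<close>
  have am: "a m p = mdiff (bs p) L" if p: "p \<in> P" for p
  proof -
    have "(\<Sum>i<Suc m. a i p * t ^ i) = (\<Sum>i<Suc m. (if i = m then mdiff (bs p) L else 0) * t ^ i)" if t: "t > 0" for t
    proof -
      have "(\<Sum>i<Suc m. a i p * t ^ i) = mdiff (bs p) ((*\<^sub>R) t ` L)" using a[OF p, of t] t by simp
      also have "\<dots> = t ^ m * mdiff (bs p) L"
        using mdiff_scaleR_set[OF L(1) t, of "bs p"] bs(1)[OF p] m by simp
      also have "\<dots> = (\<Sum>i<Suc m. (if i = m then mdiff (bs p) L else 0) * t ^ i)" by (simp add: mult.commute)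
      finally show ?thesis .
    qed
    from poly_coeff_unique[OF this, of m] show ?thesis by simp
  qed
  have "iter_lim zp zn m P (\<lambda>vs p. f p * mdiff (bs p @ vs) {0}) (\<lambda>p. f p * (fact m * a m p))"
    by (rule iter_lim_mult_bounded[OF _ al]) (use f in auto)
  then show ?thesis
    by (rule iter_lim_cong[rotated 2]) (auto simp: gd md am mdiff_append_commute)
qed

text \<open>Transforming the vectors by \<open>B p\<close> amounts to transforming \<open>K\<close>
  by the inverse, up to the determinant. The lower bound on \<open>B p\<close> keeps these bodies in
  one ball, so they form an admissible family; at the identity the limit is read off from the
  polynomial of \<open>K\<close> itself.\<close>

lemma mdiff_image_iter_lim:
  fixes K L :: "(real ^ 'n::{finite,wellorder}) set" and B :: "'p \<Rightarrow> real ^ 'n::_ ^ 'n::_"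
  assumes L: "cconvex L" "0 \<in> L" and ap: "\<And>r. zono_approx L (\<epsilon> r) (zp r) (zn r)" and \<epsilon>: "\<epsilon> \<longlonglongrightarrow> 0"
    and K: "cconvex K" and m: "m \<le> CARD('n)"
    and B: "\<And>p x. p \<in> P \<Longrightarrow> norm x \<le> 2 * norm (B p *v x)" "\<And>p. p \<in> P \<Longrightarrow> \<bar>det (B p)\<bar> \<le> D"
  shows "\<exists>\<Phi>. iter_lim zp zn m P (\<lambda>ws p. mdiff (map ((*v) (B p)) ws) K) \<Phi> \<and>
    (\<forall>p\<in>P. \<forall>\<alpha>. B p = mat 1 \<longrightarrow> (\<forall>t\<ge>0. measure lebesgue (K + (*\<^sub>R) t ` L) = (\<Sum>i<Suc (CARD('n)). \<alpha> i * t ^ i)) \<longrightarrow>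
      \<Phi> p = fact m * \<alpha> m)"
proof -
  have "\<exists>B'. B p ** B' = mat 1 \<and> B' ** B p = mat 1" if p: "p \<in> P" for p
  proof -
    have "x = 0" if "B p *v x = 0" for x using B(1)[OF p, of x] that by simp
    then have "invertible (B p)" using matrix_left_invertible_ker[of "B p"] invertible_left_inverse[of "B p"] by blast
    then show ?thesis unfolding invertible_def .
  qed
  then obtain B' where B': "\<And>p. p \<in> P \<Longrightarrow> B p ** B' p = mat 1" "\<And>p. p \<in> P \<Longrightarrow> B' p ** B p = mat 1" by metis
  define C where "C p = (*v) (B' p) ` K" for p
  have C: "cconvex (C p)" for p unfolding C_def by (intro cconvex_linear_image K) simp
  have "bounded K" using K by (simp add: cconvex_def compact_imp_bounded)
  then obtain r where r: "\<And>x. x \<in> K \<Longrightarrow> norm x \<le> r" unfolding bounded_iff by blast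
  have CR: "C p \<subseteq> cball 0 (2 * \<bar>r\<bar>)" if p: "p \<in> P" for p
  proof
    fix y assume "y \<in> C p"
    then obtain x where x: "x \<in> K" "y = B' p *v x" by (auto simp: C_def)
    have "norm y \<le> 2 * norm (B p *v y)" by (rule B(1)[OF p])
    also have "B p *v y = x" unfolding x matrix_vector_mul_assoc B'(1)[OF p] by simp
    finally show "y \<in> cball 0 (2 * \<bar>r\<bar>)" using r[OF x(1)] by simp
  qed
  have "\<exists>a. (\<forall>p\<in>P. \<forall>t\<ge>0. mdiff [] (C p + (*\<^sub>R) t ` L) = (\<Sum>i<Suc (CARD('n)). a i p * t ^ i)) \<and>
    (\<forall>i<Suc (CARD('n)). iter_lim zp zn i P (\<lambda>vs p. mdiff ([] @ vs) (C p)) (\<lambda>p. fact i * a i p))"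
    by (rule mdiff_polynomial_family[OF L ap \<epsilon>, where R = "2 * \<bar>r\<bar>"]) (use C CR in auto)
  then obtain a where a: "\<And>p t. p \<in> P \<Longrightarrow> t \<ge> 0 \<Longrightarrow> mdiff [] (C p + (*\<^sub>R) t ` L) = (\<Sum>i<Suc (CARD('n)). a i p * t ^ i)"
    and al: "iter_lim zp zn m P (\<lambda>vs p. mdiff vs (C p)) (\<lambda>p. fact m * a m p)" using m by (auto simp: less_Suc_eq_le)
  have "mdiff (map ((*v) (B p)) ws) K = \<bar>det (B p)\<bar> * mdiff ws (C p)" if p: "p \<in> P" for p ws
  proof -
    have "(*v) (B p) ` C p = K" unfolding C_def image_image matrix_vector_mul_assoc B'(1)[OF p] by simp
    then show ?thesis using mdiff_matrix_image[OF C, of "B p" ws p] by simp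
  qed
  moreover have "iter_lim zp zn m P (\<lambda>ws p. \<bar>det (B p)\<bar> * mdiff ws (C p)) (\<lambda>p. \<bar>det (B p)\<bar> * (fact m * a m p))"
    by (rule iter_lim_mult_bounded[OF _ al]) (use B(2) in auto)
  ultimately have "iter_lim zp zn m P (\<lambda>ws p. mdiff (map ((*v) (B p)) ws) K) (\<lambda>p. \<bar>det (B p)\<bar> * (fact m * a m p))"
    using iter_lim_cong[of m P "\<lambda>ws p. \<bar>det (B p)\<bar> * mdiff ws (C p)"] by simp
  moreover have "\<bar>det (B p)\<bar> * (fact m * a m p) = fact m * \<alpha> m"
    if p: "p \<in> P" and Bp: "B p = mat 1" and al: "\<And>t. t \<ge> 0 \<Longrightarrow> measure lebesgue (K + (*\<^sub>R) t ` L) = (\<Sum>i<Suc (CARD('n)). \<alpha> i * t ^ i)" for p \<alpha>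
  proof -
    have CK: "C p = K" using B'(2)[OF p] Bp unfolding C_def by simp
    have "a m p = \<alpha> m"
    proof (rule poly_coeff_unique[where a = "\<lambda>i. a i p" and b = \<alpha> and k = "Suc (CARD('n))"])
      fix t :: real assume "t > 0"
      then show "(\<Sum>i<Suc (CARD('n)). a i p * t ^ i) = (\<Sum>i<Suc (CARD('n)). \<alpha> i * t ^ i)"
        using a[OF p, of t] al[of t] unfolding CK mdiff.simps by simp
    qed (use m in simp)
    then show ?thesis using Bp by simp
  qed
  ultimately show ?thesis by (intro exI[of _ "\<lambda>p. \<bar>det (B p)\<bar> * (fact m * a m p)"]) auto
qed

text \<open>\<open>ws\<close> enters only through the scalar \<open>F\<close> and the orthogonal
  matrix \<open>R\<close>, which carries the last axes to a basis of the orthogonal complement of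
  \<open>ws\<close>. This is the source of finite rank.\<close>

lemma gdet_frame:
  fixes ws :: "(real ^ 'n::{finite,wellorder}) list"
  assumes ws: "length ws = m" and m: "m \<le> CARD('n)"
  shows "\<exists>F R. orthogonal_matrix R \<and>
    (\<forall>vs. length vs = m \<longrightarrow> gdet m vs ws = F * \<bar>det (mcols (map ((*v) (transpose R)) vs @ drop m axes))\<bar>)"
proof (cases "lin_dep ws")
  case True
  then show ?thesis using gdet_lin_dep[OF True ws m] orthogonal_matrix_id by (intro exI[of _ 0] exI[of _ "mat 1"]) auto
next
  case False
  obtain hs bs where hb: "length hs = length ws" "length bs = DIM(real ^ 'n::_) - length ws"
    "orthonormal_list (hs @ bs)" "span (set hs) = span (set ws)"
    using not_lin_dep_frame[OF False] by metis
  have lb: "length bs = CARD('n) - m" and lh: "length hs = m" using hb ws by auto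
  have obs: "orthonormal_list bs" using hb(3) by (simp add: orthonormal_list_append_iff)
  have orth: "inner w b = 0" if w: "w \<in> set ws" and b: "b \<in> set bs" for w b
  proof -
    have "w \<in> span (set hs)" using hb(4) w span_base by blast
    then show ?thesis
    proof (rule span_induct)
      show "subspace {h. inner h b = 0}" by (rule subspaceI) (auto simp: inner_add_left)
    qed (use hb(3) b in \<open>auto simp: orthonormal_list_append_iff\<close>)
  qed
  define R where "R = mcols (hs @ bs)"
  have lhb: "length (hs @ bs) = CARD('n)" using lh lb m by simp
  have oR: "orthogonal_matrix R" unfolding R_def by (rule orthogonal_mcols[OF hb(3) lhb])
  have RR: "R ** transpose R = mat 1" using oR by (simp add: orthogonal_matrix_def)
  have "map ((*v) R) (drop m axes) = drop m (map ((*v) R) axes)" by (simp add: drop_map)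
  also have "\<dots> = bs" unfolding R_def map_mcols_axes[OF lhb] using lh by simp
  finally have Rb: "map ((*v) R) (drop m axes) = bs" .
  have "gdet m vs ws = \<bar>det (mcols (ws @ bs))\<bar> * \<bar>det (mcols (map ((*v) (transpose R)) vs @ drop m axes))\<bar>" if vs: "length vs = m" for vs
  proof -
    have "map ((*v) R) (map ((*v) (transpose R)) vs) = map (\<lambda>v. (R ** transpose R) *v v) vs"
      by (simp add: matrix_vector_mul_assoc[symmetric])
    then have "map ((*v) R) (map ((*v) (transpose R)) vs @ drop m axes) = vs @ bs"
      unfolding map_append Rb RR by simp
    moreover have "mcols (map ((*v) R) (map ((*v) (transpose R)) vs @ drop m axes)) = R ** mcols (map ((*v) (transpose R)) vs @ drop m axes)"
      using vs m by (intro mcols_map) simp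
    ultimately have "\<bar>det (mcols (vs @ bs))\<bar> = \<bar>det (mcols (map ((*v) (transpose R)) vs @ drop m axes))\<bar>"
      using det_orthogonal_matrix[OF oR] by (auto simp: det_mul abs_mult)
    then show ?thesis using gdet_eq_det_mult[OF vs ws lb m obs orth] by simp
  qed
  then show ?thesis using oR by blast
qed

section \<open>Polynomials and integration on matrices\<close>

lemma linear_matrix_mult_right: "linear (\<lambda>A :: real ^ 'k ^ 'n. (R :: real ^ 'n ^ 'm) ** A)"
proof (rule linearI)
  show "R ** (A + B) = R ** A + R ** B" for A B :: "real ^ 'k ^ 'n" by (rule matrix_add_ldistrib)
  show "R ** (c *\<^sub>R A) = c *\<^sub>R (R ** A)" for c and A :: "real ^ 'k ^ 'n"
    by (simp add: vec_eq_iff matrix_matrix_mult_def sum_distrib_left mult_ac)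
qed

text \<open>A linear function of \<open>R ** A\<close> separates by expanding \<open>A\<close> in a
  basis; sums concatenate the lists and products multiply them out. The functions \<open>q\<close>
  are integrated later, hence the record of their continuity.\<close>

lemma real_polynomial_function_mult_separate:
  fixes k :: "real ^ 'n ^ 'n \<Rightarrow> real"
  assumes "real_polynomial_function k"
  shows "\<exists>xs. (\<forall>R A :: real ^ 'n ^ 'n. k (R ** A) = (\<Sum>(p, q)\<leftarrow>xs. p R * q A)) \<and> (\<forall>(p, q)\<in>set xs. continuous_on UNIV q)"
  using assms
proof (induction k rule: real_polynomial_function.induct)
  case (linear f)
  then have lin: "linear f" by (simp add: linear_conv_bounded_linear)
  obtain bs where bs: "set bs = (Basis :: (real ^ 'n ^ 'n) set)" "distinct bs" using finite_distinct_list[OF finite_Basis] by blast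
  have fe: "f (R ** A) = (\<Sum>b\<in>Basis. f (R ** b) * inner A b)" for R A :: "real ^ 'n ^ 'n"
  proof -
    have lR: "linear (\<lambda>A. R ** A)" by (rule linear_matrix_mult_right)
    have "f (R ** A) = f (R ** (\<Sum>b\<in>Basis. inner A b *\<^sub>R b))" by (simp only: euclidean_representation)
    also have "\<dots> = (\<Sum>b\<in>Basis. inner A b * f (R ** b))"
      by (simp add: linear_sum[OF lR] linear_cmul[OF lR] linear_sum[OF lin] linear_cmul[OF lin])
    finally show ?thesis by (simp add: mult.commute)
  qed
  show ?case
  proof (intro exI[of _ "map (\<lambda>b. (\<lambda>R. f (R ** b), \<lambda>A. inner A b)) bs"] conjI allI)
    fix R A :: "real ^ 'n ^ 'n"
    show "f (R ** A) = (\<Sum>(p, q)\<leftarrow>map (\<lambda>b. (\<lambda>R. f (R ** b), \<lambda>A. inner A b)) bs. p R * q A)"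
      unfolding fe[of R A] by (simp add: comp_def bs sum_list_distinct_conv_sum_set)
  qed (auto intro!: continuous_intros)
next
  case (const c)
  then show ?case by (intro exI[of _ "[(\<lambda>_. c, \<lambda>_. 1)]"]) auto
next
  case (add f g)
  then obtain xs ys where "\<forall>R A :: real ^ 'n ^ 'n. f (R ** A) = (\<Sum>(p, q)\<leftarrow>xs. p R * q A)" "\<forall>(p, q)\<in>set xs. continuous_on UNIV q"
    "\<forall>R A :: real ^ 'n ^ 'n. g (R ** A) = (\<Sum>(p, q)\<leftarrow>ys. p R * q A)" "\<forall>(p, q)\<in>set ys. continuous_on UNIV q" by blast
  then show ?case by (intro exI[of _ "xs @ ys"]) auto
next
  case (mult f g)
  then obtain xs ys where f: "\<forall>R A :: real ^ 'n ^ 'n. f (R ** A) = (\<Sum>(p, q)\<leftarrow>xs. p R * q A)" "\<forall>(p, q)\<in>set xs. continuous_on UNIV q"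
    and g: "\<forall>R A :: real ^ 'n ^ 'n. g (R ** A) = (\<Sum>(p, q)\<leftarrow>ys. p R * q A)" "\<forall>(p, q)\<in>set ys. continuous_on UNIV q" by blast
  define zs where "zs = concat (map (\<lambda>(p, q). map (\<lambda>(p', q'). (\<lambda>R. p R * p' R, \<lambda>A. q A * q' A)) ys) xs)"
  have one: "(\<Sum>(p, q)\<leftarrow>map (\<lambda>(p', q'). (\<lambda>R. pp R * p' R, \<lambda>A. qq A * q' A)) ys. p R * q A) =
      pp R * qq A * (\<Sum>(p, q)\<leftarrow>ys. p R * q A)" for pp qq R A
    by (induction ys) (auto simp: algebra_simps)
  have "(\<Sum>(p, q)\<leftarrow>zs. p R * q A) = (\<Sum>(p, q)\<leftarrow>xs. p R * q A) * (\<Sum>(p, q)\<leftarrow>ys. p R * q A)" for R A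
    unfolding zs_def
  proof (induction xs)
    case (Cons x xs)
    obtain pp qq where x: "x = (pp, qq)" by fastforce
    show ?case using Cons one[where pp = pp and qq = qq and R = R and A = A] by (simp add: x algebra_simps)
  qed simp
  moreover have "\<forall>(p, q)\<in>set zs. continuous_on UNIV q"
    using f(2) g(2) unfolding zs_def by (fastforce intro!: continuous_intros)
  ultimately show ?case using f(1) g(1) by (intro exI[of _ zs]) auto
qed

lemma continuous_on_det:
  fixes f :: "'a::topological_space \<Rightarrow> real ^ 'n ^ 'n"
  assumes "\<And>i j. continuous_on S (\<lambda>x. f x $ i $ j)"
  shows "continuous_on S (\<lambda>x. det (f x))"
  unfolding det_def by (intro continuous_intros assms)

lemma norm_matrix_vector_le:
  fixes A :: "real ^ 'n ^ 'm"
  shows "norm (A *v x) \<le> norm A * norm x"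
proof -
  have n2: "(norm v)\<^sup>2 = (\<Sum>i\<in>UNIV. (norm (v $ i))\<^sup>2)" for v :: "'b::real_normed_vector ^ 'm"
    unfolding norm_vec_def L2_set_def by (simp add: sum_nonneg)
  have "(norm (A *v x))\<^sup>2 = (\<Sum>i\<in>UNIV. (inner (A $ i) x)\<^sup>2)" unfolding n2 matrix_vector_mul_component by simp
  also have "\<dots> \<le> (\<Sum>i\<in>UNIV. (norm (A $ i))\<^sup>2 * (norm x)\<^sup>2)"
  proof (rule sum_mono)
    fix i show "(inner (A $ i) x)\<^sup>2 \<le> (norm (A $ i))\<^sup>2 * (norm x)\<^sup>2"
      using Cauchy_Schwarz_ineq2[of "A $ i" x] by (metis abs_ge_zero power2_abs power_mono power_mult_distrib)
  qed
  also have "\<dots> = (norm A * norm x)\<^sup>2" unfolding power_mult_distrib n2[of A] sum_distrib_right ..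
  finally show ?thesis by (rule power2_le_imp_le) simp
qed

lemma inner_transpose: "inner (transpose A) (transpose B) = inner A (B :: real ^ 'n ^ 'm)"
  unfolding inner_vec_def transpose_def by simp (rule sum.swap)

lemma norm_vector_matrix_le:
  fixes A :: "real ^ 'n ^ 'm"
  shows "norm (x v* A) \<le> norm A * norm x"
proof -
  have "norm (transpose A) = norm A" using inner_transpose[of A A] by (simp add: norm_eq_sqrt_inner)
  then show ?thesis using norm_matrix_vector_le[of "transpose A" x] by simp
qed

lemma orthogonal_matrix_mult_transformation:
  fixes R :: "real ^ 'n ^ 'n"
  assumes "orthogonal_matrix R"
  shows "orthogonal_transformation (\<lambda>A :: real ^ 'n ^ 'n. R ** A)"
proof -
  have oR: "orthogonal_transformation ((*v) R)"
    using assms by (simp add: orthogonal_transformation_matrix)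
  have cols: "inner A B = (\<Sum>j\<in>UNIV. inner (column j A) (column j B))" for A B :: "real ^ 'n ^ 'n"
    unfolding inner_vec_def column_def by simp (rule sum.swap)
  have "column j (R ** A) = R *v column j A" for j and A :: "real ^ 'n ^ 'n"
    by (simp add: column_def matrix_matrix_mult_def matrix_vector_mult_def vec_eq_iff)
  then have "inner (R ** A) (R ** B) = inner A B" for A B :: "real ^ 'n ^ 'n"
    unfolding cols using oR by (simp add: orthogonal_transformation_def)
  moreover have "linear (\<lambda>A :: real ^ 'n ^ 'n. R ** A)"
    by (rule linear_matrix_mult_right)
  ultimately show ?thesis by (simp add: orthogonal_transformation_def)
qed

lemma continuous_on_matrix_vector: "continuous_on S (\<lambda>A :: real ^ 'n ^ 'm. A *v x)"
  unfolding matrix_vector_mult_def by (intro continuous_intros)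

lemma continuous_on_vector_matrix: "continuous_on S (\<lambda>A :: real ^ 'n ^ 'm. x v* A)"
  unfolding vector_matrix_mult_def by (intro continuous_intros)

text \<open>Norm conditions alone describe the set, so it is stable under left multiplication by
  orthogonal matrices and contains all of them. It is compact, keeps \<open>A\<close> and its
  transpose uniformly invertible, and contains a ball around the identity, since a perturbation of
  norm below 1/2 shrinks no vector by more than half.\<close>

definition near_id :: "(real ^ 'n ^ 'n) set" where
  "near_id = {A. norm A \<le> norm (mat 1 :: real ^ 'n ^ 'n) + 1 \<and> (\<forall>x. norm x \<le> 2 * norm (A *v x)) \<and> (\<forall>x. norm x \<le> 2 * norm (x v* A))}"

lemma compact_near_id: "compact (near_id :: (real ^ 'n ^ 'n) set)"
proof -
  have "closed (near_id :: (real ^ 'n ^ 'n) set)"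
    unfolding near_id_def
    by (intro closed_Collect_conj closed_Collect_all closed_Collect_le continuous_intros
        continuous_on_matrix_vector continuous_on_vector_matrix)
  moreover have "bounded (near_id :: (real ^ 'n ^ 'n) set)"
    unfolding bounded_iff near_id_def by blast
  ultimately show ?thesis by (simp add: compact_eq_bounded_closed)
qed

lemma ball_subset_near_id: "ball (mat 1) (1/2) \<subseteq> (near_id :: (real ^ 'n ^ 'n) set)"
proof
  fix A :: "real ^ 'n ^ 'n" assume "A \<in> ball (mat 1) (1/2)"
  then have d: "norm (mat 1 - A) < 1/2" by (simp add: dist_norm)
  have "norm A \<le> norm (mat 1 :: real ^ 'n ^ 'n) + norm (mat 1 - A)" by norm
  then have 1: "norm A \<le> norm (mat 1 :: real ^ 'n ^ 'n) + 1" using d by simp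
  have 2: "norm x \<le> 2 * norm (A *v x)" for x
  proof -
    have "norm (x - A *v x) \<le> norm (mat 1 - A) * norm x"
      using norm_matrix_vector_le[of "mat 1 - A" x] by (simp add: matrix_vector_mult_diff_rdistrib)
    also have "\<dots> \<le> 1/2 * norm x" using d by (intro mult_right_mono) auto
    finally show ?thesis using norm_triangle_ineq2[of x "A *v x"] by simp
  qed
  have 3: "norm x \<le> 2 * norm (x v* A)" for x
  proof -
    have "norm (x - x v* A) \<le> norm (mat 1 - A) * norm x"
      using norm_vector_matrix_le[of x "mat 1 - A"] by (simp add: vector_matrix_mult_diff_rdistrib)
    also have "\<dots> \<le> 1/2 * norm x" using d by (intro mult_right_mono) auto
    finally show ?thesis using norm_triangle_ineq2[of x "x v* A"] by simp
  qed
  show "A \<in> near_id" using 1 2 3 by (simp add: near_id_def)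
qed

lemma orthogonal_mult_near_id:
  fixes R :: "real ^ 'n ^ 'n"
  assumes R: "orthogonal_matrix R"
  shows "R ** A \<in> near_id \<longleftrightarrow> A \<in> near_id"
proof -
  have imp: "S ** B \<in> near_id" if S: "orthogonal_matrix S" and B: "B \<in> near_id" for S B :: "real ^ 'n ^ 'n"
  proof -
    have nS: "norm (S *v x) = norm x" if "orthogonal_matrix S" for x and S :: "real ^ 'n ^ 'n"
    proof -
      have "orthogonal_transformation ((*v) S)" using that by (simp add: orthogonal_transformation_matrix)
      then show ?thesis by (simp add: orthogonal_transformation)
    qed
    have nt: "norm (x v* S) = norm x" for x
      using nS[of "transpose S" x] S by (simp add: orthogonal_matrix_transpose)
    have "norm (S ** B) = norm B"
      using orthogonal_matrix_mult_transformation[OF S] by (simp add: orthogonal_transformation)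
    moreover have "norm x \<le> 2 * norm ((S ** B) *v x)" for x
      using B nS[OF S] by (simp add: near_id_def matrix_vector_mul_assoc[symmetric])
    moreover have "norm x \<le> 2 * norm (x v* (S ** B))" for x
    proof -
      have "x v* (S ** B) = (x v* S) v* B"
        by (metis matrix_transpose_mul matrix_vector_mul_assoc transpose_matrix_vector)
      moreover have "norm (x v* S) \<le> 2 * norm ((x v* S) v* B)" using B by (simp add: near_id_def)
      ultimately show ?thesis using nt by simp
    qed
    ultimately show ?thesis using B by (simp add: near_id_def)
  qed
  have "transpose R ** (R ** A) = A" using R by (simp add: matrix_mul_assoc orthogonal_matrix)
  then show ?thesis using imp[OF R, of A] imp[of "transpose R" "R ** A"] R by (auto simp: orthogonal_matrix_transpose)
qed

lemma near_id_integral_orthogonal: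
  fixes R :: "real ^ 'n ^ 'n" and f :: "real ^ 'n ^ 'n \<Rightarrow> real"
  assumes R: "orthogonal_matrix R" and f: "f \<in> borel_measurable borel"
  shows "(LINT A:near_id|lborel. f A) = (LINT A:near_id|lborel. f (R ** A))"
proof -
  let ?g = "\<lambda>A. indicator near_id A *\<^sub>R f A"
  have nm: "near_id \<in> sets borel" using compact_near_id by (rule borel_compact)
  have o: "orthogonal_transformation (\<lambda>A :: real ^ 'n ^ 'n. R ** A)" by (rule orthogonal_matrix_mult_transformation[OF R])
  then have "linear (\<lambda>A :: real ^ 'n ^ 'n. R ** A)" by (simp add: orthogonal_transformation_def)
  then have Rm: "(\<lambda>A :: real ^ 'n ^ 'n. R ** A) \<in> borel_measurable borel"
    by (intro borel_measurable_continuous_onI linear_continuous_on) (simp add: linear_conv_bounded_linear)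
  have "(LINT A:near_id|lborel. f A) = (LINT A|distr lborel borel (\<lambda>A. R ** A). ?g A)"
    unfolding lborel_orthogonal_transformation[OF o] set_lebesgue_integral_def ..
  also have "\<dots> = (LINT A|lborel. ?g (R ** A))"
    using Rm f nm by (intro integral_distr borel_measurable_scaleR borel_measurable_indicator) auto
  also have "\<dots> = (LINT A:near_id|lborel. f (R ** A))"
    unfolding set_lebesgue_integral_def by (simp add: indicator_def orthogonal_mult_near_id[OF R])
  finally show ?thesis .
qed

lemma near_id_integrable:
  fixes f :: "real ^ 'n ^ 'n \<Rightarrow> real"
  assumes "continuous_on near_id f"
  shows "set_integrable lborel near_id f"
  unfolding set_integrable_def by (rule borel_integrable_compact[OF compact_near_id assms])

lemma continuous_on_gdet:
  "continuous_on S (\<lambda>A :: real ^ 'n ^ 'n. gdet m us (map (\<lambda>w. w v* A) ws))" if "length ws = m"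
proof -
  have "continuous_on S (\<lambda>A. det (gram m us (map (\<lambda>w. w v* A) ws)))"
  proof (rule continuous_on_det)
    fix i j :: 'n
    show "continuous_on S (\<lambda>A. gram m us (map (\<lambda>w. w v* A) ws) $ i $ j)"
      using that by (cases "idx i < m \<and> idx j < m") (auto simp: gram_def intro!: continuous_intros continuous_on_vector_matrix)
  qed
  then show ?thesis unfolding gdet_def by (intro continuous_intros)
qed

text \<open>Averaging over \<open>near_id\<close> against a polynomial makes the kernel finite-dimensional, because
  \<open>near_id\<close> is invariant under left multiplication by the orthogonal group, which acts transitively on
  orthonormal frames.\<close>

lemma averaged_gdet_finite_rank:
  fixes k :: "real ^ 'n::{finite,wellorder} ^ 'n::_ \<Rightarrow> real"
  assumes k: "real_polynomial_function k" and m: "m \<le> CARD('n)"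
  shows "\<exists>(N::nat) x y. \<forall>us ws. length us = m \<longrightarrow> length ws = m \<longrightarrow>
    (LINT A:near_id|lborel. k A * gdet m us (map (\<lambda>w. w v* A) ws)) = (\<Sum>a<N. x a us * y a ws)"
proof -
  obtain xs where xs: "\<And>R A :: real ^ 'n::_ ^ 'n::_. k (R ** A) = (\<Sum>(p, q)\<leftarrow>xs. p R * q A)" "\<And>p q. (p, q) \<in> set xs \<Longrightarrow> continuous_on UNIV q"
    using real_polynomial_function_mult_separate[OF k] by blast
  have "\<exists>F R. orthogonal_matrix R \<and>
    (\<forall>vs. length vs = m \<longrightarrow> gdet m vs ws = F * \<bar>det (mcols (map ((*v) (transpose R)) vs @ drop m axes))\<bar>)"
    if "length ws = m" for ws :: "(real ^ 'n::_) list" using gdet_frame[OF that m] .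
  then obtain F R where R: "\<And>ws :: (real ^ 'n::_) list. length ws = m \<Longrightarrow> orthogonal_matrix (R ws)"
    and F: "\<And>ws vs. length ws = m \<Longrightarrow> length vs = m \<Longrightarrow>
      gdet m vs ws = F ws * \<bar>det (mcols (map ((*v) (transpose (R ws))) vs @ drop m axes))\<bar>" by metis
  define h where "h us A = \<bar>det (mcols (map ((*v) A) us @ drop m axes))\<bar>" for us and A :: "real ^ 'n::_ ^ 'n::_"
  have hc: "continuous_on UNIV (h us)" if "length us = m" for us
    unfolding h_def
  proof (rule continuous_on_rabs, rule continuous_on_det)
    fix i j
    show "continuous_on UNIV (\<lambda>A. mcols (map ((*v) A) us @ drop m axes) $ i $ j)"
      using that by (cases "idx j < m") (auto simp: mcols_def nth_append intro!: continuous_intros continuous_on_matrix_vector)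
  qed
  have kc: "continuous_on UNIV k" using continuous_real_polymonial_function[OF k] by (simp add: continuous_on_eq_continuous_at)
  define x where "x a us = (LINT A:near_id|lborel. snd (xs ! a) A * h us A)" for a us
  define y where "y a ws = F ws * fst (xs ! a) (R ws)" for a ws
  have "(LINT A:near_id|lborel. k A * gdet m us (map (\<lambda>w. w v* A) ws)) = (\<Sum>a<length xs. x a us * y a ws)"
    if us: "length us = m" and ws: "length ws = m" for us ws
  proof -
    have "gdet m us (map (\<lambda>w. w v* A) ws) = F ws * h us (transpose (R ws) ** A)" for A
    proof -
      have "gdet m us (map (\<lambda>w. w v* A) ws) = gdet m (map ((*v) A) us) ws" using gdet_adjoint[OF us ws] by simp
      also have "\<dots> = F ws * \<bar>det (mcols (map ((*v) (transpose (R ws))) (map ((*v) A) us) @ drop m axes))\<bar>"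
        using us ws by (intro F) auto
      also have "map ((*v) (transpose (R ws))) (map ((*v) A) us) = map ((*v) (transpose (R ws) ** A)) us"
        unfolding map_map comp_def matrix_vector_mul_assoc ..
      finally show ?thesis by (simp add: h_def)
    qed
    then have "(LINT A:near_id|lborel. k A * gdet m us (map (\<lambda>w. w v* A) ws)) =
        (LINT A:near_id|lborel. k A * (F ws * h us (transpose (R ws) ** A)))" by simp
    \<comment> \<open>Substituting \<open>R ws ** A\<close> for \<open>A\<close> takes
      \<open>ws\<close> out of the determinant and into the polynomial, where it separates.\<close>
    also have "\<dots> = (LINT A:near_id|lborel. k (R ws ** A) * (F ws * h us (transpose (R ws) ** (R ws ** A))))"
    proof (rule near_id_integral_orthogonal[OF R[OF ws]])
      have "continuous_on UNIV (\<lambda>A. transpose (R ws) ** A)"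
        by (intro linear_continuous_on) (simp add: linear_conv_bounded_linear[symmetric] linear_matrix_mult_right)
      then have "continuous_on UNIV (\<lambda>A. h us (transpose (R ws) ** A))"
        using continuous_on_compose2[OF hc[OF us]] by blast
      then show "(\<lambda>A. k A * (F ws * h us (transpose (R ws) ** A))) \<in> borel_measurable borel"
        using kc by (intro borel_measurable_continuous_onI continuous_intros)
    qed
    also have "\<dots> = (LINT A:near_id|lborel. \<Sum>a<length xs. y a ws * (snd (xs ! a) A * h us A))"
    proof -
      have "k (R ws ** A) * (F ws * h us (transpose (R ws) ** (R ws ** A))) = (\<Sum>a<length xs. y a ws * (snd (xs ! a) A * h us A))" for A
      proof -
        have "transpose (R ws) ** (R ws ** A) = A" using R[OF ws] by (simp add: matrix_mul_assoc orthogonal_matrix)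
        moreover have "k (R ws ** A) = (\<Sum>a<length xs. fst (xs ! a) (R ws) * snd (xs ! a) A)"
          unfolding xs(1) by (simp add: sum_list_sum_nth lessThan_atLeast0 case_prod_unfold)
        ultimately show ?thesis by (simp add: y_def sum_distrib_left sum_distrib_right mult_ac)
      qed
      then show ?thesis by simp
    qed
    also have "\<dots> = (\<Sum>a<length xs. LINT A:near_id|lborel. y a ws * (snd (xs ! a) A * h us A))"
      unfolding set_lebesgue_integral_def scaleR_sum_right
    proof (rule Bochner_Integration.integral_sum)
      fix a assume "a \<in> {..<length xs}"
      then have "continuous_on UNIV (snd (xs ! a))" using xs(2)[of "fst (xs ! a)" "snd (xs ! a)"] by simp
      then show "integrable lborel (\<lambda>A. indicator near_id A *\<^sub>R (y a ws * (snd (xs ! a) A * h us A)))"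
        unfolding set_integrable_def[symmetric] using hc[OF us] by (intro near_id_integrable continuous_intros) (auto intro: continuous_on_subset)
    qed
    also have "\<dots> = (\<Sum>a<length xs. x a us * y a ws)" by (simp add: x_def mult.commute)
    finally show ?thesis .
  qed
  then show ?thesis by blast
qed

lemma zono_approx_sequence:
  fixes L :: "'a::euclidean_space set"
  assumes L: "cconvex L" "L \<noteq> {}" "\<And>x. x \<in> L \<Longrightarrow> - x \<in> L"
  obtains \<epsilon> zp zn where "\<And>r. zono_approx L (\<epsilon> r) (zp r) (zn r)" "\<epsilon> \<longlonglongrightarrow> 0" "0 \<in> L"
proof -
  obtain x where x: "x \<in> L" using L(2) by blast
  have "(1/2) *\<^sub>R x + (1/2) *\<^sub>R (- x) \<in> L"
    using L(1) x L(3)[OF x] unfolding cconvex_def by (intro convexD) auto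
  then have 0: "0 \<in> L" by simp
  have "\<exists>z. zono_approx L (1 / real (Suc r)) (fst z) (snd z)" for r
    using symmetric_zono_approx[OF L, of "1 / real (Suc r)"] by auto
  then obtain z where z: "\<And>r. zono_approx L (1 / real (Suc r)) (fst (z r)) (snd (z r))" by metis
  have "(\<lambda>r. 1 / real (Suc r)) \<longlonglongrightarrow> 0" using LIMSEQ_inverse_real_of_nat by (simp add: inverse_eq_divide)
  then show ?thesis using that[of "\<lambda>r. 1 / real (Suc r)" "\<lambda>r. fst (z r)" "\<lambda>r. snd (z r)"] z 0 by blast
qed

text \<open>Approximating \<open>d\<close> itself by polynomials shows that the integral of its
  square is zero, so \<open>d\<close> vanishes almost everywhere; continuity at the interior point
  \<open>mat 1\<close> gives the value there.\<close>

lemma continuous_eq_of_polynomial_moments: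
  fixes d :: "real ^ 'n ^ 'n \<Rightarrow> real"
  assumes d: "continuous_on near_id d"
    and mom: "\<And>k. real_polynomial_function k \<Longrightarrow> (LINT A:near_id|lborel. k A * d A) = 0"
  shows "d (mat 1) = 0"
proof -
  have abs_int: "set_integrable lborel near_id (\<lambda>A. \<bar>d A\<bar>)" and sq_int: "set_integrable lborel near_id (\<lambda>A. d A * d A)"
    by (intro near_id_integrable continuous_intros d)+
  define I where "I = (LINT A:near_id|lborel. \<bar>d A\<bar>)"
  have I0: "I \<ge> 0" unfolding I_def set_lebesgue_integral_def by (intro integral_nonneg_AE) auto
  have le: "(LINT A:near_id|lborel. d A * d A) \<le> e * I" if e: "e > 0" for e
  proof -
    obtain k where k: "real_polynomial_function k" "\<And>A. A \<in> near_id \<Longrightarrow> \<bar>d A - k A\<bar> < e"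
      using Stone_Weierstrass_real_polynomial_function[OF compact_near_id d e] by blast
    have kc: "continuous_on near_id k"
      using continuous_real_polymonial_function[OF k(1)] by (simp add: continuous_at_imp_continuous_on)
    have ki: "set_integrable lborel near_id (\<lambda>A. k A * d A)" by (intro near_id_integrable continuous_intros d kc)
    have "(LINT A:near_id|lborel. d A * d A) = (LINT A:near_id|lborel. d A * d A - k A * d A)"
      using set_integral_diff(2)[OF sq_int ki] mom[OF k(1)] by simp
    also have "\<dots> \<le> (LINT A:near_id|lborel. e * \<bar>d A\<bar>)"
    proof (rule set_integral_mono)
      show "set_integrable lborel near_id (\<lambda>A. d A * d A - k A * d A)" by (rule set_integral_diff(1)[OF sq_int ki])
      show "set_integrable lborel near_id (\<lambda>A. e * \<bar>d A\<bar>)" using abs_int by simp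
      fix A :: "real ^ 'n ^ 'n" assume A: "A \<in> near_id"
      have "d A * d A - k A * d A \<le> \<bar>d A - k A\<bar> * \<bar>d A\<bar>" by (simp flip: abs_mult left_diff_distrib)
      also have "\<dots> \<le> e * \<bar>d A\<bar>" using k(2)[OF A] by (intro mult_right_mono) auto
      finally show "d A * d A - k A * d A \<le> e * \<bar>d A\<bar>" .
    qed
    also have "\<dots> = e * I" by (simp add: I_def)
    finally show ?thesis .
  qed
  have "(LINT A:near_id|lborel. d A * d A) \<le> 0"
  proof (rule field_le_epsilon)
    fix e :: real assume e: "e > 0"
    have "(LINT A:near_id|lborel. d A * d A) \<le> e / (I + 1) * I" using e I0 by (intro le) simp
    also have "\<dots> \<le> e / (I + 1) * (I + 1)" using e I0 by (intro mult_left_mono) auto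
    also have "\<dots> = e" using I0 by simp
    finally show "(LINT A:near_id|lborel. d A * d A) \<le> 0 + e" by simp
  qed
  moreover have "(LINT A:near_id|lborel. d A * d A) \<ge> 0"
    unfolding set_lebesgue_integral_def by (intro integral_nonneg_AE) auto
  ultimately have "(LINT A:near_id|lborel. d A * d A) = 0" by simp
  then have ae: "AE A in lborel. indicator near_id A *\<^sub>R (d A * d A) = 0"
    using integral_nonneg_eq_0_iff_AE[of lborel "\<lambda>A. indicator near_id A *\<^sub>R (d A * d A)"] sq_int
    unfolding set_lebesgue_integral_def set_integrable_def by auto
  show ?thesis
  proof (rule ccontr)
    assume nz: "d (mat 1) \<noteq> 0"
    let ?B = "ball (mat 1) (1/2) :: (real ^ 'n ^ 'n) set"
    have "continuous_on ?B d" by (rule continuous_on_subset[OF d ball_subset_near_id])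
    then have "continuous (at (mat 1)) d"
      by (metis centre_in_ball continuous_on_eq_continuous_at half_gt_zero_iff open_ball zero_less_one)
    then obtain r where r: "r > 0" "\<And>A. dist (mat 1) A < r \<Longrightarrow> d A \<noteq> 0"
      using continuous_at_avoid[of "mat 1" d 0] nz by blast
    let ?C = "ball (mat 1) (min r (1/2)) :: (real ^ 'n ^ 'n) set"
    from ae have "AE A in lborel. A \<in> - ?C"
    proof eventually_elim
      case (elim A)
      show ?case
      proof
        assume A: "A \<in> ?C"
        then have "A \<in> near_id" using ball_subset_near_id by auto
        then show False using elim r(2)[of A] A by simp
      qed
    qed
    then have "emeasure lborel ?C = 0" by (subst (asm) AE_iff_measurable[of ?C]) auto
    moreover have "unit_ball_vol (real CARD('n) * real CARD('n)) > 0" by (rule unit_ball_vol_pos) simp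
    then have "unit_ball_vol (real CARD('n) * real CARD('n)) \<noteq> 0" by linarith
    ultimately show False using r(1) by (simp add: emeasure_ball min_def split: if_splits)
  qed
qed

text \<open>Both coefficients come from one kernel: \<alpha> by letting \<open>us\<close>
  approximate \<open>L1\<close> first and \<open>ws\<close> approximate \<open>K2\<close>
  afterwards, \<beta> by the reverse order. Each inner limit gives a factor \<open>fact m\<close>
  through a projection hypothesis, each outer limit another through the Minkowski polynomial, so the
  factors agree.\<close>

theorem mixed_coefficient_duality:
  fixes K1 K2 L1 L2 :: "(real ^ 'n::{finite,wellorder}) set"
  assumes cc: "cconvex K1" "cconvex K2" "cconvex L1" "cconvex L2"
    and K2: "K2 \<noteq> {}" "\<And>x. x \<in> K2 \<Longrightarrow> - x \<in> K2" and L1: "L1 \<noteq> {}" "\<And>x. x \<in> L1 \<Longrightarrow> - x \<in> L1"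
    and m: "m \<le> CARD('n)"
    and dual1: "\<And>us bs. length us = m \<Longrightarrow> length bs = CARD('n) - m \<Longrightarrow> orthonormal_list (us @ bs) \<Longrightarrow> mdiff us K1 = mdiff bs L1"
    and dual2: "\<And>us bs. length us = m \<Longrightarrow> length bs = CARD('n) - m \<Longrightarrow> orthonormal_list (us @ bs) \<Longrightarrow> mdiff us L2 = mdiff bs K2"
    and \<alpha>: "\<And>t. t \<ge> 0 \<Longrightarrow> measure lebesgue (K1 + (*\<^sub>R) t ` K2) = (\<Sum>i<Suc (CARD('n)). \<alpha> i * t ^ i)"
    and \<beta>: "\<And>t. t \<ge> 0 \<Longrightarrow> measure lebesgue (L2 + (*\<^sub>R) t ` L1) = (\<Sum>i<Suc (CARD('n)). \<beta> i * t ^ i)"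
  shows "\<alpha> m = \<beta> m"
proof -
  let ?W = "near_id :: (real ^ 'n::_ ^ 'n::_) set"
  obtain \<epsilon> zp zn where L1z: "\<And>r. zono_approx L1 (\<epsilon> r) (zp r) (zn r)" "\<epsilon> \<longlonglongrightarrow> 0" "0 \<in> L1"
    using zono_approx_sequence[OF cc(3) L1] by blast
  obtain \<epsilon>' zp' zn' where K2z: "\<And>r. zono_approx K2 (\<epsilon>' r) (zp' r) (zn' r)" "\<epsilon>' \<longlonglongrightarrow> 0" "0 \<in> K2"
    using zono_approx_sequence[OF cc(2) K2] by blast
  obtain r where r: "\<And>A. A \<in> ?W \<Longrightarrow> norm A \<le> r"
    using compact_imp_bounded[OF compact_near_id] unfolding bounded_iff by blast
  obtain D where D: "\<And>A. A \<in> ?W \<Longrightarrow> \<bar>det A\<bar> \<le> D"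
  proof -
    have "continuous_on ?W det" by (intro continuous_on_det continuous_intros)
    then have "bounded (det ` ?W)" using compact_near_id compact_continuous_image compact_imp_bounded by blast
    then show ?thesis using that unfolding bounded_iff by auto
  qed
  \<comment> \<open>A bound on the transformed vectors that is uniform over
    \<open>near_id\<close>.\<close>
  define M where "M ws = r * (\<Sum>w\<leftarrow>ws. norm w)" for ws :: "(real ^ 'n::_) list"
  have M: "norm A * norm w \<le> M ws" if "A \<in> ?W" "w \<in> set ws" for A w ws
  proof -
    have "norm w \<le> (\<Sum>w\<leftarrow>ws. norm w)" using that(2) by (intro member_le_sum_list) auto
    then show ?thesis unfolding M_def using r[OF that(1)] by (intro mult_mono) (auto intro: order_trans[OF norm_ge_zero])
  qed
  have g1: "iter_lim zp zn m ?W (\<lambda>us A. gdet m us (map (\<lambda>w. w v* A) ws)) (\<lambda>A. fact m * mdiff (map (\<lambda>w. w v* A) ws) K1)"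
    if "length ws = m" for ws
  proof (rule gdet_iter_lim[OF cc(3) L1z(3,1,2) cc(1) m dual1])
    show "length (map (\<lambda>w. w v* A) ws) = m" for A :: "real ^ 'n::_ ^ 'n::_" using that by simp
    show "norm w \<le> M ws" if A: "A \<in> ?W" and w: "w \<in> set (map (\<lambda>w. w v* A) ws)" for A w
      using w M[OF A] norm_vector_matrix_le[of _ A] by (auto intro: order_trans)
  qed
  have g2: "iter_lim zp' zn' m ?W (\<lambda>ws A. gdet m ws (map ((*v) A) us)) (\<lambda>A. fact m * mdiff (map ((*v) A) us) L2)"
    if "length us = m" for us
  proof (rule gdet_iter_lim[OF cc(2) K2z(3,1,2) cc(4) m dual2])
    show "length (map ((*v) A) us) = m" for A :: "real ^ 'n::_ ^ 'n::_" using that by simp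
    show "norm w \<le> M us" if A: "A \<in> ?W" and w: "w \<in> set (map ((*v) A) us)" for A w
      using w M[OF A] norm_matrix_vector_le[of A] by (auto intro: order_trans)
  qed
  \<comment> \<open>The kernel becomes that of \<open>g1\<close>: the adjoint moves \<open>A\<close>
    to the other argument, and \<open>gdet\<close> is symmetric.\<close>
  have g2': "iter_lim zp' zn' m ?W (\<lambda>ws A. gdet m us (map (\<lambda>w. w v* A) ws)) (\<lambda>A. fact m * mdiff (map ((*v) A) us) L2)"
    if us: "length us = m" for us
    by (rule iter_lim_cong[OF _ _ g2[OF us]]) (use us gdet_adjoint gdet_commute in metis)+
  have "\<exists>\<Phi>. iter_lim zp' zn' m ?W (\<lambda>ws A. mdiff (map ((*v) (transpose A)) ws) K1) \<Phi> \<and>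
    (\<forall>A\<in>?W. \<forall>\<alpha>. transpose A = mat 1 \<longrightarrow> (\<forall>t\<ge>0. measure lebesgue (K1 + (*\<^sub>R) t ` K2) = (\<Sum>i<Suc (CARD('n)). \<alpha> i * t ^ i)) \<longrightarrow>
      \<Phi> A = fact m * \<alpha> m)"
    by (rule mdiff_image_iter_lim[OF cc(2) K2z(3,1,2) cc(1) m, where D = D]) (auto simp: near_id_def det_transpose intro: D[unfolded near_id_def])
  then obtain \<Phi> where \<Phi>0: "iter_lim zp' zn' m ?W (\<lambda>ws A. mdiff (map ((*v) (transpose A)) ws) K1) \<Phi>"
    and \<Phi>1: "\<And>A \<alpha>. A \<in> ?W \<Longrightarrow> transpose A = mat 1 \<Longrightarrow>
      (\<forall>t\<ge>0. measure lebesgue (K1 + (*\<^sub>R) t ` K2) = (\<Sum>i<Suc (CARD('n)). \<alpha> i * t ^ i)) \<Longrightarrow> \<Phi> A = fact m * \<alpha> m" by blast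
  have "(*v) (transpose A) = (\<lambda>w. w v* A)" for A :: "real ^ 'n::_ ^ 'n::_" by (simp add: fun_eq_iff)
  then have \<Phi>: "iter_lim zp' zn' m ?W (\<lambda>ws A. mdiff (map (\<lambda>w. w v* A) ws) K1) \<Phi>" using \<Phi>0 by simp
  have "\<exists>\<Psi>. iter_lim zp zn m ?W (\<lambda>us A. mdiff (map ((*v) A) us) L2) \<Psi> \<and>
    (\<forall>A\<in>?W. \<forall>\<beta>. A = mat 1 \<longrightarrow> (\<forall>t\<ge>0. measure lebesgue (L2 + (*\<^sub>R) t ` L1) = (\<Sum>i<Suc (CARD('n)). \<beta> i * t ^ i)) \<longrightarrow>
      \<Psi> A = fact m * \<beta> m)"
    by (rule mdiff_image_iter_lim[OF cc(3) L1z(3,1,2) cc(4) m, where D = D]) (auto simp: near_id_def intro: D[unfolded near_id_def])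
  then obtain \<Psi> where \<Psi>: "iter_lim zp zn m ?W (\<lambda>us A. mdiff (map ((*v) A) us) L2) \<Psi>"
    and \<Psi>1: "\<And>A \<beta>. A \<in> ?W \<Longrightarrow> A = mat 1 \<Longrightarrow>
      (\<forall>t\<ge>0. measure lebesgue (L2 + (*\<^sub>R) t ` L1) = (\<Sum>i<Suc (CARD('n)). \<beta> i * t ^ i)) \<Longrightarrow> \<Psi> A = fact m * \<beta> m" by blast
  have one: "mat 1 \<in> ?W" using ball_subset_near_id centre_in_ball by fastforce
  have c1: "continuous_on ?W (\<lambda>A. fact m * mdiff (map (\<lambda>w. w v* A) ws) K1)" if "length ws = m" for ws
    by (rule iter_lim_continuous[OF _ g1[OF that]]) (rule continuous_on_gdet[OF that])
  have c2: "continuous_on ?W (\<lambda>A. fact m * mdiff (map ((*v) A) us) L2)" if "length us = m" for us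
    by (rule iter_lim_continuous[OF _ g2'[OF that]]) (rule continuous_on_gdet)
  have \<Phi>f: "iter_lim zp' zn' m ?W (\<lambda>ws A. fact m * mdiff (map (\<lambda>w. w v* A) ws) K1) (\<lambda>A. fact m * \<Phi> A)"
    by (rule iter_lim_mult_bounded[OF _ \<Phi>, of _ "fact m"]) simp
  have \<Psi>f: "iter_lim zp zn m ?W (\<lambda>us A. fact m * mdiff (map ((*v) A) us) L2) (\<lambda>A. fact m * \<Psi> A)"
    by (rule iter_lim_mult_bounded[OF _ \<Psi>, of _ "fact m"]) simp
  have c\<Phi>: "continuous_on ?W (\<lambda>A. fact m * \<Phi> A)" by (rule iter_lim_continuous[OF c1 \<Phi>f])
  have c\<Psi>: "continuous_on ?W (\<lambda>A. fact m * \<Psi> A)" by (rule iter_lim_continuous[OF c2 \<Psi>f])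
  have "fact m * \<Phi> (mat 1) - fact m * \<Psi> (mat 1) = 0"
  proof (rule continuous_eq_of_polynomial_moments)
    show "continuous_on ?W (\<lambda>A. fact m * \<Phi> A - fact m * \<Psi> A)" by (intro continuous_intros c\<Phi> c\<Psi>)
    fix k :: "real ^ 'n::_ ^ 'n::_ \<Rightarrow> real" assume k: "real_polynomial_function k"
    have kc: "continuous_on ?W k"
      using continuous_real_polymonial_function[OF k] by (simp add: continuous_at_imp_continuous_on)
    \<comment> \<open>\<open>T\<close> passes through every stage of both iterated limits; after it
      the kernel has finite rank and the limits commute.\<close>
    define T where "T f = (LINT A:?W|lborel. k A * f A)" for f
    have int: "set_integrable lborel ?W (\<lambda>A. k A * f A)" if "continuous_on ?W f" for f
      by (intro near_id_integrable continuous_intros kc that)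
    have Tdiff: "T (\<lambda>A. f A - g A) = T f - T g" if "continuous_on ?W f" "continuous_on ?W g" for f g
      unfolding T_def right_diff_distrib by (rule set_integral_diff(2)[OF int int]) (rule that)+
    define B where "B = (LINT A:?W|lborel. \<bar>k A\<bar>)"
    have Tbd: "\<bar>T f\<bar> \<le> B * e" if f: "continuous_on ?W f" and e: "\<And>A. A \<in> ?W \<Longrightarrow> \<bar>f A\<bar> \<le> e" for f e
    proof -
      have "\<bar>T f\<bar> \<le> (LINT A:?W|lborel. \<bar>k A * f A\<bar>)"
        unfolding T_def set_lebesgue_integral_def
        using integral_abs_bound[of lborel "\<lambda>A. indicator ?W A *\<^sub>R (k A * f A)"] by (simp add: abs_mult)
      also have "\<dots> \<le> (LINT A:?W|lborel. \<bar>k A\<bar> * e)"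
        by (intro set_integral_mono near_id_integrable continuous_intros kc f) (use e in \<open>auto simp: abs_mult intro!: mult_left_mono\<close>)
      also have "\<dots> = B * e" by (simp add: B_def)
      finally show ?thesis .
    qed
    note functional = iter_lim_functional[where T = T and P = ?W and B = B, OF Tdiff Tbd]
    obtain N :: nat and x y where rank: "\<And>us ws. length us = m \<Longrightarrow> length ws = m \<Longrightarrow>
        T (\<lambda>A. gdet m us (map (\<lambda>w. w v* A) ws)) = (\<Sum>a<N. x a us * y a ws)"
      using averaged_gdet_finite_rank[OF k m] unfolding T_def by blast
    have "T (\<lambda>A. fact m * \<Phi> A) = T (\<lambda>A. fact m * \<Psi> A)"
    proof (rule iter_lim_interchange[where m = m and I = "{..<N}" and x = x and y = y
          and \<kappa> = "\<lambda>us ws. T (\<lambda>A. gdet m us (map (\<lambda>w. w v* A) ws))"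
          and \<alpha> = "\<lambda>ws. T (\<lambda>A. fact m * mdiff (map (\<lambda>w. w v* A) ws) K1)"
          and \<beta> = "\<lambda>us. T (\<lambda>A. fact m * mdiff (map ((*v) A) us) L2)"
          and zp = zp and zn = zn and zp' = zp' and zn' = zn'])
      show "finite {..<N}" by simp
      show "T (\<lambda>A. gdet m us (map (\<lambda>w. w v* A) ws)) = (\<Sum>a<N. x a us * y a ws)" if "length us = m" "length ws = m" for us ws
        using rank[OF that] .
      show "iter_lim zp zn m (UNIV :: unit set) (\<lambda>us _. T (\<lambda>A. gdet m us (map (\<lambda>w. w v* A) ws)))
          (\<lambda>_. T (\<lambda>A. fact m * mdiff (map (\<lambda>w. w v* A) ws) K1))" if "length ws = m" for ws
        by (rule functional[OF _ _ _ _ continuous_on_gdet[OF that] g1[OF that]])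
      show "iter_lim zp' zn' m (UNIV :: unit set) (\<lambda>ws _. T (\<lambda>A. gdet m us (map (\<lambda>w. w v* A) ws)))
          (\<lambda>_. T (\<lambda>A. fact m * mdiff (map ((*v) A) us) L2))" if "length us = m" for us
        by (rule functional[OF _ _ _ _ continuous_on_gdet g2'[OF that]])
      show "iter_lim zp' zn' m (UNIV :: unit set) (\<lambda>ws _. T (\<lambda>A. fact m * mdiff (map (\<lambda>w. w v* A) ws) K1)) (\<lambda>_. T (\<lambda>A. fact m * \<Phi> A))"
        by (rule functional[OF _ _ _ _ c1 \<Phi>f])
      show "iter_lim zp zn m (UNIV :: unit set) (\<lambda>us _. T (\<lambda>A. fact m * mdiff (map ((*v) A) us) L2)) (\<lambda>_. T (\<lambda>A. fact m * \<Psi> A))"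
        by (rule functional[OF _ _ _ _ c2 \<Psi>f])
    qed
    then show "(LINT A:?W|lborel. k A * (fact m * \<Phi> A - fact m * \<Psi> A)) = 0"
      using Tdiff[OF c\<Phi> c\<Psi>] by (simp add: T_def)
  qed
  moreover have "\<Phi> (mat 1) = fact m * \<alpha> m" using \<Phi>1[OF one _, of \<alpha>] \<alpha> by (simp add: transpose_mat)
  moreover have "\<Psi> (mat 1) = fact m * \<beta> m" using \<Psi>1[OF one _, of \<beta>] \<beta> by simp
  ultimately show ?thesis by simp
qed

section \<open>Mixed volumes\<close>

text \<open>The change of variables formula \<open>measure_linear_image\<close> is only available on \<open>real ^ 'n\<close> with a well-ordered
index type, so an arbitrary Euclidean space is transported to \<open>real ^ 'a basis_index\<close>.\<close>

typedef (overloaded) ('a::euclidean_space) basis_index = "{..<DIM('a)}"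
  by (rule exI[of _ 0]) simp

instantiation basis_index :: (euclidean_space) linorder
begin

definition "x \<le> y \<longleftrightarrow> Rep_basis_index x \<le> Rep_basis_index y"
definition "x < y \<longleftrightarrow> Rep_basis_index x < Rep_basis_index y"

instance
  by standard (auto simp: less_eq_basis_index_def less_basis_index_def Rep_basis_index_inject)

end

instance basis_index :: (euclidean_space) wellorder
proof
  fix P :: "'a basis_index \<Rightarrow> bool" and a :: "'a basis_index"
  assume step: "\<And>x. (\<And>y. y < x \<Longrightarrow> P y) \<Longrightarrow> P x"
  show "P a"
    by (induction a rule: measure_induct_rule[where f = Rep_basis_index]) (auto intro: step simp: less_basis_index_def)
qed

instance basis_index :: (euclidean_space) finite
proof
  have eq: "(UNIV :: 'a basis_index set) = Abs_basis_index ` {..<DIM('a)}"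
    by (rule type_definition.univ[OF type_definition_basis_index])
  show "finite (UNIV :: 'a basis_index set)" unfolding eq by (intro finite_imageI finite_lessThan)
qed

lemma CARD_basis_index: "CARD(('a::euclidean_space) basis_index) = DIM('a)"
proof -
  have "card (UNIV :: 'a basis_index set) = card {..<DIM('a)}"
    by (rule type_definition.card[OF type_definition_basis_index])
  then show ?thesis by simp
qed

lemma lborel_isometry:
  fixes f :: "'a::euclidean_space \<Rightarrow> 'b::euclidean_space"
  assumes lin: "linear f" and inn: "\<And>x y. inner (f x) (f y) = inner x y" and dim: "DIM('b) = DIM('a)"
  shows "distr lborel borel f = lborel"
proof -
  obtain b :: "nat \<Rightarrow> 'a" where b: "bij_betw b {..<DIM('a)} Basis"
    using ex_bij_betw_nat_finite[of "Basis :: 'a set"] by (auto simp: lessThan_atLeast0)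
  have fm: "f \<in> borel_measurable borel"
    using lin by (intro borel_measurable_continuous_onI linear_continuous_on) (simp add: linear_conv_bounded_linear)
  have on: "inner (f (b i)) (f (b j)) = (if i = j then 1 else 0)" if "i < DIM('b)" "j < DIM('b)" for i j
    unfolding inn using that bij_betwE[OF b] bij_betw_imp_inj_on[OF b] unfolding dim by (auto simp: inner_Basis inj_on_eq_iff)
  have "distr lborel borel f = distr (distr (PiM {..<DIM('a)} (\<lambda>_. lborel)) borel (\<lambda>g. \<Sum>i<DIM('a). g i *\<^sub>R b i)) borel f"
    using lborel_eq_distr_PiM_Basis[OF _ b] by simp
  also have "\<dots> = distr (PiM {..<DIM('a)} (\<lambda>_. lborel)) borel (f \<circ> (\<lambda>g. \<Sum>i<DIM('a). g i *\<^sub>R b i))"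
    by (rule distr_distr[OF fm]) measurable
  also have "f \<circ> (\<lambda>g. \<Sum>i<DIM('a). g i *\<^sub>R b i) = (\<lambda>g. \<Sum>i<DIM('b). g i *\<^sub>R f (b i))"
    by (simp add: fun_eq_iff linear_sum[OF lin] linear_cmul[OF lin] dim)
  also have "distr (PiM {..<DIM('a)} (\<lambda>_. lborel)) borel \<dots> = lborel"
    using lborel_eq_distr_PiM_orthonormal[of "\<lambda>i. f (b i)", OF on] unfolding dim by simp
  finally show ?thesis .
qed

lemma mdiff_isometry:
  fixes f :: "'a::euclidean_space \<Rightarrow> 'b::euclidean_space"
  assumes lin: "linear f" and inn: "\<And>x y. inner (f x) (f y) = inner x y" and dim: "DIM('b) = DIM('a)"
    and C: "cconvex C"
  shows "mdiff (map f us) (f ` C) = mdiff us C"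
  using C
proof (induction us arbitrary: C)
  case Nil
  have fm: "f \<in> borel_measurable borel"
    using lin by (intro borel_measurable_continuous_onI linear_continuous_on) (simp add: linear_conv_bounded_linear)
  have nf: "norm (f x) = norm x" for x using inn by (simp add: norm_eq_sqrt_inner)
  have "inj f" using lin nf by (metis linear_injective_0 norm_eq_zero)
  then have vi: "f -` (f ` C) = C" by (simp add: inj_vimage_image_eq)
  have cf: "cconvex (f ` C)" by (rule cconvex_linear_image[OF lin Nil])
  have leb: "measure lebesgue D = measure lborel D" if "cconvex D" for D :: "'c::euclidean_space set"
    using that by (intro measure_completion) (auto simp: cconvex_def borel_compact)
  have "emeasure lborel (f ` C) = emeasure (distr lborel borel f) (f ` C)" unfolding lborel_isometry[OF lin inn dim] ..
  also have "\<dots> = emeasure lborel C"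
    using cf fm by (subst emeasure_distr) (auto simp: vi cconvex_def borel_compact)
  finally have "measure lborel (f ` C) = measure lborel C" by (simp add: measure_def)
  then show ?case using leb[OF Nil] leb[OF cf] by simp
next
  case (Cons u us)
  have "f ` (C + seg u) = f ` C + seg (f u)" by (simp add: set_plus_linear_image[OF lin] seg_linear_image[OF lin])
  then show ?case using Cons.IH[of C] Cons.IH[of "C + seg u"] Cons.prems by (simp add: cconvex_plus)
qed

lemma basis_index_isometry:
  obtains f :: "'a::euclidean_space \<Rightarrow> real ^ 'a basis_index"
  where "linear f" "\<And>x y. inner (f x) (f y) = inner x y" "surj f"
proof -
  obtain b :: "nat \<Rightarrow> 'a" where b: "bij_betw b {..<DIM('a)} Basis"
    using ex_bij_betw_nat_finite[of "Basis :: 'a set"] by (auto simp: lessThan_atLeast0)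
  define f :: "'a \<Rightarrow> real ^ 'a basis_index" where "f x = (\<chi> i. inner x (b (Rep_basis_index i)))" for x
  have lin: "linear f" by (rule linearI) (simp_all add: f_def vec_eq_iff inner_add_left)
  have bij: "bij_betw Rep_basis_index (UNIV :: 'a basis_index set) {..<DIM('a)}"
    by (rule bij_betwI[of _ _ _ Abs_basis_index])
      (use Rep_basis_index in \<open>auto simp: Rep_basis_index_inverse Abs_basis_index_inverse\<close>)
  have inn: "inner (f x) (f y) = inner x y" for x y
  proof -
    have "inner (f x) (f y) = (\<Sum>i\<in>UNIV. inner x (b (Rep_basis_index i)) * inner y (b (Rep_basis_index (i :: 'a basis_index))))"
      by (simp add: inner_vec_def f_def)
    also have "\<dots> = (\<Sum>k<DIM('a). inner x (b k) * inner y (b k))" by (rule sum.reindex_bij_betw[OF bij])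
    also have "\<dots> = (\<Sum>v\<in>Basis. inner x v * inner y v)" by (rule sum.reindex_bij_betw[OF b])
    finally show ?thesis by (simp add: euclidean_inner[of x y])
  qed
  have "inj f"
  proof (rule linear_injective_0[OF lin, THEN iffD2], intro allI impI)
    fix x assume "f x = 0"
    then have "inner x x = 0" using inn[of x x] by simp
    then show "x = 0" by simp
  qed
  then have "dim (range f) = DIM('a)" using dim_image_eq[OF lin, of UNIV] by (simp add: dim_UNIV)
  then have "span (range f) = UNIV" using dim_eq_full[of "range f"] by (simp add: CARD_basis_index)
  moreover have "subspace (range f)" using linear_subspace_image[OF lin subspace_UNIV] .
  ultimately have "surj f" by (simp add: span_eq_iff[THEN iffD2])
  then show ?thesis using that lin inn by blast
qed

text \<open>With \<open>E\<close> the span of \<open>us\<close>, projecting \<open>K\<close> onto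
  the orthogonal complement of \<open>E\<close> removes the directions \<open>us\<close>, and
  projecting \<open>L\<close> onto \<open>E\<close> removes \<open>bs\<close>. Both volumes are then
  differences along orthonormal lists.\<close>

lemma proj_body_mdiff:
  fixes K L :: "'a::euclidean_space set"
  assumes pb: "is_proj_body i K L" and K: "cconvex K" and L: "cconvex L" and i: "i \<le> DIM('a)"
    and us: "length us = DIM('a) - i" "length bs = i" "orthonormal_list (us @ bs)"
  shows "mdiff us K = mdiff bs L"
proof -
  define E where "E = span (set us)"
  have ous: "orthonormal_list us" and obs: "orthonormal_list bs" and ub: "\<And>u b. u \<in> set us \<Longrightarrow> b \<in> set bs \<Longrightarrow> inner u b = 0"
    using us(3) by (auto simp: orthonormal_list_append_iff)
  have "dim E = DIM('a) - i"
  proof -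
    have "distinct us"
      using ous unfolding distinct_conv_nth orthonormal_list_def by (metis zero_neq_one)
    moreover have "independent (set us)"
    proof (rule pairwise_orthogonal_independent)
      show "pairwise orthogonal (set us)"
        using ous by (auto simp: pairwise_def orthogonal_def orthonormal_list_def in_set_conv_nth)
      show "0 \<notin> set us" using orthonormal_list_norm[OF ous] by force
    qed
    ultimately show ?thesis using us(1) by (simp add: E_def dim_eq_card_independent distinct_card)
  qed
  moreover have sE: "subspace E" by (simp add: E_def)
  ultimately have "vol_sub i (orthogonal_comp E) (orth_proj (orthogonal_comp E) ` K) = vol_sub (DIM('a) - i) E (orth_proj E ` L)"
    using pb unfolding is_proj_body_def by blast
  moreover have "vol_sub (DIM('a) - i) E (orth_proj E ` L) = mdiff bs L"
  proof (rule vol_sub_orth_proj[OF sE \<open>dim E = DIM('a) - i\<close> L obs])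
    show "length bs = DIM('a) - (DIM('a) - i)" using us(2) i by simp
    show "inner b x = 0" if b: "b \<in> set bs" and x: "x \<in> E" for b x
      using x unfolding E_def
    proof (rule span_induct)
      show "subspace {x. inner b x = 0}" by (rule subspaceI) (auto simp: inner_add_right)
    qed (use ub b in \<open>auto simp: inner_commute\<close>)
  qed
  moreover have "vol_sub i (orthogonal_comp E) (orth_proj (orthogonal_comp E) ` K) = mdiff us K"
  proof (rule vol_sub_orth_proj[OF _ _ K ous us(1)])
    show "subspace (orthogonal_comp E)" by (rule subspace_orthogonal_comp)
    have "dim {y \<in> UNIV. \<forall>x\<in>E. orthogonal x y} + dim E = dim (UNIV :: 'a set)"
      by (rule dim_subspace_orthogonal_to_vectors) (use sE in auto)
    moreover have "{y \<in> UNIV. \<forall>x\<in>E. orthogonal x y} = orthogonal_comp E" by (auto simp: orthogonal_comp_def)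
    ultimately show "dim (orthogonal_comp E) = i" using \<open>dim E = DIM('a) - i\<close> i by (simp add: dim_UNIV)
    show "inner u x = 0" if "u \<in> set us" "x \<in> orthogonal_comp E" for u x
      using that span_base[of u "set us"] by (auto simp: orthogonal_comp_def orthogonal_def E_def)
  qed
  ultimately show ?thesis by simp
qed

section \<open>Mixed volumes as polynomial coefficients\<close>

lemma sym_convex_body_cconvex: "sym_convex_body K \<Longrightarrow> cconvex K"
  by (simp add: sym_convex_body_def cconvex_def)

lemma sym_convex_body_nonempty: "sym_convex_body K \<Longrightarrow> K \<noteq> {}"
  using interior_subset by (auto simp: sym_convex_body_def)

lemma minkowski_polynomial:
  fixes K L :: "'a::euclidean_space set"
  assumes K: "cconvex K" and L: "sym_convex_body L"
  shows "\<exists>\<alpha>. \<forall>t\<ge>0. measure lebesgue (K + (*\<^sub>R) t ` L) = (\<Sum>i<Suc DIM('a). \<alpha> i * t ^ i)"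
proof -
  have cL: "cconvex L" using L by (rule sym_convex_body_cconvex)
  obtain \<epsilon> zp zn where z: "\<And>r. zono_approx L (\<epsilon> r) (zp r) (zn r)" "\<epsilon> \<longlonglongrightarrow> 0" "0 \<in> L"
    using zono_approx_sequence[OF cL sym_convex_body_nonempty[OF L]] L unfolding sym_convex_body_def by blast
  have "bounded K" using K by (simp add: cconvex_def compact_imp_bounded)
  then obtain r where "\<And>x. x \<in> K \<Longrightarrow> norm x \<le> r" unfolding bounded_iff by blast
  then have r: "norm x \<le> \<bar>r\<bar>" if "x \<in> K" for x using that abs_ge_self order_trans by blast
  have "\<exists>a. (\<forall>p\<in>(UNIV :: unit set). \<forall>t\<ge>0. mdiff [] (K + (*\<^sub>R) t ` L) = (\<Sum>i<Suc DIM('a). a i p * t ^ i)) \<and>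
    (\<forall>i<Suc DIM('a). iter_lim zp zn i (UNIV :: unit set) (\<lambda>vs p. mdiff ([] @ vs) K) (\<lambda>p. fact i * a i p))"
    by (rule mdiff_polynomial_family[OF cL z(3,1,2), where R = "\<bar>r\<bar>"]) (use K r in auto)
  then obtain a where "\<forall>t\<ge>0. mdiff [] (K + (*\<^sub>R) t ` L) = (\<Sum>i<Suc DIM('a). a i () * t ^ i)" by blast
  then show ?thesis by (intro exI[of _ "\<lambda>i. a i ()"]) simp
qed

lemma scaled_sum_measure:
  fixes K L :: "'a::euclidean_space set"
  assumes \<alpha>: "\<And>t. t \<ge> 0 \<Longrightarrow> measure lebesgue (K + (*\<^sub>R) t ` L) = (\<Sum>i<Suc DIM('a). \<alpha> i * t ^ i)"
    and s: "s > 0" and t: "t \<ge> 0"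
  shows "measure lebesgue ((*\<^sub>R) s ` K + (*\<^sub>R) t ` L) = (\<Sum>i\<le>DIM('a). \<alpha> (DIM('a) - i) * s ^ i * t ^ (DIM('a) - i))"
proof -
  have "(*\<^sub>R) s ` (K + (*\<^sub>R) (t / s) ` L) = (*\<^sub>R) s ` K + (*\<^sub>R) t ` L"
    using s by (simp add: set_plus_linear_image[OF linear_scaleR_right] image_image)
  then have "measure lebesgue ((*\<^sub>R) s ` K + (*\<^sub>R) t ` L) = s ^ DIM('a) * measure lebesgue (K + (*\<^sub>R) (t / s) ` L)"
    using mdiff_homothety[of s "[]" "K + (*\<^sub>R) (t / s) ` L"] s by simp
  also have "\<dots> = (\<Sum>i\<le>DIM('a). s ^ DIM('a) * (\<alpha> i * (t / s) ^ i))"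
    using s t by (simp only: \<alpha> divide_nonneg_pos sum_distrib_left lessThan_Suc_atMost)
  also have "\<dots> = (\<Sum>i\<le>DIM('a). \<alpha> i * s ^ (DIM('a) - i) * t ^ i)"
  proof (rule sum.cong[OF refl])
    fix i assume "i \<in> {..DIM('a)}"
    then have "s ^ DIM('a) = s ^ (DIM('a) - i) * s ^ i" by (simp flip: power_add)
    then show "s ^ DIM('a) * (\<alpha> i * (t / s) ^ i) = \<alpha> i * s ^ (DIM('a) - i) * t ^ i"
      using s by (simp add: power_divide)
  qed
  also have "\<dots> = (\<Sum>i\<le>DIM('a). \<alpha> (DIM('a) - i) * s ^ i * t ^ (DIM('a) - i))"
    by (rule sum.reindex_bij_witness[of _ "\<lambda>i. DIM('a) - i" "\<lambda>i. DIM('a) - i"]) auto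
  finally show ?thesis .
qed

text \<open>Both polynomials describe the same two-variable volume, dehomogenised in either body, so
  their coefficients are reversed. Homogeneity extends them to all \<open>s\<close> and
  \<open>t\<close>, which gives existence for \<open>mixed_vol\<close>; uniqueness follows by
  comparing coefficients at \<open>t = 1\<close>.\<close>

lemma mixed_vol_coefficient:
  fixes K L :: "'a::euclidean_space set"
  assumes K: "sym_convex_body K" and L: "sym_convex_body L" and j: "j \<le> DIM('a)"
    and \<alpha>: "\<And>t. t \<ge> 0 \<Longrightarrow> measure lebesgue (K + (*\<^sub>R) t ` L) = (\<Sum>i<Suc DIM('a). \<alpha> i * t ^ i)"
    and \<beta>: "\<And>t. t \<ge> 0 \<Longrightarrow> measure lebesgue (L + (*\<^sub>R) t ` K) = (\<Sum>i<Suc DIM('a). \<beta> i * t ^ i)"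
  shows "\<alpha> (DIM('a) - j) = \<beta> j" and "mixed_vol K L j = \<beta> j / real (DIM('a) choose j)"
proof -
  let ?n = "DIM('a)"
  have ne: "K \<noteq> {}" "L \<noteq> {}" using K L sym_convex_body_nonempty by auto
  have \<beta>\<alpha>: "\<beta> i = \<alpha> (?n - i)" if i: "i \<le> ?n" for i
  proof (rule poly_coeff_unique[where a = \<beta> and b = "\<lambda>i. \<alpha> (?n - i)" and k = "Suc ?n"])
    fix s :: real assume s: "s > 0"
    have "measure lebesgue ((*\<^sub>R) s ` K + (*\<^sub>R) 1 ` L) = (\<Sum>i\<le>?n. \<alpha> (?n - i) * s ^ i * 1 ^ (?n - i))"
      by (rule scaled_sum_measure[OF \<alpha> s]) auto
    moreover have "(*\<^sub>R) s ` K + (*\<^sub>R) 1 ` L = L + (*\<^sub>R) s ` K" by (simp add: add.commute)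
    ultimately show "(\<Sum>i<Suc ?n. \<beta> i * s ^ i) = (\<Sum>i<Suc ?n. \<alpha> (?n - i) * s ^ i)"
      using \<beta>[of s] s by (simp add: lessThan_Suc_atMost)
  qed (use i in simp)
  then show "\<alpha> (?n - j) = \<beta> j" using j by simp
  have set_eq: "{s *\<^sub>R x + t *\<^sub>R y | x y. x \<in> K \<and> y \<in> L} = (*\<^sub>R) s ` K + (*\<^sub>R) t ` L" for s t
    unfolding set_plus_def by blast
  define a where "a i = \<beta> i / real (?n choose i)" for i
  have vol: "measure lebesgue {s *\<^sub>R x + t *\<^sub>R y | x y. x \<in> K \<and> y \<in> L} =
      (\<Sum>i\<le>?n. real (?n choose i) * a i * s ^ i * t ^ (?n - i))" if st: "s \<ge> 0" "t \<ge> 0" for s t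
  proof -
    have ca: "real (?n choose i) * a i = \<beta> i" if "i \<le> ?n" for i using that by (simp add: a_def)
    have "measure lebesgue ((*\<^sub>R) s ` K + (*\<^sub>R) t ` L) = (\<Sum>i\<le>?n. \<beta> i * s ^ i * t ^ (?n - i))"
    proof (cases "s = 0")
      case False
      then show ?thesis using scaled_sum_measure[OF \<alpha>, of s t] st by (simp add: \<beta>\<alpha>)
    next
      \<comment> \<open>\<open>scaled_sum_measure\<close> divides by \<open>s\<close>. At
        \<open>s = 0\<close> only the term \<open>i = 0\<close> survives, because
        \<open>0 ^ 0 = 1\<close>, and it is the volume of \<open>t L\<close>.\<close>
      case True
      have "(*\<^sub>R) 0 ` K = {0}" using ne by auto
      then have "measure lebesgue ((*\<^sub>R) s ` K + (*\<^sub>R) t ` L) = t ^ ?n * measure lebesgue L"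
        using mdiff_homothety[of t "[]" L] st True by simp
      also have "measure lebesgue L = \<beta> 0"
      proof -
        have "(*\<^sub>R) 0 ` K = {0}" using ne by auto
        then show ?thesis using \<beta>[of 0] by (simp add: sum.lessThan_Suc_shift del: sum.lessThan_Suc)
      qed
      also have "t ^ ?n * \<beta> 0 = (\<Sum>i\<le>?n. if i = 0 then \<beta> i * t ^ ?n else 0)" by simp
      also have "\<dots> = (\<Sum>i\<le>?n. \<beta> i * s ^ i * t ^ (?n - i))"
        using True by (intro sum.cong) auto
      finally show ?thesis .
    qed
    then show ?thesis unfolding set_eq by (simp add: ca)
  qed
  show "mixed_vol K L j = \<beta> j / real (?n choose j)"
    unfolding mixed_vol_def
  proof (rule the_equality)
    show "\<exists>b. (\<forall>s t. s \<ge> 0 \<longrightarrow> t \<ge> 0 \<longrightarrow> measure lebesgue {s *\<^sub>R x + t *\<^sub>R y | x y. x \<in> K \<and> y \<in> L} =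
        (\<Sum>i\<le>?n. real (?n choose i) * b i * s ^ i * t ^ (?n - i))) \<and> \<beta> j / real (?n choose j) = b j"
      using vol by (intro exI[of _ a]) (auto simp: a_def)
    fix c assume "\<exists>b. (\<forall>s t. s \<ge> 0 \<longrightarrow> t \<ge> 0 \<longrightarrow> measure lebesgue {s *\<^sub>R x + t *\<^sub>R y | x y. x \<in> K \<and> y \<in> L} =
        (\<Sum>i\<le>?n. real (?n choose i) * b i * s ^ i * t ^ (?n - i))) \<and> c = b j"
    then obtain b where b: "\<And>s t. s \<ge> 0 \<Longrightarrow> t \<ge> 0 \<Longrightarrow> measure lebesgue {s *\<^sub>R x + t *\<^sub>R y | x y. x \<in> K \<and> y \<in> L} =
        (\<Sum>i\<le>?n. real (?n choose i) * b i * s ^ i * t ^ (?n - i))" "c = b j" by blast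
    have "real (?n choose j) * b j = real (?n choose j) * a j"
    proof (rule poly_coeff_unique[where a = "\<lambda>i. real (?n choose i) * b i" and b = "\<lambda>i. real (?n choose i) * a i" and k = "Suc ?n"])
      fix s :: real assume s: "s > 0"
      show "(\<Sum>i<Suc ?n. real (?n choose i) * b i * s ^ i) = (\<Sum>i<Suc ?n. real (?n choose i) * a i * s ^ i)"
        using b(1)[of s 1] vol[of s 1] s unfolding lessThan_Suc_atMost by simp
    qed (use j in simp)
    moreover have "real (?n choose j) \<noteq> 0" using j by simp
    ultimately have "b j = a j" using mult_left_cancel by blast
    then show "c = \<beta> j / real (?n choose j)" using b(2) by (simp add: a_def)
  qed
qed

theorem theorem5p4:
  fixes K1 K2 L1 L2 :: "'a::euclidean_space set" and j :: nat
  assumes "DIM('a) \<ge> 3" and "1 \<le> j" and "j \<le> DIM('a) - 1"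
    and "sym_convex_body K1" and "sym_convex_body K2"
    and "sym_convex_body L1" and "sym_convex_body L2"
    and "is_proj_body j K1 L1"
    and "is_proj_body (DIM('a) - j) K2 L2"
  shows "mixed_vol K1 K2 j = mixed_vol L1 L2 (DIM('a) - j)"
proof -
  define m where "m = DIM('a) - j"
  have j: "j \<le> DIM('a)" and m: "m \<le> DIM('a)" "DIM('a) - m = j" using assms(3) by (auto simp: m_def)
  note sym = assms(4-7)
  note cc = sym[THEN sym_convex_body_cconvex]
  note ne = sym[THEN sym_convex_body_nonempty]
  obtain f :: "'a \<Rightarrow> real ^ 'a basis_index" where f: "linear f" "\<And>x y. inner (f x) (f y) = inner x y" "surj f"
    using basis_index_isometry by blast
  have dim: "DIM(real ^ 'a basis_index) = DIM('a)" by (simp add: CARD_basis_index)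
  note iso = mdiff_isometry[OF f(1,2) dim]
  have pull: "\<exists>us'. us = map f us'" for us
    using f(3) by (metis ex_map_conv surjD)
  have on: "orthonormal_list (map f us) \<longleftrightarrow> orthonormal_list us" for us
    by (simp add: orthonormal_list_def f(2))
  obtain \<alpha> where \<alpha>: "\<And>t. t \<ge> 0 \<Longrightarrow> measure lebesgue (K1 + (*\<^sub>R) t ` K2) = (\<Sum>i<Suc DIM('a). \<alpha> i * t ^ i)"
    using minkowski_polynomial[OF cc(1) sym(2)] by blast
  obtain \<alpha>' where \<alpha>': "\<And>t. t \<ge> 0 \<Longrightarrow> measure lebesgue (K2 + (*\<^sub>R) t ` K1) = (\<Sum>i<Suc DIM('a). \<alpha>' i * t ^ i)"
    using minkowski_polynomial[OF cc(2) sym(1)] by blast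
  obtain \<beta> where \<beta>: "\<And>t. t \<ge> 0 \<Longrightarrow> measure lebesgue (L2 + (*\<^sub>R) t ` L1) = (\<Sum>i<Suc DIM('a). \<beta> i * t ^ i)"
    using minkowski_polynomial[OF cc(4) sym(3)] by blast
  obtain \<beta>' where \<beta>': "\<And>t. t \<ge> 0 \<Longrightarrow> measure lebesgue (L1 + (*\<^sub>R) t ` L2) = (\<Sum>i<Suc DIM('a). \<beta>' i * t ^ i)"
    using minkowski_polynomial[OF cc(3) sym(4)] by blast
  have dual1: "mdiff us (f ` K1) = mdiff bs (f ` L1)"
    if len: "length us = m" "length bs = DIM('a) - m" and o: "orthonormal_list (us @ bs)" for us bs
  proof -
    obtain us' bs' where ub: "us = map f us'" "bs = map f bs'" using pull by metis
    have "mdiff us' K1 = mdiff bs' L1"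
      using len o on[of "us' @ bs'"] m by (intro proj_body_mdiff[OF assms(8) cc(1,3) j]) (auto simp: ub m_def[symmetric])
    then show ?thesis by (simp add: ub iso cc)
  qed
  have dual2: "mdiff us (f ` L2) = mdiff bs (f ` K2)"
    if len: "length us = m" "length bs = DIM('a) - m" and o: "orthonormal_list (us @ bs)" for us bs
  proof -
    obtain us' bs' where ub: "us = map f us'" "bs = map f bs'" using pull by metis
    have "orthonormal_list (us' @ bs')" using o on[of "us' @ bs'"] by (simp add: ub)
    \<comment> \<open>For the second pair the roles of the two lists are exchanged, because its
      index is the complementary dimension.\<close>
    then have "orthonormal_list (bs' @ us')" unfolding orthonormal_list_append_iff by (metis inner_commute)
    then have "mdiff bs' K2 = mdiff us' L2"
      using len m by (intro proj_body_mdiff[OF assms(9)[folded m_def] cc(2,4) m(1)]) (auto simp: ub)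
    then show ?thesis by (simp add: ub iso cc)
  qed
  have fsum: "measure lebesgue (f ` A + (*\<^sub>R) t ` f ` B) = measure lebesgue (A + (*\<^sub>R) t ` B)"
    if "cconvex A" "cconvex B" for A B t
  proof -
    have "f ` A + (*\<^sub>R) t ` f ` B = f ` (A + (*\<^sub>R) t ` B)"
      by (simp add: set_plus_linear_image[OF f(1)] image_image linear_cmul[OF f(1)])
    then show ?thesis using iso[of "A + (*\<^sub>R) t ` B" "[]"] that by (simp add: cconvex_plus cconvex_scaleR)
  qed
  have negs: "- y \<in> f ` K" if "\<And>x. x \<in> K \<Longrightarrow> - x \<in> K" "y \<in> f ` K" for y K
    using that by (auto simp: linear_neg[OF f(1), symmetric])
  have "\<alpha> m = \<beta> m"
  proof (rule mixed_coefficient_duality[of "f ` K1" "f ` K2" "f ` L1" "f ` L2" m])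
    show "cconvex (f ` K1)" "cconvex (f ` K2)" "cconvex (f ` L1)" "cconvex (f ` L2)"
      by (intro cconvex_linear_image f(1) cc)+
    show "f ` K2 \<noteq> {}" "f ` L1 \<noteq> {}" using ne by auto
    show "- x \<in> f ` K2" if "x \<in> f ` K2" for x using negs[OF _ that] sym(2) by (auto simp: sym_convex_body_def)
    show "- x \<in> f ` L1" if "x \<in> f ` L1" for x using negs[OF _ that] sym(3) by (auto simp: sym_convex_body_def)
    show "m \<le> CARD('a basis_index)" using m by (simp add: CARD_basis_index)
    show "mdiff us (f ` K1) = mdiff bs (f ` L1)" "mdiff us (f ` L2) = mdiff bs (f ` K2)"
      if "length us = m" "length bs = CARD('a basis_index) - m" "orthonormal_list (us @ bs)" for us bs
      using dual1 dual2 that by (simp_all add: CARD_basis_index)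
    show "measure lebesgue (f ` K1 + (*\<^sub>R) t ` f ` K2) = (\<Sum>i<Suc CARD('a basis_index). \<alpha> i * t ^ i)"
      "measure lebesgue (f ` L2 + (*\<^sub>R) t ` f ` L1) = (\<Sum>i<Suc CARD('a basis_index). \<beta> i * t ^ i)" if "t \<ge> 0" for t
      unfolding fsum[OF cc(1,2)] fsum[OF cc(4,3)] CARD_basis_index using \<alpha>[OF that] \<beta>[OF that] by simp_all
  qed
  moreover have "mixed_vol K1 K2 j = \<alpha> m / real (DIM('a) choose j)"
    using mixed_vol_coefficient[OF sym(1,2) j \<alpha> \<alpha>'] by (simp add: m_def)
  \<comment> \<open>The exponent of \<open>t\<close> in the volume of \<open>L2 + t L1\<close>
    counts the copies of \<open>L1\<close>, so \<beta> supplies the coefficient here.\<close>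
  moreover have "mixed_vol L1 L2 m = \<beta> m / real (DIM('a) choose m)"
    by (rule mixed_vol_coefficient(2)[OF sym(3,4) m(1) \<beta>' \<beta>])
  moreover have "DIM('a) choose m = DIM('a) choose j" using binomial_symmetric[OF j] by (simp add: m_def)
  ultimately show ?thesis by (simp add: m_def)
qed

end
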